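(* There exists a function $C\colon(0,\infty)\to\mathbb{R}$ (so that the constant $C(W_0)$ below depends only on $W_0$) such that the following holds. Let $f\colon[-1,1]^2\to\mathbb{C}$ and $g\colon[-1,1]^2\to\mathbb{R}$ admit infinitely differentiable extensions to an open neighborhood of $[-1,1]^2$ such that the extension of $g_x=\partial g/\partial x$ is nonzero in the neighborhood. Put $$G_0=\min_{[-1,1]^2}|g_x|,\qquad G_1=\max_{[-1,1]^2}|g_x|,\qquad W=\max_{y\in[-1,1]}\left|\int_{-1}^{1}g_x(x,y)\,\mathrm{d}x\right|,$$ $$\boldsymbol{u}(x,y)=\left(\frac1W\int_{-1}^{x}g_x(t,y)\,\mathrm{d}t,\;y\right),\qquad (x,y)\in[-1,1]^2,$$ let $\Omega_{\boldsymbol u}=\boldsymbol u((-1,1)^2)$ (so $\overline{\Omega}_{\boldsymbol u}\subset[-1,1]^2$, and $\boldsymbol u$ is a bijection of $[-1,1]^2$ onto $\overline{\Omega}_{\boldsymbol u}$), and define $h\colon\overline{\Omega}_{\boldsymbol u}\to\mathbb{C}$ by $$h(x',y')=f(\boldsymbol u^{-1}(x',y'))\,\det(D\boldsymbol u^{-1})(x',y').$$ Let $0<\varepsilon<1$ and let $W_0=c_h(\varepsilon)$, assumed positive. Then there exists an infinitely differentiable function $p_b\colon[-1,1]^2\to\mathbb{C}$ such that 1. $p_b(\boldsymbol u^{-1}(x',y'))$ is the restriction to $\overline{\Omega}_{\boldsymbol u}$ of an entire function in $\mathcal{S}'(\mathbb{R}^2)$ whose Fourier transform is a tempered distribution of order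 at most $1$ supported in $[-W_0,W_0]^2$; 2. $\left|\dfrac{\partial p_b}{\partial x}(x,y)+i\,\dfrac{\partial g}{\partial x}(x,y)\,p_b(x,y)-f(x,y)\right|\le\varepsilon\,\dfrac{G_1}{G_0}\,\|f\|_{L^\infty([-1,1]^2)}$ for all $(x,y)\in[-1,1]^2$; 3. $\|p_b\|_{L^\infty([-1,1]^2)}\le C(W_0)\,\dfrac{W}{G_0}\,\min\left\{1,\dfrac1W\right\}\|f\|_{L^\infty([-1,1]^2)}$; 4. $\left\|\dfrac{\partial p_b}{\partial x}\right\|_{L^\infty([-1,1]^2)}\le C(W_0)\,\dfrac{G_1}{G_0}\,\min\left\{1,\dfrac1W\right\}\|f\|_{L^\infty([-1,1]^2)}$.
   Context: $\mathcal{S}(\mathbb{R}^2)$ is the Schwartz space and $\mathcal{S}'(\mathbb{R}^2)$ the space of tempered distributions. The Fourier transform is $\hat\varphi(\xi_1,\xi_2)=\frac{1}{4\pi^2}\int_{\mathbb{R}^2}\varphi(x,y)e^{-i(\xi_1x+\xi_2y)}\,\mathrm{d}x\,\mathrm{d}y$ for $\varphi\in\mathcal S(\mathbb{R}^2)$, extended to $\mathcal{S}'(\mathbb{R}^2)$ by $\langle\hat T,\varphi\rangle=\langle T,\hat\varphi\rangle$. A function (or tempered distribution) has bandlimit $c$ if its Fourier transform is supported in $[-c,c]^2$ ($c$ need not be minimal). Order: $T\in\mathcal S'(\mathbb{R}^2)$ is of order at most $m$ if for each compact $K$ there is a constant $M_K$ with $|\langle T,\varphi\rangle|\le M_K\sup_{|\alpha|\le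 m}\sup_{K}|D^\alpha\varphi|$ for every $\varphi\in\mathcal S(\mathbb{R}^2)$ supported in $K$; its order is the least such $m$. $\varepsilon$-bandlimited approximation: let $\Omega\subset[-1,1]^2$ be closed, let $h\colon\Omega\to\mathbb{C}$ admit an infinitely differentiable extension to an open neighborhood of $\Omega$, and let $0<\varepsilon<1$. A function $h_b\in\mathcal S(\mathbb{R}^2)$ is an $\varepsilon$-bandlimited approximation of $h$ if it has some finite bandlimit and (1) $\|h_b-h\|_{L^\infty(\Omega)}\le\varepsilon\|h\|_{L^\infty(\Omega)}$; (2) $\|h_b\|_{L^\infty(\mathbb{R}^2)}\le3\|h\|_{L^\infty(\Omega)}$; (3) $\|D^{\alpha}\hat h_b\|_{L^\infty(\mathbb{R}^2)}\le10\|h\|_{L^\infty(\Omega)}$ for all multi-indices $|\alpha|\le2$. The number $c_h(\varepsilon)$ is the infimum of the set of $c>0$ such that there exists an $\varepsilon$-bandlimited approximation of $h$ with bandlimit $c$ (this set is nonempty, so $c_h(\varepsilon)<\infty$; $c_h(\varepsilon)=0$ only if $h$ is the zero function). *)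

theory Defs
  imports "HOL-Analysis.Analysis"
begin

subsection \<open>Smooth functions of two real variables\<close>

text \<open>The partial derivatives are taken within \<^term>\<open>S\<close>: for open \<^term>\<open>S\<close> these are the ordinary
  ones, and on a closed square they are one-sided at the edges.\<close>

definition partial_x ::
    "(real \<times> real) set \<Rightarrow> (real \<times> real \<Rightarrow> 'a::real_normed_vector) \<Rightarrow> real \<times> real \<Rightarrow> 'a" where
  "partial_x S f = (\<lambda>(x, y). vector_derivative (\<lambda>t. f (t, y)) (at x within {t. (t, y) \<in> S}))"

definition partial_y ::
    "(real \<times> real) set \<Rightarrow> (real \<times> real \<Rightarrow> 'a::real_normed_vector) \<Rightarrow> real \<times> real \<Rightarrow> 'a" where
  "partial_y S f = (\<lambda>(x, y). vector_derivative (\<lambda>t. f (x, t)) (at y within {t. (x, t) \<in> S}))"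

text \<open>Only used for open \<^term>\<open>U\<close>.\<close>

primrec C_k_on ::
    "nat \<Rightarrow> (real \<times> real) set \<Rightarrow> (real \<times> real \<Rightarrow> 'a::real_normed_vector) \<Rightarrow> bool" where
  "C_k_on 0 U f \<longleftrightarrow> continuous_on U f"
| "C_k_on (Suc k) U f \<longleftrightarrow>
     f differentiable_on U \<and> C_k_on k U (partial_x U f) \<and> C_k_on k U (partial_y U f)"

definition smooth_on ::
    "(real \<times> real) set \<Rightarrow> (real \<times> real \<Rightarrow> 'a::real_normed_vector) \<Rightarrow> bool" where
  "smooth_on U f \<longleftrightarrow> (\<forall>k. C_k_on k U f)"

text \<open>A function on \<^term>\<open>S\<close> is represented by a total function whose values off \<^term>\<open>S\<close> are
  irrelevant; \<^term>\<open>F\<close> is its extension to the neighbourhood \<^term>\<open>U\<close>.\<close>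

definition smooth_extension ::
    "(real \<times> real) set \<Rightarrow> (real \<times> real \<Rightarrow> 'a::real_normed_vector) \<Rightarrow>
     (real \<times> real) set \<Rightarrow> (real \<times> real \<Rightarrow> 'a) \<Rightarrow> bool" where
  "smooth_extension S f U F \<longleftrightarrow> open U \<and> S \<subseteq> U \<and> smooth_on U F \<and> (\<forall>z\<in>S. F z = f z)"

definition deriv_multi :: "nat \<times> nat \<Rightarrow> (real \<times> real \<Rightarrow> complex) \<Rightarrow> real \<times> real \<Rightarrow> complex" where
  "deriv_multi \<alpha> f = (partial_x UNIV ^^ fst \<alpha>) ((partial_y UNIV ^^ snd \<alpha>) f)"

text \<open>Where it renders an \<open>L\<^sup>\<infinity>\<close> norm, \<^term>\<open>f\<close> is bounded and continuous and \<^term>\<open>S\<close> is the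
  closure of an open set, so that the essential supremum is the supremum.\<close>

definition sup_norm :: "(real \<times> real) set \<Rightarrow> (real \<times> real \<Rightarrow> complex) \<Rightarrow> real" where
  "sup_norm S f = (SUP z\<in>S. norm (f z))"

definition square :: "real \<Rightarrow> (real \<times> real) set" where
  "square c = {-c..c} \<times> {-c..c}"

definition fun_support :: "(real \<times> real \<Rightarrow> complex) \<Rightarrow> (real \<times> real) set" where
  "fun_support f = closure {z. f z \<noteq> 0}"


subsection \<open>Schwartz functions and tempered distributions\<close>

definition weighted_deriv ::
    "nat \<times> nat \<Rightarrow> nat \<times> nat \<Rightarrow> (real \<times> real \<Rightarrow> complex) \<Rightarrow> real \<times> real \<Rightarrow> complex" where
  "weighted_deriv \<beta> \<alpha> f = (\<lambda>z. of_real (fst z ^ fst \<beta> * snd z ^ snd \<beta>) * deriv_multi \<alpha> f z)"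

definition schwartz :: "(real \<times> real \<Rightarrow> complex) set" where
  "schwartz = {f. smooth_on UNIV f \<and> (\<forall>\<beta> \<alpha>. bounded (range (weighted_deriv \<beta> \<alpha> f)))}"

definition schwartz_tendsto ::
    "(nat \<Rightarrow> real \<times> real \<Rightarrow> complex) \<Rightarrow> (real \<times> real \<Rightarrow> complex) \<Rightarrow> bool" where
  "schwartz_tendsto \<Phi> \<phi> \<longleftrightarrow>
     (\<forall>\<beta> \<alpha>. (\<lambda>n. sup_norm UNIV (weighted_deriv \<beta> \<alpha> (\<lambda>z. \<Phi> n z - \<phi> z))) \<longlonglongrightarrow> 0)"

text \<open>Continuous linear functionals on the Schwartz space; since this space is metrizable,
  continuity is sequential continuity. Values off \<^const>\<open>schwartz\<close> are irrelevant.\<close>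

definition tempered :: "((real \<times> real \<Rightarrow> complex) \<Rightarrow> complex) \<Rightarrow> bool" where
  "tempered T \<longleftrightarrow>
     (\<forall>\<phi>\<in>schwartz. \<forall>\<psi>\<in>schwartz. \<forall>a b. T (\<lambda>z. a * \<phi> z + b * \<psi> z) = a * T \<phi> + b * T \<psi>) \<and>
     (\<forall>\<Phi> \<phi>. (\<forall>n. \<Phi> n \<in> schwartz) \<and> \<phi> \<in> schwartz \<and> schwartz_tendsto \<Phi> \<phi> \<longrightarrow>
        (\<lambda>n. T (\<Phi> n)) \<longlonglongrightarrow> T \<phi>)"

definition fourier :: "(real \<times> real \<Rightarrow> complex) \<Rightarrow> real \<times> real \<Rightarrow> complex" where
  "fourier \<phi> = (\<lambda>(\<xi>\<^sub>1, \<xi>\<^sub>2). of_real (1 / (4 * pi\<^sup>2)) *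
     (LINT (x, y)|lborel. \<phi> (x, y) * exp (- (\<i> * of_real (\<xi>\<^sub>1 * x + \<xi>\<^sub>2 * y)))))"

definition fourier_dist ::
    "((real \<times> real \<Rightarrow> complex) \<Rightarrow> complex) \<Rightarrow> (real \<times> real \<Rightarrow> complex) \<Rightarrow> complex" where
  "fourier_dist T = (\<lambda>\<phi>. T (fourier \<phi>))"

definition dist_of_fun ::
    "(real \<times> real \<Rightarrow> complex) \<Rightarrow> (real \<times> real \<Rightarrow> complex) \<Rightarrow> complex" where
  "dist_of_fun F = (\<lambda>\<phi>. LINT z|lborel. F z * \<phi> z)"

text \<open>A function that is a tempered distribution. The integrability clause excludes the default
  value \<open>0\<close> of the Bochner integral of non-integrable functions.\<close>

definition tempered_fun :: "(real \<times> real \<Rightarrow> complex) \<Rightarrow> bool" where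
  "tempered_fun F \<longleftrightarrow>
     (\<forall>\<phi>\<in>schwartz. integrable lborel (\<lambda>z. F z * \<phi> z)) \<and> tempered (dist_of_fun F)"

definition dist_support :: "((real \<times> real \<Rightarrow> complex) \<Rightarrow> complex) \<Rightarrow> (real \<times> real) set" where
  "dist_support T = - \<Union> {U. open U \<and>
     (\<forall>\<phi>\<in>schwartz. compact (fun_support \<phi>) \<and> fun_support \<phi> \<subseteq> U \<longrightarrow> T \<phi> = 0)}"

definition order_at_most :: "((real \<times> real \<Rightarrow> complex) \<Rightarrow> complex) \<Rightarrow> nat \<Rightarrow> bool" where
  "order_at_most T m \<longleftrightarrow> tempered T \<and>
     (\<forall>K. compact K \<longrightarrow> (\<exists>M. \<forall>\<phi>\<in>schwartz. fun_support \<phi> \<subseteq> K \<longrightarrow>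
        norm (T \<phi>) \<le> M * (SUP \<alpha>\<in>{\<alpha>. fst \<alpha> + snd \<alpha> \<le> m}. sup_norm K (deriv_multi \<alpha> \<phi>))))"

text \<open>Holomorphy on \<open>\<complex>\<^sup>2\<close>: the real Frechet derivative exists and is complex linear.\<close>

definition entire2 :: "(complex \<times> complex \<Rightarrow> complex) \<Rightarrow> bool" where
  "entire2 F \<longleftrightarrow> (\<forall>z. \<exists>a b. (F has_derivative (\<lambda>(h, k). a * h + b * k)) (at z))"

definition real_restriction :: "(complex \<times> complex \<Rightarrow> complex) \<Rightarrow> real \<times> real \<Rightarrow> complex" where
  "real_restriction F = (\<lambda>(x, y). F (of_real x, of_real y))"


subsection \<open>Bandlimited approximation\<close>

definition has_bandlimit :: "(real \<times> real \<Rightarrow> complex) \<Rightarrow> real \<Rightarrow> bool" where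
  "has_bandlimit \<phi> c \<longleftrightarrow> fun_support (fourier \<phi>) \<subseteq> square c"

definition bandlimited_approx ::
    "real \<Rightarrow> (real \<times> real) set \<Rightarrow> (real \<times> real \<Rightarrow> complex) \<Rightarrow> (real \<times> real \<Rightarrow> complex) \<Rightarrow> bool" where
  "bandlimited_approx \<epsilon> \<Omega> h h\<^sub>b \<longleftrightarrow>
     h\<^sub>b \<in> schwartz \<and> (\<exists>c. has_bandlimit h\<^sub>b c) \<and>
     sup_norm \<Omega> (\<lambda>z. h\<^sub>b z - h z) \<le> \<epsilon> * sup_norm \<Omega> h \<and>
     sup_norm UNIV h\<^sub>b \<le> 3 * sup_norm \<Omega> h \<and>
     (\<forall>\<alpha>. fst \<alpha> + snd \<alpha> \<le> 2 \<longrightarrow>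
        sup_norm UNIV (deriv_multi \<alpha> (fourier h\<^sub>b)) \<le> 10 * sup_norm \<Omega> h)"

definition min_bandlimit ::
    "(real \<times> real) set \<Rightarrow> (real \<times> real \<Rightarrow> complex) \<Rightarrow> real \<Rightarrow> real" where
  "min_bandlimit \<Omega> h \<epsilon> =
     Inf {c. 0 < c \<and> (\<exists>h\<^sub>b. bandlimited_approx \<epsilon> \<Omega> h h\<^sub>b \<and> has_bandlimit h\<^sub>b c)}"


subsection \<open>The change of variables determined by the phase\<close>

definition g_x :: "(real \<times> real \<Rightarrow> real) \<Rightarrow> real \<times> real \<Rightarrow> real" where
  "g_x g = partial_x (square 1) g"

text \<open>The infima and suprema are attained, \<^term>\<open>g_x g\<close> being continuous on the square.\<close>

definition G_min :: "(real \<times> real \<Rightarrow> real) \<Rightarrow> real" where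
  "G_min g = (INF z\<in>square 1. \<bar>g_x g z\<bar>)"

definition G_max :: "(real \<times> real \<Rightarrow> real) \<Rightarrow> real" where
  "G_max g = (SUP z\<in>square 1. \<bar>g_x g z\<bar>)"

definition W_of :: "(real \<times> real \<Rightarrow> real) \<Rightarrow> real" where
  "W_of g = (SUP y\<in>{-1..1}. \<bar>integral {-1..1} (\<lambda>x. g_x g (x, y))\<bar>)"

definition u_map :: "(real \<times> real \<Rightarrow> real) \<Rightarrow> real \<times> real \<Rightarrow> real \<times> real" where
  "u_map g = (\<lambda>(x, y). (1 / W_of g * integral {-1..x} (\<lambda>t. g_x g (t, y)), y))"

definition u_domain :: "(real \<times> real \<Rightarrow> real) \<Rightarrow> (real \<times> real) set" where
  "u_domain g = u_map g ` ({-1<..<1} \<times> {-1<..<1})"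

definition u_inv :: "(real \<times> real \<Rightarrow> real) \<Rightarrow> real \<times> real \<Rightarrow> real \<times> real" where
  "u_inv g = the_inv_into (square 1) (u_map g)"

text \<open>On the boundary of \<^term>\<open>S\<close> the derivative is taken within \<^term>\<open>S\<close>.\<close>

definition jacobian_det ::
    "(real \<times> real) set \<Rightarrow> (real \<times> real \<Rightarrow> real \<times> real) \<Rightarrow> real \<times> real \<Rightarrow> real" where
  "jacobian_det S v z =
     (let L = frechet_derivative v (at z within S)
      in det (vector [vector [fst (L (1, 0)), fst (L (0, 1))],
                      vector [snd (L (1, 0)), snd (L (0, 1))]] :: real^2^2))"

definition h_fun ::
    "(real \<times> real \<Rightarrow> complex) \<Rightarrow> (real \<times> real \<Rightarrow> real) \<Rightarrow> real \<times> real \<Rightarrow> complex" where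
  "h_fun f g z = f (u_inv g z) * of_real (jacobian_det (closure (u_domain g)) (u_inv g) z)"

end

theory Submission
  imports Defs "HOL-Probability.Characteristic_Functions" "HOL-Probability.Sinc_Integral"
    "HOL-Complex_Analysis.Great_Picard" "HOL-Real_Asymp.Real_Asymp"
begin

text \<open>In the variables \<open>(x', y') = \<^bold>u(x, y)\<close> the equation \<open>\<partial>\<^sub>x p + \<i> g\<^sub>x p = f\<close> becomes
  \<open>\<partial>\<^sub>x q + \<i> W q = h\<close>. Take \<open>\<epsilon>\<close>-bandlimited approximations of \<open>h\<close> whose bandlimits tend to the
  infimum \<open>W\<^sub>0\<close>. Since the first derivatives of their Fourier transforms are uniformly bounded,
  Arzela-Ascoli yields a limiting Lipschitz symbol \<open>k\<close>, supported in the square of size \<open>W\<^sub>0\<close>, and the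
  inverse transform of \<open>k\<close> still approximates \<open>h\<close> up to \<open>\<epsilon>\<close>. The function
  \<open>q(x, y) = \<integral>\<integral> (k(\<xi>, \<eta>) exp (\<i> (x \<xi> + y \<eta>)) - k(- W, \<eta>) exp (\<i> (- W x + y \<eta>))) / (\<i> (\<xi> + W)) d\<xi> d\<eta>\<close>,
  integrated over that square, solves \<open>\<partial>\<^sub>x q + \<i> W q = \<integral>\<integral> k exp (\<i> (x \<xi> + y \<eta>))\<close>. Subtracting the value on
  the line \<open>\<xi> = - W\<close> removes the singularity at the price of one derivative, whence the order at most
  \<open>1\<close> of the transform of \<open>q\<close>. For \<open>W \<ge> W\<^sub>0\<close> the subtracted term vanishes because \<open>k\<close> is zero on that
  line, and for \<open>W \<ge> 2 W\<^sub>0\<close> the denominator is at least \<open>W / 2\<close>, which gives the factor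
  \<open>min {1, 1 / W}\<close>.\<close>

subsection \<open>Calculus of \<open>C\<^sup>k\<close> functions of two variables\<close>

text \<open>The constant may depend on \<open>W\<^sub>0\<close> only, while \<open>W\<close> is
  arbitrary, so the resonance \<open>\<xi> = - W\<close> may lie inside the band, outside it or near
  its edge, and all estimates must be uniform in its position. Near the resonance the Lipschitz
  bound of the symbol controls the quotient, far from it the denominator does. Formally the
  subtracted term is a function of \<open>y\<close> times the homogeneous solution
  \<open>exp (- \<i> W x)\<close>, so the equation is not affected; it is present only when the
  frequency \<open>- W\<close> belongs to the band, so no frequency outside the square arises. The
  bandlimit must be \<open>W\<^sub>0\<close> itself and the infimum is not known to be attained,
  which is why a limit is taken; the limit may fail to be a Schwartz function, but the solution is
  built from the size, the Lipschitz constant and the support of the symbol. The ratios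
  \<open>W / G_min g\<close> and \<open>G_max g / G_min g\<close> come from the change of variables
  alone: \<open>h\<close> is \<open>f\<close> times \<open>W / g_x\<close>, and returning to the old
  variables multiplies derivatives and residuals by \<open>g_x / W\<close>.\<close>

lemma open_slice_x: "open U \<Longrightarrow> open {t. (t, y) \<in> (U :: (real \<times> real) set)}"
  using open_vimage[of U "\<lambda>t. (t, y)"] by (simp add: vimage_def continuous_on_Pair)

lemma open_slice_y: "open U \<Longrightarrow> open {t. (x, t) \<in> (U :: (real \<times> real) set)}"
  using open_vimage[of U "\<lambda>t. (x, t)"] by (simp add: vimage_def continuous_on_Pair)

lemma has_derivative_slice_x:
  fixes f :: "real \<times> real \<Rightarrow> 'a::real_normed_vector"
  assumes "(f has_derivative D) (at (x, y))"
  shows "((\<lambda>t. f (t, y)) has_vector_derivative D (1, 0)) (at x)"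
proof -
  have 1: "((f \<circ> (\<lambda>t. (t, y))) has_derivative D \<circ> (\<lambda>t. (t, 0))) (at x)"
    using assms by (intro diff_chain_at has_derivative_Pair has_derivative_ident has_derivative_const)
  have *: "D (t, 0) = t *\<^sub>R D (1, 0)" for t
    using linear_scale[OF has_derivative_linear[OF assms], of t "(1, 0)"] by simp
  have 2: "D \<circ> (\<lambda>t. (t, 0)) = (\<lambda>t. t *\<^sub>R D (1, 0))"
    unfolding o_def by (intro ext *)
  show ?thesis
    using 1 unfolding has_vector_derivative_def 2 by (simp add: o_def)
qed

lemma has_derivative_slice_y:
  fixes f :: "real \<times> real \<Rightarrow> 'a::real_normed_vector"
  assumes "(f has_derivative D) (at (x, y))"
  shows "((\<lambda>t. f (x, t)) has_vector_derivative D (0, 1)) (at y)"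
proof -
  have 1: "((f \<circ> (\<lambda>t. (x, t))) has_derivative D \<circ> (\<lambda>t. (0, t))) (at y)"
    using assms by (intro diff_chain_at has_derivative_Pair has_derivative_ident has_derivative_const)
  have *: "D (0, t) = t *\<^sub>R D (0, 1)" for t
    using linear_scale[OF has_derivative_linear[OF assms], of t "(0, 1)"] by simp
  have 2: "D \<circ> (\<lambda>t. (0, t)) = (\<lambda>t. t *\<^sub>R D (0, 1))"
    unfolding o_def by (intro ext *)
  show ?thesis
    using 1 unfolding has_vector_derivative_def 2 by (simp add: o_def)
qed

lemma partial_x_eqI:
  assumes "open U" "(x, y) \<in> U" "((\<lambda>t. f (t, y)) has_vector_derivative d) (at x)"
  shows "partial_x U f (x, y) = d"
  using assms open_slice_x[OF assms(1), of y]
  by (simp add: partial_x_def at_within_open[of x "{t. (t, y) \<in> U}"] vector_derivative_at)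

lemma partial_y_eqI:
  assumes "open U" "(x, y) \<in> U" "((\<lambda>t. f (x, t)) has_vector_derivative d) (at y)"
  shows "partial_y U f (x, y) = d"
  using assms open_slice_y[OF assms(1), of x]
  by (simp add: partial_y_def at_within_open[of y "{t. (x, t) \<in> U}"] vector_derivative_at)

lemma partial_x_eq:
  assumes "open U" "z \<in> U" "(f has_derivative D) (at z)"
  shows "partial_x U f z = D (1, 0)"
  using assms partial_x_eqI has_derivative_slice_x by (metis surj_pair)

lemma partial_y_eq:
  assumes "open U" "z \<in> U" "(f has_derivative D) (at z)"
  shows "partial_y U f z = D (0, 1)"
  using assms partial_y_eqI has_derivative_slice_y by (metis surj_pair)

text \<open>A normal form for linear maps on the plane that displays the values on the two unit
  vectors: from a Frechet derivative in this form \<open>partial_x\<close> and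
  \<open>partial_y\<close> can be read off directly.\<close>

definition grad_map :: "'a::real_normed_vector \<Rightarrow> 'a \<Rightarrow> real \<times> real \<Rightarrow> 'a" where
  "grad_map a b = (\<lambda>d. fst d *\<^sub>R a + snd d *\<^sub>R b)"

lemma grad_map_simps [simp]: "grad_map a b (1, 0) = a" "grad_map a b (0, 1) = b"
  by (simp_all add: grad_map_def)

lemma linear_eq_grad_map:
  assumes "linear D"
  shows "D = grad_map (D (1, 0)) (D (0, 1))"
proof
  fix d :: "real \<times> real"
  have "D d = D (fst d *\<^sub>R (1, 0) + snd d *\<^sub>R (0, 1))"
    by (cases d) simp
  then show "D d = grad_map (D (1, 0)) (D (0, 1)) d"
    by (simp only: linear_add[OF assms] linear_scale[OF assms] grad_map_def)
qed

lemma has_derivative_grad_map: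
  assumes "open U" "z \<in> U" "f differentiable_on U"
  shows "(f has_derivative grad_map (partial_x U f z) (partial_y U f z)) (at z)"
proof -
  obtain D where D: "(f has_derivative D) (at z)"
    using assms by (auto simp: differentiable_on_def differentiable_def at_within_open[of z U])
  have "D = grad_map (D (1, 0)) (D (0, 1))"
    using D has_derivative_linear linear_eq_grad_map by blast
  then show ?thesis
    using D partial_x_eq[OF assms(1,2) D] partial_y_eq[OF assms(1,2) D] by simp
qed

text \<open>A partial derivative computed by hand coincides with \<open>partial_x U f\<close> only
  on \<open>U\<close>. On an open set derivatives depend on nearby values only, so such formulas may
  replace the partial derivatives at every order.\<close>

lemma C_k_on_cong:
  assumes "open U" "\<And>z. z \<in> U \<Longrightarrow> f z = g z"
  shows "C_k_on k U f \<longleftrightarrow> C_k_on k U g"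
  using assms(2)
proof (induction k arbitrary: f g)
  case 0
  then show ?case by (simp cong: continuous_on_cong)
next
  case (Suc k)
  have "partial_x U f z = partial_x U g z" if "z \<in> U" for z
  proof -
    obtain x y where z: "z = (x, y)" by (cases z)
    have "eventually (\<lambda>t. t \<in> {t. (t, y) \<in> U}) (nhds x)"
      using open_slice_x[OF assms(1), of y] that z by (intro eventually_nhds_in_open) auto
    then have "eventually (\<lambda>t. f (t, y) = g (t, y)) (nhds x)"
      by eventually_elim (use Suc.prems in auto)
    then have "vector_derivative (\<lambda>t. f (t, y)) (at x) = vector_derivative (\<lambda>t. g (t, y)) (at x)"
      by (intro vector_derivative_cong_eq) (auto simp: eventually_at_filter elim: eventually_mono)
    then show ?thesis
      using that z open_slice_x[OF assms(1), of y] by (simp add: partial_x_def at_within_open[of x "{t. (t, y) \<in> U}"])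
  qed
  then have "C_k_on k U (partial_x U f) = C_k_on k U (partial_x U g)" by (rule Suc.IH)
  moreover have "partial_y U f z = partial_y U g z" if "z \<in> U" for z
  proof -
    obtain x y where z: "z = (x, y)" by (cases z)
    have "eventually (\<lambda>t. t \<in> {t. (x, t) \<in> U}) (nhds y)"
      using open_slice_y[OF assms(1), of x] that z by (intro eventually_nhds_in_open) auto
    then have "eventually (\<lambda>t. f (x, t) = g (x, t)) (nhds y)"
      by eventually_elim (use Suc.prems in auto)
    then have "vector_derivative (\<lambda>t. f (x, t)) (at y) = vector_derivative (\<lambda>t. g (x, t)) (at y)"
      by (intro vector_derivative_cong_eq) (auto simp: eventually_at_filter elim: eventually_mono)
    then show ?thesis
      using that z open_slice_y[OF assms(1), of x] by (simp add: partial_y_def at_within_open[of y "{t. (x, t) \<in> U}"])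
  qed
  then have "C_k_on k U (partial_y U f) = C_k_on k U (partial_y U g)" by (rule Suc.IH)
  moreover have "f differentiable_on U \<longleftrightarrow> g differentiable_on U"
    unfolding differentiable_on_def differentiable_def
    using has_derivative_transform[of _ U f g] has_derivative_transform[of _ U g f] Suc.prems by metis
  ultimately show ?case
    by simp
qed

lemma C_k_on_SucI:
  assumes "open U" "\<And>z. z \<in> U \<Longrightarrow> (f has_derivative grad_map (fx z) (fy z)) (at z)"
    and "C_k_on k U fx" "C_k_on k U fy"
  shows "C_k_on (Suc k) U f"
proof -
  have "partial_x U f z = fx z" "partial_y U f z = fy z" if "z \<in> U" for z
    using partial_x_eq[OF assms(1) that assms(2)] partial_y_eq[OF assms(1) that assms(2)] that by auto
  moreover have "f differentiable_on U"
    using assms(2) by (intro differentiable_at_imp_differentiable_on) (blast intro: differentiableI)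
  ultimately show ?thesis
    using assms(3,4) C_k_on_cong[OF assms(1), of "partial_x U f" fx] C_k_on_cong[OF assms(1), of "partial_y U f" fy]
    by simp
qed

lemma C_k_on_has_derivative:
  assumes "open U" "z \<in> U" "C_k_on (Suc k) U f"
  shows "(f has_derivative grad_map (partial_x U f z) (partial_y U f z)) (at z)"
  by (rule has_derivative_grad_map) (use assms in simp_all)

lemma C_k_on_SucD: "C_k_on (Suc k) U f \<Longrightarrow> C_k_on k U f"
proof (induction k arbitrary: f)
  case 0
  then show ?case by (auto intro: differentiable_imp_continuous_on)
next
  case (Suc k)
  from Suc.prems have "C_k_on (Suc k) U (partial_x U f)" "C_k_on (Suc k) U (partial_y U f)" by simp_all
  from this[THEN Suc.IH] Suc.prems show ?case by simp
qed

lemma C_k_on_const [simp]: "open U \<Longrightarrow> C_k_on k U (\<lambda>z. c)"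
proof (induction k arbitrary: c)
  case (Suc k)
  then show ?case
    by (intro C_k_on_SucI[where fx = "\<lambda>_. 0" and fy = "\<lambda>_. 0"]) (auto simp: grad_map_def)
qed simp

lemma C_k_on_bounded_linear:
  assumes "open U" "bounded_linear L"
  shows "C_k_on k U f \<Longrightarrow> C_k_on k U (\<lambda>z. L (f z))"
proof (induction k arbitrary: f)
  case 0
  then show ?case
    using bounded_linear.continuous_on[OF assms(2)] by auto
next
  case (Suc k)
  show ?case
  proof (rule C_k_on_SucI[OF assms(1)])
    fix z assume "z \<in> U"
    from bounded_linear.has_derivative[OF assms(2) C_k_on_has_derivative[OF assms(1) this Suc.prems]]
    show "((\<lambda>z. L (f z)) has_derivative grad_map (L (partial_x U f z)) (L (partial_y U f z))) (at z)"
      by (simp add: grad_map_def linear_add[OF bounded_linear.linear[OF assms(2)]]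
          linear_scale[OF bounded_linear.linear[OF assms(2)]])
  qed (use Suc in auto)
qed

lemma C_k_on_add:
  assumes "open U"
  shows "C_k_on k U f \<Longrightarrow> C_k_on k U g \<Longrightarrow> C_k_on k U (\<lambda>z. f z + g z)"
proof (induction k arbitrary: f g)
  case 0
  then show ?case by (simp add: continuous_on_add)
next
  case (Suc k)
  show ?case
  proof (rule C_k_on_SucI[OF assms(1)])
    fix z assume "z \<in> U"
    from has_derivative_add[OF C_k_on_has_derivative[OF assms(1) this Suc.prems(1)] C_k_on_has_derivative[OF assms(1) this Suc.prems(2)]]
    show "((\<lambda>z. f z + g z) has_derivative grad_map (partial_x U f z + partial_x U g z) (partial_y U f z + partial_y U g z)) (at z)"
      by (simp add: grad_map_def algebra_simps)
  qed (use Suc in auto)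
qed

text \<open>The product rule involves \<open>f\<close> and \<open>g\<close> themselves next to their
  derivatives, hence the lowering of the order by \<open>C_k_on_SucD\<close> in the
  induction.\<close>

lemma C_k_on_bilinear:
  assumes "open U" "bounded_bilinear B"
  shows "C_k_on k U f \<Longrightarrow> C_k_on k U g \<Longrightarrow> C_k_on k U (\<lambda>z. B (f z) (g z))"
proof (induction k arbitrary: f g)
  case 0
  then show ?case using bounded_bilinear.continuous_on[OF assms(2)] by auto
next
  case (Suc k)
  interpret bounded_bilinear B by fact
  show ?case
  proof (rule C_k_on_SucI[OF assms(1)])
    fix z assume "z \<in> U"
    from FDERIV[OF C_k_on_has_derivative[OF assms(1) this Suc.prems(1)] C_k_on_has_derivative[OF assms(1) this Suc.prems(2)]]
    show "((\<lambda>z. B (f z) (g z)) has_derivative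
      grad_map (B (f z) (partial_x U g z) + B (partial_x U f z) (g z))
         (B (f z) (partial_y U g z) + B (partial_y U f z) (g z))) (at z)"
      by (simp add: grad_map_def algebra_simps add_left add_right scaleR_left scaleR_right)
  qed (use Suc C_k_on_SucD[OF Suc.prems(1)] C_k_on_SucD[OF Suc.prems(2)] in \<open>auto intro!: C_k_on_add[OF assms(1)]\<close>)
qed

section \<open>Closure properties of smooth functions\<close>

lemma smooth_on_const [simp]: "open U \<Longrightarrow> smooth_on U (\<lambda>z. c)"
  by (simp add: smooth_on_def)

lemma smooth_on_add: "open U \<Longrightarrow> smooth_on U f \<Longrightarrow> smooth_on U g \<Longrightarrow> smooth_on U (\<lambda>z. f z + g z)"
  by (simp add: smooth_on_def C_k_on_add)

lemma smooth_on_bilinear: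
  "open U \<Longrightarrow> bounded_bilinear B \<Longrightarrow> smooth_on U f \<Longrightarrow> smooth_on U g \<Longrightarrow> smooth_on U (\<lambda>z. B (f z) (g z))"
  by (simp add: smooth_on_def C_k_on_bilinear)

lemmas smooth_on_mult = smooth_on_bilinear[OF _ bounded_bilinear_mult]

lemma smooth_on_bounded_linear:
  "open U \<Longrightarrow> bounded_linear L \<Longrightarrow> smooth_on U f \<Longrightarrow> smooth_on U (\<lambda>z. L (f z))"
  by (simp add: smooth_on_def C_k_on_bounded_linear)

lemmas smooth_on_of_real = smooth_on_bounded_linear[OF _ bounded_linear_of_real]

lemma smooth_on_partials:
  "smooth_on U f \<Longrightarrow> smooth_on U (partial_x U f)" "smooth_on U f \<Longrightarrow> smooth_on U (partial_y U f)"
  unfolding smooth_on_def by (metis C_k_on.simps(2))+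

lemma smooth_on_has_derivative:
  "open U \<Longrightarrow> z \<in> U \<Longrightarrow> smooth_on U f \<Longrightarrow>
    (f has_derivative grad_map (partial_x U f z) (partial_y U f z)) (at z)"
  unfolding smooth_on_def using C_k_on_has_derivative by blast

lemma smooth_on_continuous_on: "smooth_on U f \<Longrightarrow> continuous_on U f"
  unfolding smooth_on_def using C_k_on.simps(1) by blast

text \<open>A family whose partial derivatives stay in the family consists of smooth functions. It
  serves for integrals depending on a parameter, where differentiation merely changes the density,
  and so avoids formulas for higher derivatives.\<close>

lemma smooth_on_coinduct:
  assumes "P f" "open U"
    and step: "\<And>f. P f \<Longrightarrow> \<exists>fx fy. P fx \<and> P fy \<and> (\<forall>z\<in>U. (f has_derivative grad_map (fx z) (fy z)) (at z))"
  shows "smooth_on U f"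
proof -
  have "C_k_on k U f" if "P f" for k f
    using that
  proof (induction k arbitrary: f)
    case 0
    then obtain fx fy where "\<forall>z\<in>U. (f has_derivative grad_map (fx z) (fy z)) (at z)"
      using step by blast
    then show ?case
      by (simp, intro continuous_at_imp_continuous_on ballI) (blast intro: has_derivative_continuous)
  next
    case (Suc k)
    then show ?case using step[OF Suc.prems] by (blast intro: C_k_on_SucI[OF assms(2)])
  qed
  then show ?thesis using assms(1) by (simp add: smooth_on_def)
qed

lemma smooth_on_SucI:
  assumes "open U" "\<And>z. z \<in> U \<Longrightarrow> (f has_derivative grad_map (fx z) (fy z)) (at z)"
    and "smooth_on U fx" "smooth_on U fy"
  shows "smooth_on U f"
  unfolding smooth_on_def
proof
  fix k
  have "C_k_on (Suc k) U f"
    by (rule C_k_on_SucI[OF assms(1,2)]) (use assms(3,4) in \<open>simp_all add: smooth_on_def\<close>)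
  then show "C_k_on k U f" by (rule C_k_on_SucD)
qed

lemma smooth_on_bounded_linear_id:
  assumes "open U" "bounded_linear (L :: real \<times> real \<Rightarrow> 'a::real_normed_vector)"
  shows "smooth_on U L"
  by (rule smooth_on_SucI[OF assms(1), where fx = "\<lambda>_. L (1, 0)" and fy = "\<lambda>_. L (0, 1)"])
    (use assms linear_eq_grad_map[of L] bounded_linear_imp_has_derivative[OF assms(2)] in \<open>auto dest: bounded_linear.linear\<close>)

lemmas smooth_on_fst = smooth_on_bounded_linear_id[OF _ bounded_linear_fst]
lemmas smooth_on_snd = smooth_on_bounded_linear_id[OF _ bounded_linear_snd]

text \<open>\<open>partial_x U f\<close> and \<open>partial_x V f\<close> may differ off
  \<open>V\<close>, so the derivatives taken in \<open>U\<close> serve as witnesses of the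
  coinduction.\<close>

lemma smooth_on_subset: 
  assumes "open U" "open V" "V \<subseteq> U" "smooth_on U f"
  shows "smooth_on V f"
proof (rule smooth_on_coinduct[where P = "smooth_on U"])
  fix f :: "real \<times> real \<Rightarrow> 'a" assume "smooth_on U f"
  then show "\<exists>fx fy. smooth_on U fx \<and> smooth_on U fy \<and> (\<forall>z\<in>V. (f has_derivative grad_map (fx z) (fy z)) (at z))"
    using smooth_on_has_derivative[OF assms(1)] assms(3)
    by (intro exI[of _ "partial_x U f"] exI[of _ "partial_y U f"]) (auto intro: smooth_on_partials)
qed (use assms in auto)

lemma smooth_on_real_polynomial_function:
  assumes "real_polynomial_function p" "open U"
  shows "smooth_on U (p :: real \<times> real \<Rightarrow> real)"
  using assms(1)
proof induction
  case (linear f)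
  then show ?case by (rule smooth_on_bounded_linear_id[OF assms(2)])
next
  case (const c)
  show ?case by (rule smooth_on_const[OF assms(2)])
next
  case (add f g)
  then show ?case by (intro smooth_on_add[OF assms(2)])
next
  case (mult f g)
  then show ?case by (intro smooth_on_mult[OF assms(2)])
qed

subsection \<open>Integrals with decay and oscillatory integrals\<close>

text \<open>A product weight rather than a radial one: Fubini splits it into integrable
  one-dimensional factors, and on a line parallel to an axis it is a constant times
  \<open>1 / (1 + t\<^sup>2)\<close>.\<close>

definition wt :: "real \<times> real \<Rightarrow> real" where
  "wt z = 1 / ((1 + (fst z)\<^sup>2) * (1 + (snd z)\<^sup>2))"

lemma integrable_inverse_square_plus_1: "integrable lborel (\<lambda>x::real. 1 / (1 + x\<^sup>2))"
  using integrable_inverse_1_plus_square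
  by (simp add: set_integrable_def einterval_def divide_inverse)

lemma integrable_tensor:
  fixes f :: "'a \<Rightarrow> 'c::{real_normed_field, banach, second_countable_topology}" and g :: "'b \<Rightarrow> 'c"
  assumes "sigma_finite_measure M" "sigma_finite_measure N" "integrable M f" "integrable N g"
  shows "integrable (M \<Otimes>\<^sub>M N) (\<lambda>z. f (fst z) * g (snd z))"
proof -
  interpret M: sigma_finite_measure M by fact
  interpret N: sigma_finite_measure N by fact
  interpret pair_sigma_finite M N ..
  have [measurable]: "f \<in> borel_measurable M" "g \<in> borel_measurable N"
    using assms by auto
  show ?thesis
  proof (rule Fubini_integrable)
    show "integrable M (\<lambda>x. \<integral>y. norm (f (fst (x, y)) * g (snd (x, y))) \<partial>N)"
      using assms by (simp add: norm_mult)
    show "AE x in M. integrable N (\<lambda>y. f (fst (x, y)) * g (snd (x, y)))"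
      using assms by simp
  qed simp
qed

lemma integral_tensor:
  fixes f :: "'a \<Rightarrow> 'c::{real_normed_field, banach, second_countable_topology}" and g :: "'b \<Rightarrow> 'c"
  assumes "sigma_finite_measure M" "sigma_finite_measure N" "integrable M f" "integrable N g"
  shows "(\<integral>z. f (fst z) * g (snd z) \<partial>(M \<Otimes>\<^sub>M N)) = (\<integral>x. f x \<partial>M) * (\<integral>y. g y \<partial>N)"
proof -
  interpret M: sigma_finite_measure M by fact
  interpret N: sigma_finite_measure N by fact
  interpret pair_sigma_finite M N ..
  have "(\<integral>z. f (fst z) * g (snd z) \<partial>(M \<Otimes>\<^sub>M N)) = (\<integral>x. \<integral>y. f x * g y \<partial>N \<partial>M)"
    by (subst integral_fst'[symmetric]) (use integrable_tensor[OF assms] in simp_all)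
  then show ?thesis using assms by simp
qed

lemma integrable_wt: "integrable lborel wt"
proof -
  have "integrable (lborel \<Otimes>\<^sub>M lborel) (\<lambda>z::real \<times> real. 1 / (1 + (fst z)\<^sup>2) * (1 / (1 + (snd z)\<^sup>2)))"
    by (intro integrable_tensor[where g = "\<lambda>y. 1 / (1 + y\<^sup>2)" and f = "\<lambda>x. 1 / (1 + x\<^sup>2)"] integrable_inverse_square_plus_1)
      (auto intro: lborel.sigma_finite_measure_axioms)
  then show ?thesis by (simp add: lborel_prod wt_def[abs_def])
qed

lemma wt_pos: "0 < wt z"
proof -
  have "0 < 1 + (fst z)\<^sup>2" "0 < 1 + (snd z)\<^sup>2" by (auto simp: add_pos_nonneg)
  then show ?thesis by (simp add: wt_def)
qed

lemma integrable_wt_bound: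
  fixes f :: "real \<times> real \<Rightarrow> 'a::{banach, second_countable_topology}"
  assumes "f \<in> borel_measurable borel" "\<And>z. norm (f z) \<le> C * wt z"
  shows "integrable lborel f"
proof (rule Bochner_Integration.integrable_bound)
  show "integrable lborel (\<lambda>z. C * wt z)" using integrable_wt by simp
  show "AE z in lborel. norm (f z) \<le> norm (C * wt z)"
  proof (intro always_eventually allI)
    fix z show "norm (f z) \<le> norm (C * wt z)" using assms(2)[of z] unfolding real_norm_def by linarith
  qed
qed (use assms(1) in simp)

text \<open>The fundamental theorem on the whole line, where the decay of \<open>g\<close> removes
  both boundary terms. Both bounds share \<open>C\<close> so that slices of functions dominated by
  \<open>wt\<close> fit.\<close>

lemma integral_derivative_zero_1d:
  fixes g g' :: "real \<Rightarrow> complex"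
  assumes der: "\<And>t. (g has_vector_derivative g' t) (at t)" and cont: "continuous_on UNIV g'"
    and bd: "\<And>t. norm (g t) \<le> C / (1 + t\<^sup>2)" and bd': "\<And>t. norm (g' t) \<le> C / (1 + t\<^sup>2)"
  shows "(\<integral>t. g' t \<partial>lborel) = 0"
proof -
  have int: "integrable lborel g'"
  proof (rule Bochner_Integration.integrable_bound)
    show "integrable lborel (\<lambda>t::real. C * (1 / (1 + t\<^sup>2)))"
      by (rule integrable_mult_right[OF integrable_inverse_square_plus_1])
    show "AE t in lborel. norm (g' t) \<le> norm (C * (1 / (1 + t\<^sup>2)))"
    proof (intro always_eventually allI)
      fix t show "norm (g' t) \<le> norm (C * (1 / (1 + t\<^sup>2)))" using order_trans[OF bd'[of t] abs_ge_self] by simp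
    qed
  qed (use cont in \<open>auto intro: borel_measurable_continuous_onI\<close>)
  have lim: "((\<lambda>t::real. C / (1 + t\<^sup>2)) \<longlongrightarrow> 0) at_top" "((\<lambda>t::real. C / (1 + t\<^sup>2)) \<longlongrightarrow> 0) at_bot"
    by real_asymp+
  have "(LBINT t=-\<infinity>..\<infinity>. g' t) = 0 - 0"
  proof (rule interval_integral_FTC_integrable)
    show "isCont g' x" for x using cont by (simp add: continuous_on_eq_continuous_at)
    show "((g \<circ> real_of_ereal) \<longlongrightarrow> 0) (at_right (-\<infinity>))" "((g \<circ> real_of_ereal) \<longlongrightarrow> 0) (at_left \<infinity>)"
      unfolding ereal_tendsto_simps using bd by (auto intro: Lim_null_comparison[OF _ lim(1)] Lim_null_comparison[OF _ lim(2)])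
  qed (use der int in \<open>auto simp: set_integrable_def einterval_def\<close>)
  then show ?thesis
    by (simp add: interval_lebesgue_integral_def einterval_def set_lebesgue_integral_def)
qed

lemma integral_partial_x_zero:
  fixes G G' :: "real \<times> real \<Rightarrow> complex"
  assumes der: "\<And>x y. ((\<lambda>t. G (t, y)) has_vector_derivative G' (x, y)) (at x)" and cont: "continuous_on UNIV G'"
    and bd: "\<And>z. norm (G z) \<le> C * wt z" and bd': "\<And>z. norm (G' z) \<le> C * wt z"
  shows "(\<integral>z. G' z \<partial>lborel) = 0"
proof -
  have meas: "G' \<in> borel_measurable borel" using cont by (rule borel_measurable_continuous_onI)
  have "integrable (lborel \<Otimes>\<^sub>M lborel) (case_prod (\<lambda>x y. G' (x, y)))"
    using integrable_wt_bound[OF meas bd'] by (simp add: lborel_prod)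
  then have "(\<integral>z. G' z \<partial>lborel) = (\<integral>y. \<integral>x. G' (x, y) \<partial>lborel \<partial>lborel)"
    by (subst lborel_pair.integral_snd) (simp_all add: lborel_prod)
  moreover have "(\<integral>x. G' (x, y) \<partial>lborel) = 0" for y
  proof (rule integral_derivative_zero_1d[where C = "C / (1 + y\<^sup>2)"])
    show "continuous_on UNIV (\<lambda>x. G' (x, y))"
      by (rule continuous_on_compose2[OF cont]) (auto intro!: continuous_intros)
  qed (use der bd[of "(_, y)"] bd'[of "(_, y)"] in \<open>simp_all add: wt_def mult.commute\<close>)
  ultimately show ?thesis by simp
qed

lemma integral_partial_y_zero:
  fixes G G' :: "real \<times> real \<Rightarrow> complex"
  assumes der: "\<And>x y. ((\<lambda>t. G (x, t)) has_vector_derivative G' (x, y)) (at y)" and cont: "continuous_on UNIV G'"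
    and bd: "\<And>z. norm (G z) \<le> C * wt z" and bd': "\<And>z. norm (G' z) \<le> C * wt z"
  shows "(\<integral>z. G' z \<partial>lborel) = 0"
proof -
  have meas: "G' \<in> borel_measurable borel" using cont by (rule borel_measurable_continuous_onI)
  have "integrable (lborel \<Otimes>\<^sub>M lborel) (case_prod (\<lambda>x y. G' (x, y)))"
    using integrable_wt_bound[OF meas bd'] by (simp add: lborel_prod)
  then have "(\<integral>z. G' z \<partial>lborel) = (\<integral>x. \<integral>y. G' (x, y) \<partial>lborel \<partial>lborel)"
    by (subst lborel_pair.integral_fst) (simp_all add: lborel_prod)
  moreover have "(\<integral>y. G' (x, y) \<partial>lborel) = 0" for x
  proof (rule integral_derivative_zero_1d[where C = "C / (1 + x\<^sup>2)"])
    show "continuous_on UNIV (\<lambda>y. G' (x, y))"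
      by (rule continuous_on_compose2[OF cont]) (auto intro!: continuous_intros)
  qed (use der bd[of "(x, _)"] bd'[of "(x, _)"] in \<open>simp_all add: wt_def mult.commute\<close>)
  ultimately show ?thesis by simp
qed

section \<open>Differentiation under the integral sign\<close>

lemma norm_integral_le:
  fixes f :: "'a \<Rightarrow> 'b::{banach, second_countable_topology}"
  assumes "integrable M g" "\<And>x. x \<in> space M \<Longrightarrow> norm (f x) \<le> g x"
  shows "norm (\<integral>x. f x \<partial>M) \<le> (\<integral>x. g x \<partial>M)"
proof -
  have "norm (\<integral>x. f x \<partial>M) \<le> (\<integral>x. norm (f x) \<partial>M)" by (rule integral_norm_bound)
  also have "\<dots> \<le> (\<integral>x. g x \<partial>M)"
    using assms by (intro integral_mono') (auto intro: order_trans[OF norm_ge_zero])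
  finally show ?thesis .
qed

text \<open>For an integral depending on a parameter the hypothesis follows by integrating the
  Taylor remainder of the integrand, so that no exchange of limits occurs.\<close>

lemma has_derivative_quadraticI:
  fixes f :: "'a::real_normed_vector \<Rightarrow> 'b::real_normed_vector"
  assumes "bounded_linear D" "\<And>d. norm d \<le> 1 \<Longrightarrow> norm (f (z + d) - f z - D d) \<le> K * (norm d)\<^sup>2"
  shows "(f has_derivative D) (at z)"
  unfolding has_derivative_at
proof
  show "(\<lambda>h. norm (f (z + h) - f z - D h) / norm h) \<midarrow>0\<rightarrow> 0"
  proof (rule Lim_null_comparison)
    have "\<forall>\<^sub>F h in at 0. norm (h :: 'a) < 1"
      unfolding eventually_at by (rule exI[of _ 1]) simp
    then show "\<forall>\<^sub>F h in at 0. norm (norm (f (z + h) - f z - D h) / norm h) \<le> K * norm h"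
    proof eventually_elim
      case (elim h)
      then show ?case
        using assms(2)[of h] by (cases "h = 0") (auto simp: divide_simps power2_eq_square mult.assoc)
    qed
    show "(\<lambda>h::'a. K * norm h) \<midarrow>0\<rightarrow> 0"
      by (auto intro!: tendsto_eq_intros)
  qed
qed (rule assms)

lemma norm_exp_remainder:
  fixes w :: complex
  shows "norm (exp w - 1 - w) \<le> exp \<bar>Re w\<bar> * (norm w)\<^sup>2"
  using Taylor_exp[of w 1] by (simp add: power2_eq_square algebra_simps)

lemma norm_cis_remainder: "norm (cis (a + d) - cis a - \<i> * of_real d * cis a) \<le> d\<^sup>2"
proof -
  have "cis (a + d) - cis a - \<i> * of_real d * cis a = cis a * (exp (\<i> * of_real d) - 1 - \<i> * of_real d)"
    by (simp add: cis_mult[symmetric] cis_conv_exp[of d] algebra_simps)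
  then show ?thesis
    using norm_exp_remainder[of "\<i> * of_real d"] by (simp add: norm_mult)
qed

lemma integrable_bound_mult:
  fixes m f :: "'a \<Rightarrow> complex"
  assumes "integrable M m" "f \<in> borel_measurable M" "\<And>t. norm (f t) \<le> C"
  shows "integrable M (\<lambda>t. m t * f t)"
proof (rule Bochner_Integration.integrable_bound)
  show "integrable M (\<lambda>t. C * norm (m t))" using assms by simp
  show "AE t in M. norm (m t * f t) \<le> norm (C * norm (m t))"
  proof (intro always_eventually allI)
    fix t
    have "norm (m t * f t) \<le> norm (m t) * C" using assms(3)[of t] by (simp add: norm_mult mult_left_mono)
    then show "norm (m t * f t) \<le> norm (C * norm (m t))" by (simp add: mult.commute)
  qed
qed (use assms in auto)

lemma grad_map_bounded_linear: "bounded_linear (grad_map a b)"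
  unfolding grad_map_def
  by (intro bounded_linear_add bounded_linear_scaleR_left[THEN bounded_linear_compose] bounded_linear_fst bounded_linear_snd)

text \<open>The remainder of \<open>cis\<close> is quadratic in the phase increment, so finite
  second moments of the phases suffice. Measure and phases are arbitrary because the lemma is
  applied both to the plane with its coordinates and to a product space with an interpolated
  phase.\<close>

lemma has_derivative_cis_integral:
  fixes m :: "'a \<Rightarrow> complex" and a b :: "'a \<Rightarrow> real"
  assumes m: "integrable M m" and [measurable]: "a \<in> borel_measurable M" "b \<in> borel_measurable M"
    and ma: "integrable M (\<lambda>t. of_real ((a t)\<^sup>2) * m t)" and mb: "integrable M (\<lambda>t. of_real ((b t)\<^sup>2) * m t)"
  shows "((\<lambda>z. \<integral>t. m t * cis (a t * fst z + b t * snd z) \<partial>M) has_derivative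
    grad_map (\<integral>t. (\<i> * of_real (a t) * m t) * cis (a t * fst z + b t * snd z) \<partial>M)
      (\<integral>t. (\<i> * of_real (b t) * m t) * cis (a t * fst z + b t * snd z) \<partial>M)) (at z)"
proof -
  have [measurable]: "m \<in> borel_measurable M" using m by auto
  \<comment> \<open>First moments are controlled by the density and its second moments, because
    \<open>|c| <= 1 + c^2\<close>.\<close>
  have first: "integrable M (\<lambda>t. \<i> * of_real (c t) * m t)"
    if [measurable]: "c \<in> borel_measurable M" and c: "integrable M (\<lambda>t. of_real ((c t)\<^sup>2) * m t)" for c :: "'a \<Rightarrow> real"
  proof (rule Bochner_Integration.integrable_bound)
    show "integrable M (\<lambda>t. norm (m t) + norm (of_real ((c t)\<^sup>2) * m t))"
      using m c by (intro Bochner_Integration.integrable_add integrable_norm)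
    have "norm (\<i> * of_real (c t) * m t) \<le> norm (norm (m t) + norm (of_real ((c t)\<^sup>2) * m t))" for t
    proof -
      have "0 \<le> (\<bar>c t\<bar> - 1)\<^sup>2" by simp
      then have "\<bar>c t\<bar> \<le> 1 + (c t)\<^sup>2" by (simp add: power2_eq_square algebra_simps)
      then have "\<bar>c t\<bar> * norm (m t) \<le> (1 + (c t)\<^sup>2) * norm (m t)" by (rule mult_right_mono) simp
      then show ?thesis by (simp add: norm_mult norm_power algebra_simps)
    qed
    then show "AE t in M. norm (\<i> * of_real (c t) * m t) \<le> norm (norm (m t) + norm (of_real ((c t)\<^sup>2) * m t))" by simp
  qed simp
  have fa: "integrable M (\<lambda>t. \<i> * of_real (a t) * m t)" and fb: "integrable M (\<lambda>t. \<i> * of_real (b t) * m t)"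
    using ma mb by (auto intro: first)
  have ic: "integrable M (\<lambda>t. n t * cis (a t * fst w + b t * snd w))" if "integrable M n" for n and w :: "real \<times> real"
    by (rule integrable_bound_mult[OF that, of _ 1]) (simp_all add: cis_conv_exp)
  have id: "integrable M (\<lambda>t. 2 * (norm (of_real ((a t)\<^sup>2) * m t) + norm (of_real ((b t)\<^sup>2) * m t)) )"
    using ma mb by (intro integrable_mult_right Bochner_Integration.integrable_add integrable_norm)
  let ?K = "\<integral>t. 2 * (norm (of_real ((a t)\<^sup>2) * m t) + norm (of_real ((b t)\<^sup>2) * m t)) \<partial>M"
  let ?A = "\<integral>t. (\<i> * of_real (a t) * m t) * cis (a t * fst z + b t * snd z) \<partial>M"
  let ?B = "\<integral>t. (\<i> * of_real (b t) * m t) * cis (a t * fst z + b t * snd z) \<partial>M"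
  show ?thesis
  proof (rule has_derivative_quadraticI[OF grad_map_bounded_linear, where K = ?K])
    fix d :: "real \<times> real"
    let ?\<theta> = "\<lambda>t. a t * fst z + b t * snd z" and ?\<delta> = "\<lambda>t. a t * fst d + b t * snd d"
    have th: "a t * fst (z + d) + b t * snd (z + d) = ?\<theta> t + ?\<delta> t" for t
      by (simp add: algebra_simps)
    have "(\<integral>t. m t * cis (a t * fst (z + d) + b t * snd (z + d)) \<partial>M) - (\<integral>t. m t * cis (?\<theta> t) \<partial>M) - grad_map ?A ?B d
      = (\<integral>t. m t * cis (a t * fst (z + d) + b t * snd (z + d)) - m t * cis (?\<theta> t) -
        (fst d *\<^sub>R ((\<i> * of_real (a t) * m t) * cis (?\<theta> t)) + snd d *\<^sub>R ((\<i> * of_real (b t) * m t) * cis (?\<theta> t))) \<partial>M)"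
      using ic[OF m, of "z + d"] ic[OF m, of z] ic[OF fa, of z] ic[OF fb, of z] by (simp add: grad_map_def)
    also have "\<dots> = (\<integral>t. m t * (cis (?\<theta> t + ?\<delta> t) - cis (?\<theta> t) - \<i> * of_real (?\<delta> t) * cis (?\<theta> t)) \<partial>M)"
      unfolding th by (intro Bochner_Integration.integral_cong refl) (simp add: scaleR_conv_of_real algebra_simps)
    finally have eq: "(\<integral>t. m t * cis (a t * fst (z + d) + b t * snd (z + d)) \<partial>M) - (\<integral>t. m t * cis (?\<theta> t) \<partial>M) - grad_map ?A ?B d = \<dots>" .
    have bd: "norm (m t * (cis (?\<theta> t + ?\<delta> t) - cis (?\<theta> t) - \<i> * of_real (?\<delta> t) * cis (?\<theta> t)))
      \<le> 2 * (norm (of_real ((a t)\<^sup>2) * m t) + norm (of_real ((b t)\<^sup>2) * m t)) * (norm d)\<^sup>2" for t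
    proof -
      have n: "\<bar>fst d\<bar> \<le> norm d" "\<bar>snd d\<bar> \<le> norm d"
        using norm_fst_le[of "fst d" "snd d"] norm_snd_le[of "snd d" "fst d"] by auto
      \<comment> \<open>The elementary bound \<open>(p + q)^2 <= 2 * (p^2 + q^2)\<close> is the
        origin of the \<open>2\<close> in \<open>?K\<close>.\<close>
      have "(?\<delta> t)\<^sup>2 \<le> 2 * ((a t * fst d)\<^sup>2 + (b t * snd d)\<^sup>2)"
        using sum_squares_bound[of "a t * fst d" "b t * snd d"] by (simp add: power2_sum)
      also have "\<dots> \<le> 2 * (((a t)\<^sup>2 + (b t)\<^sup>2) * (norm d)\<^sup>2)"
        using n by (simp add: power_mult_distrib distrib_right add_mono mult_left_mono abs_le_square_iff[symmetric])
      finally have "(?\<delta> t)\<^sup>2 \<le> 2 * ((a t)\<^sup>2 + (b t)\<^sup>2) * (norm d)\<^sup>2" by (simp only: mult.assoc)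
      with norm_cis_remainder[of "?\<theta> t" "?\<delta> t"]
      have "norm (cis (?\<theta> t + ?\<delta> t) - cis (?\<theta> t) - \<i> * of_real (?\<delta> t) * cis (?\<theta> t)) \<le> 2 * ((a t)\<^sup>2 + (b t)\<^sup>2) * (norm d)\<^sup>2"
        by linarith
      note mult_left_mono[OF this norm_ge_zero[of "m t"]]
      also have "norm (m t) * (2 * ((a t)\<^sup>2 + (b t)\<^sup>2) * (norm d)\<^sup>2) =
          2 * (norm (of_real ((a t)\<^sup>2) * m t) + norm (of_real ((b t)\<^sup>2) * m t)) * (norm d)\<^sup>2"
        by (simp add: norm_mult norm_power algebra_simps)
      finally show ?thesis by (simp only: norm_mult)
    qed
    have K: "?K * (norm d)\<^sup>2 = (\<integral>t. 2 * (norm (of_real ((a t)\<^sup>2) * m t) + norm (of_real ((b t)\<^sup>2) * m t)) * (norm d)\<^sup>2 \<partial>M)"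
      by simp
    show "norm ((\<integral>t. m t * cis (a t * fst (z + d) + b t * snd (z + d)) \<partial>M) - (\<integral>t. m t * cis (?\<theta> t) \<partial>M) - grad_map ?A ?B d) \<le> ?K * (norm d)\<^sup>2"
      unfolding eq K
    proof (rule norm_integral_le)
      show "integrable M (\<lambda>t. 2 * (norm (of_real ((a t)\<^sup>2) * m t) + norm (of_real ((b t)\<^sup>2) * m t)) * (norm d)\<^sup>2)"
        using id by (rule integrable_mult_left)
    qed (rule bd)
  qed
qed

text \<open>For complex arguments the exponential is unbounded, so the phases must stay in a bounded
  range wherever \<open>m\<close> is nonzero. This is the easy half of Paley-Wiener: compact
  frequency support gives an entire extension.\<close>

lemma has_derivative_exp_integral:
  fixes m :: "'a \<Rightarrow> complex" and a b :: "'a \<Rightarrow> real" and z w :: complex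
  assumes m: "integrable M m" and [measurable]: "a \<in> borel_measurable M" "b \<in> borel_measurable M"
    and R: "\<And>t. m t \<noteq> 0 \<Longrightarrow> \<bar>a t\<bar> \<le> R \<and> \<bar>b t\<bar> \<le> R"
  shows "((\<lambda>p. \<integral>t. m t * exp (\<i> * (of_real (a t) * fst p + of_real (b t) * snd p)) \<partial>M) has_derivative
    (\<lambda>d. fst d * (\<integral>t. \<i> * of_real (a t) * m t * exp (\<i> * (of_real (a t) * z + of_real (b t) * w)) \<partial>M) +
      snd d * (\<integral>t. \<i> * of_real (b t) * m t * exp (\<i> * (of_real (a t) * z + of_real (b t) * w)) \<partial>M))) (at (z, w))"
proof -
  have [measurable]: "m \<in> borel_measurable M" using m by auto
  let ?e = "\<lambda>t p. exp (\<i> * (of_real (a t) * fst p + of_real (b t) * snd p))"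
  \<comment> \<open>\<open>R\<close> may be negative when \<open>m\<close> vanishes
    identically.\<close>
  define R' where "R' = max R 0"
  have R': "R' \<ge> 0" "\<And>t. m t \<noteq> 0 \<Longrightarrow> \<bar>a t\<bar> \<le> R' \<and> \<bar>b t\<bar> \<le> R'" using R by (fastforce simp: R'_def)+
  define L where "L p = R' * (norm (fst p) + norm (snd p))" for p :: "complex \<times> complex"
  have lin: "norm (of_real (a t) * fst p + of_real (b t) * snd p) \<le> L p" if "m t \<noteq> 0" for t and p :: "complex \<times> complex"
  proof -
    have "norm (of_real (a t) * fst p + of_real (b t) * snd p) \<le> \<bar>a t\<bar> * norm (fst p) + \<bar>b t\<bar> * norm (snd p)"
      by (rule norm_triangle_le) (simp add: norm_mult)
    also have "\<dots> \<le> R' * norm (fst p) + R' * norm (snd p)"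
      using R'(2)[OF that] by (intro add_mono mult_right_mono) auto
    finally show ?thesis by (simp add: L_def distrib_left)
  qed
  have ebd: "norm (?e t p) \<le> exp (L p)" if "m t \<noteq> 0" for t and p :: "complex \<times> complex"
    using abs_Im_le_cmod[of "of_real (a t) * fst p + of_real (b t) * snd p"] lin[OF that, of p] by simp
  have ic: "integrable M (\<lambda>t. m t * (c t * ?e t p))"
    if [measurable]: "c \<in> borel_measurable M" and c: "\<And>t. m t \<noteq> 0 \<Longrightarrow> norm (c t) \<le> C" for p :: "complex \<times> complex" and c C
  proof (rule Bochner_Integration.integrable_bound)
    show "integrable M (\<lambda>t. norm (m t) * (C * exp (L p)))" using m by simp
    have "norm (m t * (c t * ?e t p)) \<le> norm (norm (m t) * (C * exp (L p)))" for t
    proof (cases "m t = 0")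
      case False
      have "norm (c t) * norm (?e t p) \<le> C * exp (L p)"
        using c[OF False] ebd[OF False, of p] order_trans[OF norm_ge_zero c[OF False]] by (intro mult_mono) auto
      then have "norm (m t) * (norm (c t) * norm (?e t p)) \<le> norm (m t) * (C * exp (L p))" by (rule mult_left_mono) simp
      also have "\<dots> \<le> \<bar>norm (m t) * (C * exp (L p))\<bar>" by (rule abs_ge_self)
      finally show ?thesis by (simp only: norm_mult real_norm_def)
    qed simp
    then show "AE t in M. norm (m t * (c t * ?e t p)) \<le> norm (norm (m t) * (C * exp (L p)))" by simp
  qed measurable
  have i1: "integrable M (\<lambda>t. m t * ?e t p)" for p
    using ic[of "\<lambda>_. 1" 1 p] by simp
  have i2: "integrable M (\<lambda>t. \<i> * of_real (a t) * m t * ?e t p)" "integrable M (\<lambda>t. \<i> * of_real (b t) * m t * ?e t p)" for p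
    using ic[of "\<lambda>t. \<i> * of_real (a t)" R' p] ic[of "\<lambda>t. \<i> * of_real (b t)" R' p] R'(2) by (auto simp: norm_mult mult_ac)
  let ?A = "\<integral>t. \<i> * of_real (a t) * m t * ?e t (z, w) \<partial>M"
  let ?B = "\<integral>t. \<i> * of_real (b t) * m t * ?e t (z, w) \<partial>M"
  \<comment> \<open>The factor \<open>exp (L (z, w))\<close> bounds the exponential at the base
    point. For \<open>norm d <= 1\<close> the increment of the exponent is at most
    \<open>2 * R' * norm d\<close>, which gives \<open>exp (2 * R')\<close> and
    \<open>(2 * R')^2\<close> in the Taylor remainder.\<close>
  let ?K = "\<integral>t. norm (m t) * (exp (L (z, w)) * (exp (2 * R') * (2 * R')\<^sup>2)) \<partial>M"
  have bl: "bounded_linear (\<lambda>d. fst d * ?A + snd d * ?B)"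
    by (intro bounded_linear_add bounded_linear_mult_left[THEN bounded_linear_compose] bounded_linear_fst bounded_linear_snd)
  have "((\<lambda>p. \<integral>t. m t * ?e t p \<partial>M) has_derivative (\<lambda>d. fst d * ?A + snd d * ?B)) (at (z, w))"
  proof (rule has_derivative_quadraticI[OF bl, where K = ?K])
    fix d :: "complex \<times> complex" assume d1: "norm d \<le> 1"
    let ?\<delta> = "\<lambda>t. of_real (a t) * fst d + of_real (b t) * snd d"
    have "(\<integral>t. m t * ?e t ((z, w) + d) \<partial>M) - (\<integral>t. m t * ?e t (z, w) \<partial>M) - (fst d * ?A + snd d * ?B)
      = (\<integral>t. m t * ?e t ((z, w) + d) - m t * ?e t (z, w) - (fst d * (\<i> * of_real (a t) * m t * ?e t (z, w)) + snd d * (\<i> * of_real (b t) * m t * ?e t (z, w))) \<partial>M)"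
      using i1[of "(z, w) + d"] i1[of "(z, w)"] i2[of "(z, w)"] by simp
    also have "\<dots> = (\<integral>t. m t * (?e t (z, w) * (exp (\<i> * ?\<delta> t) - 1 - \<i> * ?\<delta> t)) \<partial>M)"
      by (intro Bochner_Integration.integral_cong refl) (simp add: exp_add[symmetric] algebra_simps)
    finally have eq: "(\<integral>t. m t * ?e t ((z, w) + d) \<partial>M) - (\<integral>t. m t * ?e t (z, w) \<partial>M) - (fst d * ?A + snd d * ?B) = \<dots>" .
    have bd: "norm (m t * (?e t (z, w) * (exp (\<i> * ?\<delta> t) - 1 - \<i> * ?\<delta> t)))
      \<le> norm (m t) * (exp (L (z, w)) * (exp (2 * R') * (2 * R')\<^sup>2)) * (norm d)\<^sup>2" for t
    proof (cases "m t = 0")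
      case False
      have n: "norm (fst d) \<le> norm d" "norm (snd d) \<le> norm d"
        using norm_fst_le[of "fst d" "snd d"] norm_snd_le[of "snd d" "fst d"] by auto
      have Ld: "L d \<le> 2 * R' * norm d"
        using mult_left_mono[OF add_mono[OF n] R'(1)] by (simp add: L_def)
      have 1: "norm (?\<delta> t) \<le> 2 * R' * norm d" using lin[OF False, of d] Ld by linarith
      have 2: "\<bar>Re (\<i> * ?\<delta> t)\<bar> \<le> 2 * R'"
      proof -
        have "\<bar>Re (\<i> * ?\<delta> t)\<bar> \<le> norm (\<i> * ?\<delta> t)" by (rule abs_Re_le_cmod)
        also have "\<dots> \<le> 2 * R' * norm d" using 1 by (simp add: norm_mult)
        also have "\<dots> \<le> 2 * R' * 1" using d1 R'(1) by (intro mult_left_mono) auto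
        finally show ?thesis by simp
      qed
      have "norm (exp (\<i> * ?\<delta> t) - 1 - \<i> * ?\<delta> t) \<le> exp \<bar>Re (\<i> * ?\<delta> t)\<bar> * (norm (\<i> * ?\<delta> t))\<^sup>2"
        by (rule norm_exp_remainder)
      also have "\<dots> \<le> exp (2 * R') * (2 * R' * norm d)\<^sup>2"
        using 1 2 by (intro mult_mono power_mono) (simp_all add: norm_mult)
      finally have 3: "norm (exp (\<i> * ?\<delta> t) - 1 - \<i> * ?\<delta> t) \<le> exp (2 * R') * (2 * R' * norm d)\<^sup>2" .
      have "norm (?e t (z, w)) * norm (exp (\<i> * ?\<delta> t) - 1 - \<i> * ?\<delta> t) \<le> exp (L (z, w)) * (exp (2 * R') * (2 * R' * norm d)\<^sup>2)"
        using ebd[OF False, of "(z, w)"] 3 by (intro mult_mono) auto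
      then have "norm (m t) * (norm (?e t (z, w)) * norm (exp (\<i> * ?\<delta> t) - 1 - \<i> * ?\<delta> t)) \<le> norm (m t) * (exp (L (z, w)) * (exp (2 * R') * (2 * R' * norm d)\<^sup>2))"
        by (rule mult_left_mono) simp
      then show ?thesis by (simp only: norm_mult power_mult_distrib mult_ac)
    qed simp
    have K: "?K * (norm d)\<^sup>2 = (\<integral>t. norm (m t) * (exp (L (z, w)) * (exp (2 * R') * (2 * R')\<^sup>2)) * (norm d)\<^sup>2 \<partial>M)"
      by simp
    show "norm ((\<integral>t. m t * ?e t ((z, w) + d) \<partial>M) - (\<integral>t. m t * ?e t (z, w) \<partial>M) - (fst d * ?A + snd d * ?B)) \<le> ?K * (norm d)\<^sup>2"
      unfolding eq K
    proof (rule norm_integral_le)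
      show "integrable M (\<lambda>t. norm (m t) * (exp (L (z, w)) * (exp (2 * R') * (2 * R')\<^sup>2)) * (norm d)\<^sup>2)"
        using m by (intro integrable_mult_left integrable_norm)
    qed (rule bd)
  qed
  then show ?thesis by simp
qed

subsection \<open>Fourier inversion\<close>

text \<open>With the sign and normalization of \<open>fourier\<close>, this is the inverse Fourier
  transform. As \<open>fourier\<close> is a reflected and rescaled \<open>EI\<close>, one operator
  carries the estimates for both.\<close>

definition EI :: "(real \<times> real \<Rightarrow> complex) \<Rightarrow> real \<times> real \<Rightarrow> complex" where
  "EI f z = (\<integral>w. f w * cis (fst w * fst z + snd w * snd z) \<partial>lborel)"

lemma fourier_eq_EI: "fourier \<phi> z = of_real (1 / (4 * pi\<^sup>2)) * EI \<phi> (- z)"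
  by (cases z) (simp add: fourier_def EI_def cis_conv_exp case_prod_beta' algebra_simps)

lemma measurable_cis [measurable]: "cis \<in> borel_measurable borel"
  by (intro borel_measurable_continuous_onI) (simp add: continuous_on_cis continuous_on_id)

lemma measurable_fst_borel [measurable]: "(fst :: real \<times> real \<Rightarrow> real) \<in> borel_measurable borel"
  by (intro borel_measurable_continuous_onI continuous_intros)

lemma measurable_snd_borel [measurable]: "(snd :: real \<times> real \<Rightarrow> real) \<in> borel_measurable borel"
  by (intro borel_measurable_continuous_onI continuous_intros)

lemma integrable_cis:
  assumes "integrable M m" "\<theta> \<in> borel_measurable M"
  shows "integrable M (\<lambda>t. m t * cis (\<theta> t))"
  by (rule integrable_bound_mult[OF assms(1), of _ 1]) (use assms(2) in simp_all)

lemma norm_EI_le: "norm (EI f z) \<le> (\<integral>w. norm (f w) \<partial>lborel)"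
  unfolding EI_def using integral_norm_bound[of lborel "\<lambda>w. f w * cis (fst w * fst z + snd w * snd z)"]
  by (simp add: norm_mult)

text \<open>Fubini: pairing an oscillatory integral with \<open>p\<close> amounts to evaluating the
  transform of \<open>p\<close> at the phases. This is the multiplication formula in the proof of
  inversion, and it later computes the Fourier transform of the solution as a distribution.\<close>

lemma integral_cis_swap:
  fixes m :: "'a \<Rightarrow> complex" and a b :: "'a \<Rightarrow> real"
  assumes "sigma_finite_measure M" "integrable M m" and [measurable]: "a \<in> borel_measurable M" "b \<in> borel_measurable M"
    and "integrable lborel p"
  shows "(\<integral>z. (\<integral>t. m t * cis (a t * fst z + b t * snd z) \<partial>M) * p z \<partial>lborel) = (\<integral>t. m t * EI p (a t, b t) \<partial>M)"
proof -
  interpret M: sigma_finite_measure M by fact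
  interpret pair_sigma_finite M "lborel :: (real \<times> real) measure" ..
  have "integrable (M \<Otimes>\<^sub>M lborel) (\<lambda>x. (m (fst x) * p (snd x)) * cis (a (fst x) * fst (snd x) + b (fst x) * snd (snd x)))"
    by (rule integrable_cis[OF integrable_tensor]) (use assms in \<open>auto intro: lborel.sigma_finite_measure_axioms\<close>)
  then have i: "integrable (M \<Otimes>\<^sub>M lborel) (\<lambda>(t, z). (m t * cis (a t * fst z + b t * snd z)) * p z)"
    by (simp add: case_prod_beta' mult_ac)
  have "(\<integral>z. (\<integral>t. m t * cis (a t * fst z + b t * snd z) \<partial>M) * p z \<partial>lborel) =
      (\<integral>z. (\<integral>t. (m t * cis (a t * fst z + b t * snd z)) * p z \<partial>M) \<partial>lborel)"
    by simp
  also have "\<dots> = (\<integral>t. (\<integral>z. (m t * cis (a t * fst z + b t * snd z)) * p z \<partial>lborel) \<partial>M)"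
    by (rule Fubini_integral[OF i])
  also have "\<dots> = (\<integral>t. m t * EI p (a t, b t) \<partial>M)"
    by (simp add: EI_def integral_mult_right_zero[symmetric] mult_ac del: integral_mult_right_zero)
  finally show ?thesis .
qed

section \<open>The Gaussian and its transform\<close>

definition gauss :: "real \<times> real \<Rightarrow> real" where
  "gauss z = std_normal_density (fst z) * std_normal_density (snd z)"

lemma char_std_normal_lborel:
  "(\<integral>x. of_real (std_normal_density x) * cis (x * t) \<partial>lborel) = complex_of_real (exp (- t\<^sup>2 / 2))"
proof -
  have "(\<integral>x. of_real (std_normal_density x) * cis (x * t) \<partial>lborel) = char std_normal_distribution t"
    unfolding char_def
    by (subst integral_density) (auto simp: cis_conv_exp scaleR_conv_of_real mult_ac)
  then show ?thesis by (simp add: char_std_normal_distribution)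
qed

lemma integrable_gauss: "integrable lborel gauss"
proof -
  have "integrable (lborel \<Otimes>\<^sub>M lborel) (\<lambda>z. std_normal_density (fst z) * std_normal_density (snd z))"
    by (rule integrable_tensor) (auto intro: lborel.sigma_finite_measure_axioms)
  then show ?thesis by (simp add: lborel_prod gauss_def[abs_def])
qed

lemma EI_gauss: "EI (\<lambda>z. of_real (gauss z)) z = of_real (2 * pi * gauss z)"
proof -
  obtain s t where z: "z = (s, t)" by (cases z)
  let ?f = "\<lambda>s x. complex_of_real (std_normal_density x) * cis (x * s)"
  have i: "integrable lborel (?f s)" for s
    by (rule integrable_cis) auto
  have "EI (\<lambda>z. of_real (gauss z)) z = (\<integral>w. ?f s (fst w) * ?f t (snd w) \<partial>(lborel \<Otimes>\<^sub>M lborel))"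
    by (simp add: EI_def z gauss_def lborel_prod cis_mult[symmetric] mult_ac)
  also have "\<dots> = (\<integral>x. ?f s x \<partial>lborel) * (\<integral>x. ?f t x \<partial>lborel)"
    using i by (intro integral_tensor) (auto intro: lborel.sigma_finite_measure_axioms)
  also have "\<dots> = of_real (exp (- s\<^sup>2 / 2) * exp (- t\<^sup>2 / 2))"
    unfolding char_std_normal_lborel by simp
  also have "exp (- s\<^sup>2 / 2) * exp (- t\<^sup>2 / 2) = 2 * pi * gauss z"
  proof -
    define S where "S = sqrt (2 * pi)"
    have "S * S = 2 * pi" "S \<noteq> 0" by (simp_all add: S_def)
    then show ?thesis
      unfolding gauss_def std_normal_density_def S_def[symmetric] z by (simp add: field_simps)
  qed
  finally show ?thesis .
qed

lemma lborel_integral_affine: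
  fixes f :: "real \<times> real \<Rightarrow> complex"
  assumes c: "0 < c" and f: "f \<in> borel_measurable borel"
  shows "(\<integral>z. f z \<partial>lborel) = of_real (c\<^sup>2) * (\<integral>z. f (z0 + c *\<^sub>R z) \<partial>lborel)"
proof -
  have "(\<integral>z. f z \<partial>lborel) = (\<integral>z. f z \<partial>(density (distr lborel borel (\<lambda>x. z0 + c *\<^sub>R x)) (\<lambda>_. ennreal (\<bar>c\<bar> ^ DIM(real \<times> real)))))"
    using c by (subst lborel_affine[of c z0]) simp_all
  also have "\<dots> = (\<integral>z. \<bar>c\<bar> ^ DIM(real \<times> real) *\<^sub>R f z \<partial>(distr lborel borel (\<lambda>x. z0 + c *\<^sub>R x)))"
    using f by (subst integral_density) auto
  also have "\<dots> = (\<integral>z. \<bar>c\<bar> ^ DIM(real \<times> real) *\<^sub>R f (z0 + c *\<^sub>R z) \<partial>lborel)"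
    using f by (subst integral_distr) auto
  also have "\<dots> = of_real (c\<^sup>2) * (\<integral>z. f (z0 + c *\<^sub>R z) \<partial>lborel)"
    by (simp add: scaleR_conv_of_real power2_eq_square)
  finally show ?thesis .
qed

lemma gauss_integral: "(\<integral>z. complex_of_real (gauss z) \<partial>lborel) = 1"
  using EI_gauss[of "(0, 0)"] by (simp add: EI_def gauss_def std_normal_density_def)

lemma EI_gauss_scaled:
  assumes "0 < c"
  shows "EI (\<lambda>z. of_real (gauss (c *\<^sub>R z))) z = of_real (2 * pi / c\<^sup>2 * gauss (z /\<^sub>R c))"
proof -
  have [measurable]: "gauss \<in> borel_measurable borel" using integrable_gauss by auto
  have "EI (\<lambda>z. of_real (gauss z)) (z /\<^sub>R c) = of_real (c\<^sup>2) * EI (\<lambda>z. of_real (gauss (c *\<^sub>R z))) z"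
    unfolding EI_def using assms
    by (subst lborel_integral_affine[OF assms, of _ 0], measurable) (simp add: field_simps)
  then show ?thesis using assms by (simp add: EI_gauss field_simps)
qed

text \<open>The inversion integral is regularized by a Gaussian, whose transform is an approximate identity.\<close>

theorem fourier_inversion:
  fixes \<phi> :: "real \<times> real \<Rightarrow> complex"
  assumes int: "integrable lborel \<phi>" and bd: "\<And>w. norm (\<phi> w) \<le> B" and cont: "continuous_on UNIV \<phi>"
    and inth: "integrable lborel (fourier \<phi>)"
  shows "EI (fourier \<phi>) z = \<phi> z"
proof -
  define \<epsilon> where "\<epsilon> n = inverse (real (Suc n))" for n
  have \<epsilon>: "0 < \<epsilon> n" "\<epsilon> \<longlonglongrightarrow> 0" for n
    unfolding \<epsilon>_def[abs_def] using LIMSEQ_inverse_real_of_nat by (simp, blast)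
  have [measurable]: "\<phi> \<in> borel_measurable borel" "gauss \<in> borel_measurable borel" "fourier \<phi> \<in> borel_measurable borel"
    using int integrable_gauss inth by auto
  define G where "G n w = complex_of_real (gauss (\<epsilon> n *\<^sub>R w)) * cis (fst w * fst z + snd w * snd z)" for n w
  have iG: "integrable lborel (G n)" for n
  proof -
    \<comment> \<open>Integrability is read off from the transform at \<open>0\<close>: its value is
      known to be nonzero, while the integral of a non-integrable function has the default value
      \<open>0\<close>.\<close>
    have "integrable lborel (\<lambda>w. complex_of_real (gauss (\<epsilon> n *\<^sub>R w)))"
    proof (rule ccontr)
      assume "\<not> integrable lborel (\<lambda>w. complex_of_real (gauss (\<epsilon> n *\<^sub>R w)))"
      then have "EI (\<lambda>z. of_real (gauss (\<epsilon> n *\<^sub>R z))) 0 = 0"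
        unfolding EI_def using not_integrable_integral_eq by (simp del: integral_complex_of_real)
      then show False using EI_gauss_scaled[OF \<epsilon>(1), of n 0] \<epsilon>(1)[of n] by (simp add: gauss_def std_normal_density_def)
    qed
    then show ?thesis unfolding G_def by (intro integrable_cis) auto
  qed
  have EG: "EI (G n) w = of_real (2 * pi / (\<epsilon> n)\<^sup>2 * gauss ((w + z) /\<^sub>R \<epsilon> n))" for n w
  proof -
    have "EI (G n) w = EI (\<lambda>z. of_real (gauss (\<epsilon> n *\<^sub>R z))) (w + z)"
      by (simp add: EI_def G_def cis_mult mult.assoc algebra_simps)
    then show ?thesis using EI_gauss_scaled[OF \<epsilon>(1)] by simp
  qed
  have lhs: "(\<lambda>n. \<integral>w. fourier \<phi> w * G n w \<partial>lborel) \<longlonglongrightarrow> (\<integral>w. fourier \<phi> w * (of_real (gauss 0) * cis (fst w * fst z + snd w * snd z)) \<partial>lborel)"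
  proof (rule integral_dominated_convergence[where w = "\<lambda>w. norm (fourier \<phi> w)"])
    have "(\<lambda>n. fourier \<phi> w * G n w) \<longlonglongrightarrow> fourier \<phi> w * (of_real (gauss 0) * cis (fst w * fst z + snd w * snd z))" for w
    proof -
      have "continuous_on UNIV gauss"
        unfolding gauss_def std_normal_density_def by (intro continuous_intros) auto
      then have "isCont gauss 0" using continuous_on_eq_continuous_at[OF open_UNIV] by blast
      moreover have "(\<lambda>n. \<epsilon> n *\<^sub>R w) \<longlonglongrightarrow> 0" using \<epsilon>(2) by (auto intro!: tendsto_eq_intros)
      ultimately have "(\<lambda>n. gauss (\<epsilon> n *\<^sub>R w)) \<longlonglongrightarrow> gauss 0" by (rule isCont_tendsto_compose)
      then show ?thesis unfolding G_def by (intro tendsto_intros)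
    qed
    then show "AE w in lborel. (\<lambda>n. fourier \<phi> w * G n w) \<longlonglongrightarrow> fourier \<phi> w * (of_real (gauss 0) * cis (fst w * fst z + snd w * snd z))"
      by simp
    have d1: "0 \<le> std_normal_density x" "std_normal_density x \<le> 1" for x
    proof -
      have "1 \<le> sqrt (2 * pi)" using pi_gt3 by (simp add: real_le_rsqrt)
      moreover have "exp (- x\<^sup>2 / 2) \<le> 1" by simp
      ultimately have "exp (- x\<^sup>2 / 2) / sqrt (2 * pi) \<le> 1"
        by (subst divide_le_eq_1_pos) linarith+
      then show "std_normal_density x \<le> 1"
        unfolding std_normal_density_def by (simp only: times_divide_eq_left mult_1)
    qed simp
    have "\<bar>gauss v\<bar> \<le> 1" for v
      unfolding gauss_def using d1[of "fst v"] d1[of "snd v"] by (simp add: mult_le_one)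
    then have "norm (fourier \<phi> w * G n w) \<le> norm (fourier \<phi> w)" for n w
      by (simp add: G_def norm_mult mult_left_le)
    then show "AE w in lborel. norm (fourier \<phi> w * G n w) \<le> norm (fourier \<phi> w)" for n by simp
  qed (use inth in \<open>auto simp: G_def\<close>)
  \<comment> \<open>The multiplication formula moves the transform from \<open>\<phi>\<close> onto
    the Gaussian, which becomes a bump of width \<open>\<epsilon> n\<close> around \<open>z\<close>;
    the substitution \<open>t = z + \<epsilon> n v\<close> cancels its height, of order
    \<open>1 / (\<epsilon> n)^2\<close>.\<close>
  have "(\<integral>w. fourier \<phi> w * G n w \<partial>lborel) = of_real (1 / (2 * pi)) * (\<integral>v. \<phi> (z + \<epsilon> n *\<^sub>R v) * of_real (gauss v) \<partial>lborel)" for n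
  proof -
    have "(\<integral>w. fourier \<phi> w * G n w \<partial>lborel) =
        of_real (1 / (4 * pi\<^sup>2)) * (\<integral>w. (\<integral>t. \<phi> t * cis ((- fst t) * fst w + (- snd t) * snd w) \<partial>lborel) * G n w \<partial>lborel)"
      by (simp add: fourier_eq_EI EI_def mult.assoc flip: integral_mult_right_zero)
    also have "(\<integral>w. (\<integral>t. \<phi> t * cis ((- fst t) * fst w + (- snd t) * snd w) \<partial>lborel) * G n w \<partial>lborel) =
        (\<integral>t. \<phi> t * EI (G n) (- fst t, - snd t) \<partial>lborel)"
      using int iG by (intro integral_cis_swap) (auto intro: lborel.sigma_finite_measure_axioms)
    also have "\<dots> = (\<integral>t. \<phi> t * of_real (2 * pi / (\<epsilon> n)\<^sup>2 * gauss ((z - t) /\<^sub>R \<epsilon> n)) \<partial>lborel)"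
      unfolding EG by (intro Bochner_Integration.integral_cong refl) (simp add: prod_eq_iff gauss_def)
    also have "\<dots> = of_real ((\<epsilon> n)\<^sup>2) * (\<integral>v. \<phi> (z + \<epsilon> n *\<^sub>R v) * of_real (2 * pi / (\<epsilon> n)\<^sup>2 * gauss ((z - (z + \<epsilon> n *\<^sub>R v)) /\<^sub>R \<epsilon> n)) \<partial>lborel)"
      by (rule lborel_integral_affine[OF \<epsilon>(1)]) measurable
    also have "\<dots> = of_real ((\<epsilon> n)\<^sup>2) * (\<integral>v. of_real (2 * pi / (\<epsilon> n)\<^sup>2) * (\<phi> (z + \<epsilon> n *\<^sub>R v) * of_real (gauss v)) \<partial>lborel)"
    proof -
      have "(z - (z + \<epsilon> n *\<^sub>R v)) /\<^sub>R \<epsilon> n = - v" for v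
        using \<epsilon>(1)[of n] by simp
      moreover have "gauss (- v) = gauss v" for v by (simp add: gauss_def std_normal_density_def)
      ultimately show ?thesis by (simp add: mult_ac)
    qed
    also have "\<dots> = of_real (2 * pi) * (\<integral>v. \<phi> (z + \<epsilon> n *\<^sub>R v) * of_real (gauss v) \<partial>lborel)"
      using \<epsilon>(1)[of n] by (simp add: field_simps)
    finally show ?thesis by (simp add: power2_eq_square)
  qed
  moreover have "(\<lambda>n. \<integral>v. \<phi> (z + \<epsilon> n *\<^sub>R v) * of_real (gauss v) \<partial>lborel) \<longlonglongrightarrow> (\<integral>v. \<phi> z * of_real (gauss v) \<partial>lborel)"
  proof (rule integral_dominated_convergence[where w = "\<lambda>v. B * \<bar>gauss v\<bar>"])
    have "(\<lambda>n. \<phi> (z + \<epsilon> n *\<^sub>R v) * of_real (gauss v)) \<longlonglongrightarrow> \<phi> z * of_real (gauss v)" for v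
    proof -
      have "isCont \<phi> z" using cont continuous_on_eq_continuous_at[OF open_UNIV] by blast
      moreover have "(\<lambda>n. z + \<epsilon> n *\<^sub>R v) \<longlonglongrightarrow> z" using \<epsilon>(2) by (auto intro!: tendsto_eq_intros)
      ultimately have "(\<lambda>n. \<phi> (z + \<epsilon> n *\<^sub>R v)) \<longlonglongrightarrow> \<phi> z" by (rule isCont_tendsto_compose)
      then show ?thesis by (intro tendsto_intros)
    qed
    then show "AE v in lborel. (\<lambda>n. \<phi> (z + \<epsilon> n *\<^sub>R v) * of_real (gauss v)) \<longlonglongrightarrow> \<phi> z * of_real (gauss v)" by simp
    show "AE v in lborel. norm (\<phi> (z + \<epsilon> n *\<^sub>R v) * of_real (gauss v)) \<le> B * \<bar>gauss v\<bar>" for n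
      using bd by (simp add: norm_mult mult_right_mono)
    show "integrable lborel (\<lambda>v. B * \<bar>gauss v\<bar>)" using integrable_gauss by simp
  qed measurable
  ultimately have "(\<lambda>n. \<integral>w. fourier \<phi> w * G n w \<partial>lborel) \<longlonglongrightarrow> of_real (1 / (2 * pi)) * \<phi> z"
    using gauss_integral by (auto intro!: tendsto_eq_intros)
  with lhs have "(\<integral>w. fourier \<phi> w * (of_real (gauss 0) * cis (fst w * fst z + snd w * snd z)) \<partial>lborel) = of_real (1 / (2 * pi)) * \<phi> z"
    by (rule LIMSEQ_unique)
  moreover have "(\<integral>w. fourier \<phi> w * (of_real (gauss 0) * cis (fst w * fst z + snd w * snd z)) \<partial>lborel) = of_real (gauss 0) * EI (fourier \<phi>) z"
    by (simp add: EI_def mult_ac flip: integral_mult_right_zero)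
  moreover have "gauss 0 = 1 / (2 * pi)" by (simp add: gauss_def std_normal_density_def)
  ultimately show ?thesis by simp
qed

subsection \<open>Schwartz functions\<close>

lemma deriv_multi_simps [simp]:
  "deriv_multi (0, 0) f = f"
  "deriv_multi (Suc a, b) f = partial_x UNIV (deriv_multi (a, b) f)"
  "deriv_multi (0, Suc b) f = partial_y UNIV (deriv_multi (0, b) f)"
  by (simp_all add: deriv_multi_def)

lemma deriv_multi_induct:
  assumes "P f" "\<And>g. P g \<Longrightarrow> P (partial_x UNIV g)" "\<And>g. P g \<Longrightarrow> P (partial_y UNIV g)"
  shows "P (deriv_multi \<alpha> f)"
proof -
  obtain a b where \<alpha>: "\<alpha> = (a, b)" by (cases \<alpha>)
  have "P (deriv_multi (0, b) f)" by (induction b) (use assms in auto)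
  then have "P (deriv_multi (a, b) f)" by (induction a) (use assms in auto)
  then show ?thesis by (simp add: \<alpha>)
qed

lemma smooth_on_deriv_multi: "smooth_on UNIV f \<Longrightarrow> smooth_on UNIV (deriv_multi \<alpha> f)"
  by (rule deriv_multi_induct) (auto intro: smooth_on_partials)

lemma partial_x_has_vector_derivative:
  "smooth_on UNIV f \<Longrightarrow> ((\<lambda>t. f (t, y)) has_vector_derivative partial_x UNIV f (x, y)) (at x)"
  using has_derivative_slice_x[OF smooth_on_has_derivative[OF open_UNIV UNIV_I], of f y x] by simp

lemma partial_y_has_vector_derivative:
  "smooth_on UNIV f \<Longrightarrow> ((\<lambda>t. f (x, t)) has_vector_derivative partial_y UNIV f (x, y)) (at y)"
  using has_derivative_slice_y[OF smooth_on_has_derivative[OF open_UNIV UNIV_I], of f x y] by simp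

lemma schwartz_smooth: "f \<in> schwartz \<Longrightarrow> smooth_on UNIV f"
  by (simp add: schwartz_def)

text \<open>The seminorms needed for decay like \<open>(wt z)^2\<close>. The leading
  \<open>4\<close> is \<open>2 * 2\<close>, from \<open>(1 + x^2)^2 <= 2 * (1 + x^4)\<close> in each
  variable.\<close>

definition schwartz_norm :: "nat \<times> nat \<Rightarrow> (real \<times> real \<Rightarrow> complex) \<Rightarrow> real" where
  "schwartz_norm \<alpha> f = 4 * (sup_norm UNIV (weighted_deriv (0, 0) \<alpha> f) + sup_norm UNIV (weighted_deriv (4, 0) \<alpha> f)
    + sup_norm UNIV (weighted_deriv (0, 4) \<alpha> f) + sup_norm UNIV (weighted_deriv (4, 4) \<alpha> f))"

lemma norm_le_sup_norm:
  assumes "bounded (f ` S)" "z \<in> S"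
  shows "norm (f z) \<le> sup_norm S f"
  unfolding sup_norm_def
  by (rule cSUP_upper) (use assms in \<open>auto simp: bounded_iff bdd_above_def\<close>)

lemma schwartz_weighted_le: "f \<in> schwartz \<Longrightarrow> norm (weighted_deriv \<beta> \<alpha> f z) \<le> sup_norm UNIV (weighted_deriv \<beta> \<alpha> f)"
  by (rule norm_le_sup_norm) (auto simp: schwartz_def simp del: split_paired_All)

lemma norm_le_wt2I:
  assumes "a \<le> C0" "(fst z)^4 * a \<le> C1" "(snd z)^4 * a \<le> C2" "(fst z)^4 * (snd z)^4 * a \<le> C3" "0 \<le> a"
  shows "a \<le> 4 * (C0 + C1 + C2 + C3) * (wt z)\<^sup>2"
proof -
  have sq: "(1 + x\<^sup>2)\<^sup>2 \<le> 2 * (1 + x^4)" for x :: real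
  proof -
    have "0 \<le> (1 - x\<^sup>2)\<^sup>2" by simp
    then show ?thesis by (simp add: power2_eq_square power4_eq_xxxx algebra_simps)
  qed
  let ?p = "(1 + (fst z)\<^sup>2)\<^sup>2 * (1 + (snd z)\<^sup>2)\<^sup>2"
  have "?p * a \<le> (2 * (1 + (fst z)^4)) * (2 * (1 + (snd z)^4)) * a"
    using sq assms(5) by (intro mult_right_mono mult_mono) auto
  also have "\<dots> \<le> 4 * (C0 + C1 + C2 + C3)"
    using assms(1-4) by (simp add: algebra_simps)
  finally have *: "?p * a \<le> 4 * (C0 + C1 + C2 + C3)" .
  have "0 < 1 + (fst z)\<^sup>2" "0 < 1 + (snd z)\<^sup>2" by (auto simp: add_pos_nonneg)
  then have "0 < ?p" by simp
  with * show ?thesis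
    by (simp add: wt_def power_divide power_mult_distrib pos_le_divide_eq mult.commute)
qed

lemma schwartz_decay:
  assumes "f \<in> schwartz"
  shows "norm (deriv_multi \<alpha> f z) \<le> schwartz_norm \<alpha> f * (wt z)\<^sup>2"
  unfolding schwartz_norm_def
  by (rule norm_le_wt2I)
    (use schwartz_weighted_le[OF assms, of "(0,0)" \<alpha> z] schwartz_weighted_le[OF assms, of "(4,0)" \<alpha> z]
      schwartz_weighted_le[OF assms, of "(0,4)" \<alpha> z] schwartz_weighted_le[OF assms, of "(4,4)" \<alpha> z]
     in \<open>simp_all add: weighted_deriv_def norm_mult norm_power\<close>)

lemma wt_le_1: "wt z \<le> 1"
proof -
  have "1 * 1 \<le> (1 + (fst z)\<^sup>2) * (1 + (snd z)\<^sup>2)" by (intro mult_mono) auto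
  then show ?thesis by (simp add: wt_def)
qed

lemma wt2_le_wt: "(wt z)\<^sup>2 \<le> wt z"
  using wt_le_1[of z] wt_pos[of z] by (simp add: power2_eq_square mult_left_le)

lemma square_wt_le_1: "(fst z)\<^sup>2 * wt z \<le> 1" "(snd z)\<^sup>2 * wt z \<le> 1"
proof -
  have "(fst z)\<^sup>2 * 1 \<le> (1 + (fst z)\<^sup>2) * (1 + (snd z)\<^sup>2)" "1 * (snd z)\<^sup>2 \<le> (1 + (fst z)\<^sup>2) * (1 + (snd z)\<^sup>2)"
    by (intro mult_mono; simp)+
  moreover have "0 < 1 + (fst z)\<^sup>2" "0 < 1 + (snd z)\<^sup>2" by (auto simp: add_pos_nonneg)
  ultimately show "(fst z)\<^sup>2 * wt z \<le> 1" "(snd z)\<^sup>2 * wt z \<le> 1"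
    by (simp_all add: wt_def)
qed

lemma wt2_nonneg_const:
  assumes "norm (f z) \<le> C * (wt z)\<^sup>2"
  shows "0 \<le> C"
  using order_trans[OF norm_ge_zero assms] wt_pos[of z] by (simp add: zero_le_mult_iff)

text \<open>Decay like \<open>(wt z)^2\<close> leaves one factor \<open>wt\<close> to absorb a power
  of a coordinate up to the second, and one for integrability.\<close>

lemma integrable_wt2_bound:
  fixes f :: "real \<times> real \<Rightarrow> complex"
  assumes meas: "f \<in> borel_measurable borel" and bd: "\<And>z. norm (f z) \<le> C * (wt z)\<^sup>2"
  shows "integrable lborel f" "integrable lborel (\<lambda>z. of_real ((fst z)\<^sup>2) * f z)" "integrable lborel (\<lambda>z. of_real ((snd z)\<^sup>2) * f z)"
    "integrable lborel (\<lambda>z. of_real (fst z) * f z)" "integrable lborel (\<lambda>z. of_real (snd z) * f z)"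
proof -
  note C = wt2_nonneg_const[of f, OF bd]
  have *: "norm (g z * f z) \<le> C * wt z" if "norm (g z) * wt z \<le> 1" for g :: "real \<times> real \<Rightarrow> complex" and z
  proof -
    have "norm (g z * f z) \<le> norm (g z) * (C * (wt z)\<^sup>2)" by (simp add: norm_mult bd mult_left_mono)
    also have "\<dots> = (norm (g z) * wt z) * (C * wt z)" by (simp add: power2_eq_square)
    also have "\<dots> \<le> 1 * (C * wt z)" using that C wt_pos[of z] by (intro mult_right_mono) auto
    finally show ?thesis by simp
  qed
  have ab: "\<bar>a\<bar> * wt z \<le> 1" if "a\<^sup>2 * wt z \<le> 1" for a z
  proof -
    have "(\<bar>a\<bar> * wt z)\<^sup>2 = (a\<^sup>2 * wt z) * wt z" by (simp add: power_mult_distrib power2_eq_square)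
    also have "\<dots> \<le> 1 * 1" using that wt_le_1[of z] wt_pos[of z] by (intro mult_mono) auto
    finally show ?thesis by (simp add: abs_square_le_1 abs_mult wt_pos less_imp_le)
  qed
  show "integrable lborel f"
    by (rule integrable_wt_bound[OF meas]) (use *[of "\<lambda>_. 1"] wt_le_1 in simp)
  show "integrable lborel (\<lambda>z. of_real ((fst z)\<^sup>2) * f z)" "integrable lborel (\<lambda>z. of_real ((snd z)\<^sup>2) * f z)"
    by (rule integrable_wt_bound[where C = C]; use meas *[of "\<lambda>z. of_real ((fst z)\<^sup>2)"] *[of "\<lambda>z. of_real ((snd z)\<^sup>2)"] square_wt_le_1 in \<open>simp del: of_real_power\<close>)+
  show "integrable lborel (\<lambda>z. of_real (fst z) * f z)" "integrable lborel (\<lambda>z. of_real (snd z) * f z)"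
    by (rule integrable_wt_bound[where C = C]; use meas *[of "\<lambda>z. of_real (fst z)"] *[of "\<lambda>z. of_real (snd z)"] ab square_wt_le_1 in simp)+
qed

section \<open>The Fourier transform of Schwartz functions\<close>

lemma smooth_on_measurable: "smooth_on UNIV f \<Longrightarrow> f \<in> borel_measurable borel"
  by (intro borel_measurable_continuous_onI smooth_on_continuous_on)

lemma schwartz_integrable: "f \<in> schwartz \<Longrightarrow> integrable lborel (deriv_multi \<alpha> f)"
  by (rule integrable_wt2_bound(1)[OF _ schwartz_decay])
    (auto intro: smooth_on_measurable smooth_on_deriv_multi schwartz_smooth)

text \<open>Integration by parts: the derivative of \<open>f\<close> times the exponential has
  integral zero. The enlarged constant \<open>C'\<close> pays for the term in which the exponential
  is differentiated.\<close>

lemma EI_partial: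
  assumes "smooth_on UNIV f" and bd: "\<And>w. norm (f w) \<le> C * wt w"
  shows "(\<And>w. norm (partial_x UNIV f w) \<le> C * wt w) \<Longrightarrow> EI (partial_x UNIV f) z = - (\<i> * of_real (fst z)) * EI f z"
    and "(\<And>w. norm (partial_y UNIV f w) \<le> C * wt w) \<Longrightarrow> EI (partial_y UNIV f) z = - (\<i> * of_real (snd z)) * EI f z"
proof -
  let ?e = "\<lambda>w. cis (fst w * fst z + snd w * snd z)"
  have C: "0 \<le> C" using order_trans[OF norm_ge_zero bd[of 0]] wt_pos[of 0] by (simp add: zero_le_mult_iff)
  define C' where "C' = C + (\<bar>fst z\<bar> + \<bar>snd z\<bar>) * C"
  have C': "C \<le> C'" "C + \<bar>fst z\<bar> * C \<le> C'" "C + \<bar>snd z\<bar> * C \<le> C'"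
    using C by (auto simp: C'_def algebra_simps)
  have cont: "continuous_on UNIV f" "continuous_on UNIV (partial_x UNIV f)" "continuous_on UNIV (partial_y UNIV f)"
    using assms(1) by (auto intro: smooth_on_continuous_on smooth_on_partials)
  have meas: "f \<in> borel_measurable borel" "partial_x UNIV f \<in> borel_measurable borel" "partial_y UNIV f \<in> borel_measurable borel"
    using cont by (auto intro: borel_measurable_continuous_onI)
  have G: "norm (f w * ?e w) \<le> C' * wt w" for w
    using order_trans[OF bd[of w] mult_right_mono[OF C'(1)]] wt_pos[of w] by (simp add: norm_mult)
  have if': "integrable lborel f" using integrable_wt_bound[OF meas(1) bd] .
  have dercis: "((\<lambda>t. cis (t * a + b)) has_vector_derivative (\<i> * of_real a * cis (x * a + b))) (at x)" for a b x :: real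
  proof -
    have "((\<lambda>t. exp (\<i> * (t * of_real a + of_real b))) has_field_derivative (\<i> * of_real a * exp (\<i> * (of_real x * of_real a + of_real b)))) (at (of_real x))"
      by (auto intro!: derivative_eq_intros)
    from has_vector_derivative_real_field[OF this]
    have "((\<lambda>t. exp (\<i> * of_real (t * a + b))) has_vector_derivative (\<i> * of_real a * exp (\<i> * of_real (x * a + b)))) (at x)"
      by simp
    then show ?thesis by (simp add: cis_conv_exp)
  qed
  have bound: "norm (g w * ?e w + f w * (\<i> * of_real a * ?e w)) \<le> C' * wt w"
    if "norm (g w) \<le> C * wt w" "C + \<bar>a\<bar> * C \<le> C'" for g :: "real \<times> real \<Rightarrow> complex" and a w
  proof -
    have "norm (g w * ?e w + f w * (\<i> * of_real a * ?e w)) \<le> norm (g w) + norm (f w) * \<bar>a\<bar>"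
      by (rule norm_triangle_le) (simp add: norm_mult)
    also have "\<dots> \<le> C * wt w + (C * wt w) * \<bar>a\<bar>" using that(1) bd[of w] by (intro add_mono mult_right_mono) auto
    also have "\<dots> = (C + \<bar>a\<bar> * C) * wt w" by (simp add: algebra_simps)
    also have "\<dots> \<le> C' * wt w" using that(2) wt_pos[of w] by (intro mult_right_mono) auto
    finally show ?thesis .
  qed
  { assume bx: "\<And>w. norm (partial_x UNIV f w) \<le> C * wt w"
    have "(\<integral>w. partial_x UNIV f w * ?e w + f w * (\<i> * of_real (fst z) * ?e w) \<partial>lborel) = 0"
    proof (rule integral_partial_x_zero[where G = "\<lambda>w. f w * ?e w" and C = C'])
      show "((\<lambda>t. f (t, y) * ?e (t, y)) has_vector_derivative
        (partial_x UNIV f (x, y) * ?e (x, y) + f (x, y) * (\<i> * of_real (fst z) * ?e (x, y)))) (at x)" for x y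
        using has_vector_derivative_mult[OF partial_x_has_vector_derivative[OF assms(1), of y x] dercis[of "fst z" "y * snd z" x]]
        by (simp add: add.commute)
    qed (use G bound[of "partial_x UNIV f", OF bx C'(2)] cont in \<open>auto intro!: continuous_intros\<close>)
    moreover have "integrable lborel (\<lambda>w. partial_x UNIV f w * ?e w)" "integrable lborel (\<lambda>w. f w * ?e w)"
      using integrable_wt_bound[OF meas(2) bx] if' by (auto intro!: integrable_cis)
    ultimately show "EI (partial_x UNIV f) z = - (\<i> * of_real (fst z)) * EI f z"
      by (simp add: EI_def mult.left_commute[of "f _"] eq_neg_iff_add_eq_0) }
  { assume by': "\<And>w. norm (partial_y UNIV f w) \<le> C * wt w"
    have "(\<integral>w. partial_y UNIV f w * ?e w + f w * (\<i> * of_real (snd z) * ?e w) \<partial>lborel) = 0"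
    proof (rule integral_partial_y_zero[where G = "\<lambda>w. f w * ?e w" and C = C'])
      show "((\<lambda>t. f (x, t) * ?e (x, t)) has_vector_derivative
        (partial_y UNIV f (x, y) * ?e (x, y) + f (x, y) * (\<i> * of_real (snd z) * ?e (x, y)))) (at y)" for x y
        using has_vector_derivative_mult[OF partial_y_has_vector_derivative[OF assms(1), of x y] dercis[of "snd z" "x * fst z" y]]
        by (simp add: add.commute)
    qed (use G bound[of "partial_y UNIV f", OF by' C'(3)] cont in \<open>auto intro!: continuous_intros\<close>)
    moreover have "integrable lborel (\<lambda>w. partial_y UNIV f w * ?e w)" "integrable lborel (\<lambda>w. f w * ?e w)"
      using integrable_wt_bound[OF meas(3) by'] if' by (auto intro!: integrable_cis)
    ultimately show "EI (partial_y UNIV f) z = - (\<i> * of_real (snd z)) * EI f z"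
      by (simp add: EI_def mult.left_commute[of "f _"] eq_neg_iff_add_eq_0) }
qed

lemma schwartz_decay_wt:
  assumes "f \<in> schwartz"
  shows "norm (deriv_multi \<alpha> f z) \<le> \<bar>schwartz_norm \<alpha> f\<bar> * wt z"
proof -
  have "norm (deriv_multi \<alpha> f z) \<le> \<bar>schwartz_norm \<alpha> f\<bar> * (wt z)\<^sup>2"
    using schwartz_decay[OF assms, of \<alpha> z] by (rule order_trans) (intro mult_right_mono, auto)
  also have "\<dots> \<le> \<bar>schwartz_norm \<alpha> f\<bar> * wt z"
    using wt2_le_wt by (intro mult_left_mono) auto
  finally show ?thesis .
qed

lemma EI_deriv_multi:
  assumes f: "f \<in> schwartz"
  shows "EI (deriv_multi (a, b) f) z = (- (\<i> * of_real (fst z))) ^ a * (- (\<i> * of_real (snd z))) ^ b * EI f z"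
proof -
  define C where "C \<alpha> = \<bar>schwartz_norm \<alpha> f\<bar>" for \<alpha>
  \<comment> \<open>\<open>EI_partial\<close> asks for one constant that bounds a function and its
    derivative; hence the maximum over two multi-indices.\<close>
  have bd: "norm (deriv_multi \<alpha> f w) \<le> max (C \<alpha>) (C \<beta>) * wt w" "norm (deriv_multi \<alpha> f w) \<le> max (C \<beta>) (C \<alpha>) * wt w" for \<alpha> \<beta> w
  proof -
    have "norm (deriv_multi \<alpha> f w) \<le> C \<alpha> * wt w" unfolding C_def by (rule schwartz_decay_wt[OF f])
    also have "\<dots> \<le> max (C \<alpha>) (C \<beta>) * wt w" using wt_pos[of w] by (intro mult_right_mono) auto
    finally show "norm (deriv_multi \<alpha> f w) \<le> max (C \<alpha>) (C \<beta>) * wt w" "norm (deriv_multi \<alpha> f w) \<le> max (C \<beta>) (C \<alpha>) * wt w"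
      by (simp_all add: max.commute)
  qed
  have sm: "smooth_on UNIV (deriv_multi \<alpha> f)" for \<alpha> using f by (intro smooth_on_deriv_multi schwartz_smooth)
  have "EI (deriv_multi (0, b) f) z = (- (\<i> * of_real (snd z))) ^ b * EI f z"
  proof (induction b)
    case (Suc b)
    have "EI (partial_y UNIV (deriv_multi (0, b) f)) z = - (\<i> * of_real (snd z)) * EI (deriv_multi (0, b) f) z"
      by (rule EI_partial(2)[OF sm, where C = "max (C (0, b)) (C (0, Suc b))"])
        (use bd[of "(0, b)" _ "(0, Suc b)"] bd[of "(0, Suc b)" _ "(0, b)"] in simp_all)
    then show ?case using Suc by (simp add: mult_ac)
  qed simp
  moreover have "EI (deriv_multi (a, b) f) z = (- (\<i> * of_real (fst z))) ^ a * EI (deriv_multi (0, b) f) z"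
  proof (induction a)
    case (Suc a)
    have "EI (partial_x UNIV (deriv_multi (a, b) f)) z = - (\<i> * of_real (fst z)) * EI (deriv_multi (a, b) f) z"
      by (rule EI_partial(1)[OF sm, where C = "max (C (a, b)) (C (Suc a, b))"])
        (use bd[of "(a, b)" _ "(Suc a, b)"] bd[of "(Suc a, b)" _ "(a, b)"] in simp_all)
    then show ?case using Suc by (simp add: mult_ac)
  qed simp
  ultimately show ?thesis by (simp add: mult.assoc)
qed

text \<open>Integrable derivatives of \<open>f\<close> turn into powers of the frequency variable,
  hence into decay; the four multi-indices are those of \<open>norm_le_wt2I\<close>.\<close>

lemma EI_schwartz_decay:
  assumes f: "f \<in> schwartz"
  obtains C where "\<And>z. norm (EI f z) \<le> C * (wt z)\<^sup>2"
proof
  fix z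
  define I where "I \<alpha> = (\<integral>w. norm (deriv_multi \<alpha> f w) \<partial>lborel)" for \<alpha>
  have le: "\<bar>fst z\<bar> ^ a * \<bar>snd z\<bar> ^ b * norm (EI f z) \<le> I (a, b)" for a b
    using norm_EI_le[of "deriv_multi (a, b) f" z] by (simp add: I_def EI_deriv_multi[OF f] norm_mult norm_power)
  show "norm (EI f z) \<le> 4 * (I (0, 0) + I (4, 0) + I (0, 4) + I (4, 4)) * (wt z)\<^sup>2"
    by (rule norm_le_wt2I)
      (use le[of 0 0] le[of 4 0] le[of 0 4] le[of 4 4] in \<open>simp_all del: deriv_multi_simps\<close>)
qed

lemma has_derivative_EI:
  fixes f :: "real \<times> real \<Rightarrow> complex"
  assumes meas: "f \<in> borel_measurable borel" and bd: "\<And>z. norm (f z) \<le> C * (wt z)\<^sup>2"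
  shows "(EI f has_derivative grad_map (EI (\<lambda>w. \<i> * of_real (fst w) * f w) z) (EI (\<lambda>w. \<i> * of_real (snd w) * f w) z)) (at z)"
  unfolding EI_def[abs_def]
  by (rule has_derivative_cis_integral) (use integrable_wt2_bound[OF assms] in \<open>simp_all\<close>)

lemma has_derivative_fourier:
  fixes f :: "real \<times> real \<Rightarrow> complex"
  assumes meas: "f \<in> borel_measurable borel" and bd: "\<And>z. norm (f z) \<le> C * (wt z)\<^sup>2"
  shows "(fourier f has_derivative grad_map (fourier (\<lambda>w. - (\<i> * of_real (fst w)) * f w) z) (fourier (\<lambda>w. - (\<i> * of_real (snd w)) * f w) z)) (at z)"
proof -
  have "((\<lambda>z. of_real (1 / (4 * pi\<^sup>2)) * EI f (- z)) has_derivative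
    (\<lambda>d. of_real (1 / (4 * pi\<^sup>2)) * grad_map (EI (\<lambda>w. \<i> * of_real (fst w) * f w) (- z)) (EI (\<lambda>w. \<i> * of_real (snd w) * f w) (- z)) (- d))) (at z)"
    by (intro has_derivative_mult_right has_derivative_compose[of uminus uminus, OF _ has_derivative_EI[OF assms], unfolded o_def] has_derivative_minus has_derivative_ident)
  also have "(\<lambda>d. of_real (1 / (4 * pi\<^sup>2)) * grad_map (EI (\<lambda>w. \<i> * of_real (fst w) * f w) (- z)) (EI (\<lambda>w. \<i> * of_real (snd w) * f w) (- z)) (- d))
    = grad_map (fourier (\<lambda>w. - (\<i> * of_real (fst w)) * f w) z) (fourier (\<lambda>w. - (\<i> * of_real (snd w)) * f w) z)"
    by (simp add: fun_eq_iff grad_map_def fourier_eq_EI EI_def scaleR_conv_of_real algebra_simps)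
  also have "(\<lambda>z. of_real (1 / (4 * pi\<^sup>2)) * EI f (- z)) = fourier f" by (simp add: fun_eq_iff fourier_eq_EI)
  finally show ?thesis .
qed

lemma continuous_on_fourier:
  fixes f :: "real \<times> real \<Rightarrow> complex"
  assumes meas: "f \<in> borel_measurable borel" and bd: "\<And>z. norm (f z) \<le> C * (wt z)\<^sup>2"
  shows "continuous_on UNIV (fourier f)"
  by (intro continuous_at_imp_continuous_on ballI has_derivative_continuous[OF has_derivative_fourier[OF assms]])

lemma wt_uminus: "wt (- z) = wt z"
  by (simp add: wt_def)

lemma fourier_schwartz_decay:
  assumes f: "f \<in> schwartz"
  obtains C where "\<And>z. norm (fourier f z) \<le> C * (wt z)\<^sup>2"
proof -
  obtain C where C: "\<And>z. norm (EI f z) \<le> C * (wt z)\<^sup>2" using EI_schwartz_decay[OF f] by blast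
  have "norm (fourier f z) \<le> (1 / (4 * pi\<^sup>2) * C) * (wt z)\<^sup>2" for z
    using mult_left_mono[OF C[of "- z"], of "1 / (4 * pi\<^sup>2)"] by (simp add: fourier_eq_EI norm_divide norm_mult wt_uminus norm_power)
  then show ?thesis using that by blast
qed

lemma schwartz_measurable: "f \<in> schwartz \<Longrightarrow> f \<in> borel_measurable borel"
  by (intro smooth_on_measurable schwartz_smooth)

lemma fourier_schwartz_measurable: "f \<in> schwartz \<Longrightarrow> fourier f \<in> borel_measurable borel"
  using schwartz_decay[of f "(0, 0)"] continuous_on_fourier[OF schwartz_measurable] borel_measurable_continuous_onI
  by (metis deriv_multi_simps(1))

lemma schwartz_inversion:
  assumes f: "f \<in> schwartz"
  shows "EI (fourier f) z = f z"
proof (rule fourier_inversion)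
  obtain C where "\<And>z. norm (fourier f z) \<le> C * (wt z)\<^sup>2" using fourier_schwartz_decay[OF f] by blast
  then show "integrable lborel (fourier f)" using integrable_wt2_bound(1) fourier_schwartz_measurable[OF f] by blast
  show "integrable lborel f" using schwartz_integrable[OF f, of "(0, 0)"] by simp
  show "norm (f w) \<le> sup_norm UNIV f" for w
    using schwartz_weighted_le[OF f, of "(0,0)" "(0,0)" w] by (simp add: weighted_deriv_def)
  show "continuous_on UNIV f" using f by (intro smooth_on_continuous_on schwartz_smooth)
qed

text \<open>Differentiates the inversion formula. It shows that a factor \<open>x\<close> in a
  tempered function becomes an \<open>x\<close>-derivative of the test function on the Fourier side,
  which is the source of the order one.\<close>

lemma schwartz_inversion_partial_x:
  assumes f: "f \<in> schwartz"
  shows "EI (\<lambda>w. \<i> * of_real (fst w) * fourier f w) z = partial_x UNIV f z"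
proof -
  obtain C where C: "\<And>z. norm (fourier f z) \<le> C * (wt z)\<^sup>2" using fourier_schwartz_decay[OF f] by blast
  have "EI (fourier f) = f" using schwartz_inversion[OF f] by auto
  with partial_x_eq[OF open_UNIV UNIV_I has_derivative_EI[OF fourier_schwartz_measurable[OF f] C], of z]
  show ?thesis by simp
qed

lemma deriv_multi_lincomb:
  assumes "smooth_on UNIV f" "smooth_on UNIV g"
  shows "deriv_multi \<alpha> (\<lambda>z. a * f z + b * g z) = (\<lambda>z. a * deriv_multi \<alpha> f z + b * deriv_multi \<alpha> g z)"
proof -
  have x: "partial_x UNIV (\<lambda>z. a * f z + b * g z) = (\<lambda>z. a * partial_x UNIV f z + b * partial_x UNIV g z)"
    and y: "partial_y UNIV (\<lambda>z. a * f z + b * g z) = (\<lambda>z. a * partial_y UNIV f z + b * partial_y UNIV g z)"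
    if "smooth_on UNIV f" "smooth_on UNIV g" for f g :: "real \<times> real \<Rightarrow> complex"
  proof -
    have "((\<lambda>z. a * f z + b * g z) has_derivative (\<lambda>d. a * grad_map (partial_x UNIV f z) (partial_y UNIV f z) d + b * grad_map (partial_x UNIV g z) (partial_y UNIV g z) d)) (at z)" for z
      by (intro has_derivative_add has_derivative_mult_right smooth_on_has_derivative that) auto
    from partial_x_eq[OF open_UNIV UNIV_I this] partial_y_eq[OF open_UNIV UNIV_I this]
    show "partial_x UNIV (\<lambda>z. a * f z + b * g z) = (\<lambda>z. a * partial_x UNIV f z + b * partial_x UNIV g z)"
      "partial_y UNIV (\<lambda>z. a * f z + b * g z) = (\<lambda>z. a * partial_y UNIV f z + b * partial_y UNIV g z)"
      by auto
  qed
  obtain m n where \<alpha>: "\<alpha> = (m, n)" by (cases \<alpha>)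
  have "deriv_multi (0, n) (\<lambda>z. a * f z + b * g z) = (\<lambda>z. a * deriv_multi (0, n) f z + b * deriv_multi (0, n) g z)"
    by (induction n) (auto simp: y smooth_on_deriv_multi assms)
  then have "deriv_multi (m, n) (\<lambda>z. a * f z + b * g z) = (\<lambda>z. a * deriv_multi (m, n) f z + b * deriv_multi (m, n) g z)"
    by (induction m) (auto simp: x smooth_on_deriv_multi assms)
  then show ?thesis by (simp add: \<alpha>)
qed

lemma schwartz_lincomb:
  assumes "f \<in> schwartz" "g \<in> schwartz"
  shows "(\<lambda>z. a * f z + b * g z) \<in> schwartz"
  unfolding schwartz_def
proof (intro CollectI conjI allI)
  show "smooth_on UNIV (\<lambda>z. a * f z + b * g z)"
    using assms by (intro smooth_on_add smooth_on_mult smooth_on_const schwartz_smooth) auto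
  fix \<beta> \<alpha>
  have "norm (weighted_deriv \<beta> \<alpha> (\<lambda>z. a * f z + b * g z) z) \<le> norm a * sup_norm UNIV (weighted_deriv \<beta> \<alpha> f) + norm b * sup_norm UNIV (weighted_deriv \<beta> \<alpha> g)" for z
  proof -
    have "weighted_deriv \<beta> \<alpha> (\<lambda>z. a * f z + b * g z) z = a * weighted_deriv \<beta> \<alpha> f z + b * weighted_deriv \<beta> \<alpha> g z"
      using assms by (simp add: weighted_deriv_def deriv_multi_lincomb schwartz_smooth algebra_simps)
    also have "norm \<dots> \<le> norm a * sup_norm UNIV (weighted_deriv \<beta> \<alpha> f) + norm b * sup_norm UNIV (weighted_deriv \<beta> \<alpha> g)"
      using schwartz_weighted_le assms by (intro norm_triangle_le) (simp add: norm_mult add_mono mult_left_mono)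
    finally show ?thesis .
  qed
  then show "bounded (range (weighted_deriv \<beta> \<alpha> (\<lambda>z. a * f z + b * g z)))"
    unfolding bounded_iff by blast
qed

lemma schwartz_diff: "f \<in> schwartz \<Longrightarrow> g \<in> schwartz \<Longrightarrow> (\<lambda>z. f z - g z) \<in> schwartz"
  using schwartz_lincomb[of f g 1 "-1"] by simp

lemma fourier_lincomb:
  assumes "f \<in> schwartz" "g \<in> schwartz"
  shows "fourier (\<lambda>z. a * f z + b * g z) = (\<lambda>z. a * fourier f z + b * fourier g z)"
proof
  fix z
  have "integrable lborel (\<lambda>w. f w * cis (fst w * fst (- z) + snd w * snd (- z)))" "integrable lborel (\<lambda>w. g w * cis (fst w * fst (- z) + snd w * snd (- z)))"
    using schwartz_integrable[of f "(0, 0)"] schwartz_integrable[of g "(0, 0)"] assms by (auto intro!: integrable_cis)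
  then show "fourier (\<lambda>z. a * f z + b * g z) z = a * fourier f z + b * fourier g z"
    by (simp add: fourier_eq_EI EI_def distrib_right mult.assoc add_divide_distrib)
qed

subsection \<open>Test functions and a smooth bump\<close>

lemma compact_square: "compact (square R)"
  unfolding square_def by (intro compact_Times compact_Icc)

lemma closed_square: "closed (square R)"
  by (intro compact_imp_closed compact_square)

lemma partials_zero:
  fixes f :: "real \<times> real \<Rightarrow> complex"
  assumes "open U" "z \<in> U" "\<And>w. w \<in> U \<Longrightarrow> f w = 0"
  shows "partial_x UNIV f z = 0" "partial_y UNIV f z = 0"
proof -
  have "(f has_derivative (\<lambda>_. 0)) (at z)"
    by (rule has_derivative_transform_within_open[OF has_derivative_const[of 0] assms(1,2)]) (use assms(3) in simp)
  from partial_x_eq[OF open_UNIV UNIV_I this] partial_y_eq[OF open_UNIV UNIV_I this]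
  show "partial_x UNIV f z = 0" "partial_y UNIV f z = 0" by simp_all
qed

text \<open>Support is encoded as vanishing off some square; this passes to partial derivatives at
  once because the complement of a square is open.\<close>

definition test_fun :: "(real \<times> real \<Rightarrow> complex) \<Rightarrow> bool" where
  "test_fun f \<longleftrightarrow> smooth_on UNIV f \<and> (\<exists>R. \<forall>z. z \<notin> square R \<longrightarrow> f z = 0)"

lemma test_fun_smooth: "test_fun f \<Longrightarrow> smooth_on UNIV f"
  by (simp add: test_fun_def)

lemma test_fun_partial_x: "test_fun f \<Longrightarrow> test_fun (partial_x UNIV f)"
  and test_fun_partial_y: "test_fun f \<Longrightarrow> test_fun (partial_y UNIV f)"
proof -
  have "(\<forall>z. z \<notin> square R \<longrightarrow> partial_x UNIV f z = 0) \<and> (\<forall>z. z \<notin> square R \<longrightarrow> partial_y UNIV f z = 0)"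
    if "\<forall>z. z \<notin> square R \<longrightarrow> f z = 0" for R
    using partials_zero[of "- square R" _ f] that closed_square[of R] by (auto simp: open_Compl)
  then show "test_fun f \<Longrightarrow> test_fun (partial_x UNIV f)" "test_fun f \<Longrightarrow> test_fun (partial_y UNIV f)"
    unfolding test_fun_def using smooth_on_partials[of UNIV f] by blast+
qed

lemma test_fun_mult: "smooth_on UNIV a \<Longrightarrow> test_fun f \<Longrightarrow> test_fun (\<lambda>z. a z * f z)"
  unfolding test_fun_def by (auto intro: smooth_on_mult)

lemma test_fun_deriv_multi: "test_fun f \<Longrightarrow> test_fun (deriv_multi \<alpha> f)"
  by (rule deriv_multi_induct) (auto intro: test_fun_partial_x test_fun_partial_y)

lemma test_fun_bounded: "test_fun f \<Longrightarrow> bounded (range f)"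
proof -
  assume f: "test_fun f"
  then obtain R where R: "\<And>z. z \<notin> square R \<Longrightarrow> f z = 0" unfolding test_fun_def by blast
  have "compact (f ` square R)"
    using smooth_on_continuous_on[OF test_fun_smooth[OF f]] compact_square
    by (intro compact_continuous_image) (auto intro: continuous_on_subset)
  then have "bounded (insert 0 (f ` square R))" by (simp add: compact_imp_bounded)
  moreover have "range f \<subseteq> insert 0 (f ` square R)" using R by auto
  ultimately show ?thesis by (rule bounded_subset)
qed

lemma smooth_on_power: 
  fixes f :: "real \<times> real \<Rightarrow> real"
  assumes "smooth_on UNIV f"
  shows "smooth_on UNIV (\<lambda>z. f z ^ n)"
  by (induction n) (auto intro: smooth_on_mult assms)

lemma smooth_on_monom: "smooth_on UNIV (\<lambda>z. complex_of_real (fst z ^ a * snd z ^ b))"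
  by (intro smooth_on_of_real smooth_on_mult smooth_on_power smooth_on_fst smooth_on_snd open_UNIV)

lemma test_fun_schwartz: "test_fun f \<Longrightarrow> f \<in> schwartz"
  unfolding schwartz_def weighted_deriv_def
  by (auto intro!: test_fun_smooth test_fun_bounded test_fun_mult test_fun_deriv_multi smooth_on_monom simp del: of_real_mult of_real_power)

lemma smooth_on_ident: "smooth_on UNIV (\<lambda>z. c * complex_of_real (fst z))" "smooth_on UNIV (\<lambda>z. c * complex_of_real (snd z))"
  by (intro smooth_on_mult smooth_on_of_real smooth_on_fst smooth_on_snd smooth_on_const open_UNIV)+

lemma test_fun_wt2:
  assumes "test_fun f"
  shows "norm (f z) \<le> schwartz_norm (0, 0) f * (wt z)\<^sup>2"
  using schwartz_decay[OF test_fun_schwartz[OF assms], of "(0, 0)"] by simp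

text \<open>Transforms of test functions form a family closed under partial derivatives, whence
  smoothness. Decay holds because a monomial times such a transform is, up to a unimodular constant,
  the transform of a derivative of the test function.\<close>

lemma EI_test_fun_schwartz:
  assumes "test_fun f"
  shows "EI f \<in> schwartz"
proof -
  let ?P = "\<lambda>g. \<exists>f. test_fun f \<and> g = EI f"
  have step: "test_fun (\<lambda>w. \<i> * of_real (fst w) * f w)" "test_fun (\<lambda>w. \<i> * of_real (snd w) * f w)"
    "(EI f has_derivative grad_map (EI (\<lambda>w. \<i> * of_real (fst w) * f w) z) (EI (\<lambda>w. \<i> * of_real (snd w) * f w) z)) (at z)"
    if f: "test_fun f" for f z
    using f by (auto intro!: test_fun_mult smooth_on_ident has_derivative_EI[OF _ test_fun_wt2] smooth_on_measurable test_fun_smooth)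
  have sm: "smooth_on UNIV (EI f)"
  proof (rule smooth_on_coinduct[where P = ?P])
    fix g assume "?P g"
    then obtain f where f: "test_fun f" "g = EI f" by blast
    show "\<exists>fx fy. ?P fx \<and> ?P fy \<and> (\<forall>z\<in>UNIV. (g has_derivative grad_map (fx z) (fy z)) (at z))"
      unfolding f(2) using step[OF f(1)]
      by (intro exI[of _ "EI (\<lambda>w. \<i> * of_real (fst w) * f w)"] exI[of _ "EI (\<lambda>w. \<i> * of_real (snd w) * f w)"] conjI ballI
          exI[of _ "\<lambda>w. \<i> * of_real (fst w) * f w"] exI[of _ "\<lambda>w. \<i> * of_real (snd w) * f w"] refl)
  qed (use assms in auto)
  have px: "partial_x UNIV (EI f) = EI (\<lambda>w. \<i> * of_real (fst w) * f w)" "partial_y UNIV (EI f) = EI (\<lambda>w. \<i> * of_real (snd w) * f w)"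
    if "test_fun f" for f
    using partial_x_eq[OF open_UNIV UNIV_I step(3)[OF that]] partial_y_eq[OF open_UNIV UNIV_I step(3)[OF that]] by auto
  have P: "?P (deriv_multi \<alpha> (EI f))" for \<alpha>
  proof (rule deriv_multi_induct[where P = ?P])
    fix g assume "?P g"
    then obtain f where f: "test_fun f" "g = EI f" by blast
    show "?P (partial_x UNIV g)" "?P (partial_y UNIV g)"
      unfolding f(2) px[OF f(1)] using step(1,2)[OF f(1)] by blast+
  qed (use assms in auto)
  have "bounded (range (weighted_deriv \<beta> \<alpha> (EI f)))" for \<beta> \<alpha>
  proof -
    obtain p q where \<beta>: "\<beta> = (p, q)" by (cases \<beta>)
    obtain g where g: "test_fun g" "deriv_multi \<alpha> (EI f) = EI g" using P by blast
    have "norm (weighted_deriv \<beta> \<alpha> (EI f) z) \<le> (\<integral>w. norm (deriv_multi (p, q) g w) \<partial>lborel)" for z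
      using norm_EI_le[of "deriv_multi (p, q) g" z]
      by (simp add: \<beta> weighted_deriv_def g EI_deriv_multi[OF test_fun_schwartz[OF g(1)]] norm_mult norm_power)
    then show ?thesis unfolding bounded_iff by blast
  qed
  with sm show ?thesis by (simp add: schwartz_def)
qed

lemma lborel_integral_uminus:
  fixes f :: "real \<times> real \<Rightarrow> complex"
  assumes f: "f \<in> borel_measurable borel"
  shows "(\<integral>z. f z \<partial>lborel) = (\<integral>z. f (- z) \<partial>lborel)"
proof -
  have "(\<integral>z. f z \<partial>lborel) = (\<integral>z. f z \<partial>(density (distr lborel borel (\<lambda>x. 0 + (- 1) *\<^sub>R x)) (\<lambda>_. ennreal (\<bar>- 1\<bar> ^ DIM(real \<times> real)))))"
    by (subst lborel_affine[of "- 1" 0]) simp_all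
  also have "\<dots> = (\<integral>z. f z \<partial>(distr lborel borel (\<lambda>x. 0 + (- 1) *\<^sub>R x)))"
    using f by (subst integral_density) auto
  also have "\<dots> = (\<integral>z. f (- z) \<partial>lborel)"
    using f by (subst integral_distr) auto
  finally show ?thesis .
qed

text \<open>Reflecting the integration variable turns \<open>fourier (EI f)\<close> into
  \<open>EI (fourier f)\<close>. The identity allows a function to be built from a prescribed,
  compactly supported transform.\<close>

lemma fourier_EI:
  assumes "f \<in> schwartz"
  shows "fourier (EI f) = f"
proof
  fix z
  have [measurable]: "EI f \<in> borel_measurable borel"
    using continuous_at_imp_continuous_on[of UNIV "EI f"] has_derivative_continuous[OF has_derivative_EI[OF schwartz_measurable[OF assms]]]
      schwartz_decay[OF assms, of "(0, 0)"] by (auto intro: borel_measurable_continuous_onI)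
  have "fourier (EI f) z = of_real (1 / (4 * pi\<^sup>2)) * (\<integral>w. EI f w * cis (fst w * fst (- z) + snd w * snd (- z)) \<partial>lborel)"
    by (simp only: fourier_eq_EI EI_def[of "EI f"])
  also have "\<dots> = of_real (1 / (4 * pi\<^sup>2)) * (\<integral>w. EI f (- w) * cis (fst w * fst z + snd w * snd z) \<partial>lborel)"
    by (subst lborel_integral_uminus) (simp_all add: fst_uminus snd_uminus)
  also have "\<dots> = EI (fourier f) z"
    by (simp add: EI_def[of "fourier f"] fourier_eq_EI mult.assoc flip: integral_mult_right_zero)
  also have "\<dots> = f z" by (rule schwartz_inversion[OF assms])
  finally show "fourier (EI f) z = f z" .
qed

lemma smooth_on_scale:
  assumes "smooth_on UNIV f"
  shows "smooth_on UNIV (\<lambda>z. f (c *\<^sub>R z) :: complex)"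
    and "partial_x UNIV (\<lambda>z. f (c *\<^sub>R z)) = (\<lambda>z. of_real c * partial_x UNIV f (c *\<^sub>R z))"
    and "partial_y UNIV (\<lambda>z. f (c *\<^sub>R z)) = (\<lambda>z. of_real c * partial_y UNIV f (c *\<^sub>R z))"
proof -
  have der: "((\<lambda>z. f (c *\<^sub>R z)) has_derivative grad_map (of_real c * partial_x UNIV f (c *\<^sub>R z)) (of_real c * partial_y UNIV f (c *\<^sub>R z))) (at z)"
    if "smooth_on UNIV f" for f :: "real \<times> real \<Rightarrow> complex" and z
  proof -
    have "((\<lambda>z. f (c *\<^sub>R z)) has_derivative (\<lambda>d. grad_map (partial_x UNIV f (c *\<^sub>R z)) (partial_y UNIV f (c *\<^sub>R z)) (c *\<^sub>R d))) (at z)"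
      by (rule has_derivative_compose[of "\<lambda>z. c *\<^sub>R z" "\<lambda>d. c *\<^sub>R d", OF _ smooth_on_has_derivative[OF open_UNIV UNIV_I that]])
        (auto intro!: derivative_eq_intros)
    then show ?thesis by (simp add: grad_map_def scaleR_conv_of_real algebra_simps)
  qed
  show "partial_x UNIV (\<lambda>z. f (c *\<^sub>R z)) = (\<lambda>z. of_real c * partial_x UNIV f (c *\<^sub>R z))"
    "partial_y UNIV (\<lambda>z. f (c *\<^sub>R z)) = (\<lambda>z. of_real c * partial_y UNIV f (c *\<^sub>R z))"
    using partial_x_eq[OF open_UNIV UNIV_I der[OF assms]] partial_y_eq[OF open_UNIV UNIV_I der[OF assms]] by auto
  show "smooth_on UNIV (\<lambda>z. f (c *\<^sub>R z))"
  \<comment> \<open>The scalar \<open>a\<close> belongs to the family because each differentiation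
    produces a factor \<open>c\<close>.\<close>
  proof (rule smooth_on_coinduct[where P = "\<lambda>g. \<exists>a f. smooth_on UNIV f \<and> g = (\<lambda>z. a * f (c *\<^sub>R z))"])
    show "\<exists>a f'. smooth_on UNIV f' \<and> (\<lambda>z. f (c *\<^sub>R z)) = (\<lambda>z. a * f' (c *\<^sub>R z))"
      by (intro exI[of _ 1] exI[of _ f]) (simp add: assms)
    fix g :: "real \<times> real \<Rightarrow> complex" assume "\<exists>a f. smooth_on UNIV f \<and> g = (\<lambda>z. a * f (c *\<^sub>R z))"
    then obtain a f where f: "smooth_on UNIV f" "g = (\<lambda>z. a * f (c *\<^sub>R z))" by blast
    have "(g has_derivative grad_map ((a * of_real c) * partial_x UNIV f (c *\<^sub>R z)) ((a * of_real c) * partial_y UNIV f (c *\<^sub>R z))) (at z)" for z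
      using has_derivative_mult_right[OF der[OF f(1)], of a z] unfolding f(2)
      by (simp add: grad_map_def algebra_simps)
    then show "\<exists>fx fy. (\<exists>a f. smooth_on UNIV f \<and> fx = (\<lambda>z. a * f (c *\<^sub>R z))) \<and>
        (\<exists>a f. smooth_on UNIV f \<and> fy = (\<lambda>z. a * f (c *\<^sub>R z))) \<and> (\<forall>z\<in>UNIV. (g has_derivative grad_map (fx z) (fy z)) (at z))"
      using smooth_on_partials[OF f(1)]
      by (intro exI[of _ "\<lambda>z. (a * of_real c) * partial_x UNIV f (c *\<^sub>R z)"] exI[of _ "\<lambda>z. (a * of_real c) * partial_y UNIV f (c *\<^sub>R z)"]
        conjI exI[of _ "a * of_real c"] exI[of _ "partial_x UNIV f"] exI[of _ "partial_y UNIV f"] refl ballI)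
  qed simp
qed

section \<open>A smooth bump supported in the unit disc\<close>

lemma power_div_fact_le_exp: "0 \<le> x \<Longrightarrow> x ^ n / fact n \<le> exp (x::real)"
proof -
  assume x: "0 \<le> x"
  have "(\<Sum>i\<in>{n}. x ^ i /\<^sub>R fact i) \<le> (\<Sum>i. x ^ i /\<^sub>R fact i)"
    by (rule sum_le_suminf[OF summable_exp_generic]) (use x in auto)
  then show ?thesis by (simp add: exp_def divide_inverse mult.commute)
qed

text \<open>The power of \<open>1 / t\<close> makes the family closed, up to linear combinations,
  under differentiation.\<close>

definition flat_exp :: "nat \<Rightarrow> real \<Rightarrow> real" where
  "flat_exp n t = (if t > 0 then (1 / t) ^ n * exp (- (1 / t)) else 0)"

text \<open>The term of degree \<open>n + 2\<close> in the exponential series beats the pole of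
  order \<open>n\<close> with two powers to spare, so every member of the family vanishes
  quadratically at \<open>0\<close>; this yields the derivative there.\<close>

lemma flat_exp_le: "\<bar>flat_exp n t\<bar> \<le> fact (n + 2) * t\<^sup>2"
proof (cases "t > 0")
  case True
  have "(1 / t) ^ (n + 2) / fact (n + 2) \<le> exp (1 / t)"
    using True by (intro power_div_fact_le_exp) auto
  then have "(1 / t) ^ (n + 2) \<le> fact (n + 2) * exp (1 / t)"
    by (simp only: pos_divide_le_eq[OF fact_gt_zero] mult.commute)
  then have "(1 / t) ^ (n + 2) * exp (- (1 / t)) * t\<^sup>2 \<le> fact (n + 2) * exp (1 / t) * exp (- (1 / t)) * t\<^sup>2"
    by (intro mult_right_mono) auto
  also have "\<dots> = fact (n + 2) * t\<^sup>2" by (simp add: mult.assoc exp_minus_inverse)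
  also have "(1 / t) ^ (n + 2) * exp (- (1 / t)) * t\<^sup>2 = flat_exp n t"
    using True by (simp add: flat_exp_def power_add power_divide power2_eq_square)
  finally show ?thesis using True by (simp add: flat_exp_def)
qed (simp add: flat_exp_def)

lemma flat_exp_has_derivative:
  "(flat_exp n has_real_derivative flat_exp (n + 2) t - real n * flat_exp (n + 1) t) (at t)"
proof -
  consider "t > 0" | "t < 0" | "t = 0" by linarith
  then show ?thesis
  proof cases
    case 1
    have "((\<lambda>t. (1 / t) ^ n * exp (- (1 / t))) has_real_derivative flat_exp (n + 2) t - real n * flat_exp (n + 1) t) (at t)"
    proof -
      define U where "U = 1 / t"
      have "((\<lambda>t. 1 / t) has_real_derivative - (U\<^sup>2)) (at t)"
        using 1 by (auto intro!: derivative_eq_intros simp: U_def power2_eq_square)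
      from DERIV_mult[OF DERIV_power[OF this, of n] DERIV_fun_exp[OF DERIV_minus[OF this]]]
      have "((\<lambda>t. (1 / t) ^ n * exp (- (1 / t))) has_real_derivative
        real n * (- (U\<^sup>2) * U ^ (n - Suc 0)) * exp (- U) + exp (- U) * U\<^sup>2 * U ^ n) (at t)"
        by (simp add: U_def)
      \<comment> \<open>For \<open>n = 0\<close> the truncated exponent \<open>n - Suc 0\<close> is
        harmless, its factor \<open>real n\<close> being zero.\<close>
      also have "real n * (- (U\<^sup>2) * U ^ (n - Suc 0)) * exp (- U) + exp (- U) * U\<^sup>2 * U ^ n = flat_exp (n + 2) t - real n * flat_exp (n + 1) t"
        unfolding flat_exp_def U_def[symmetric] using 1 by (cases n) (simp_all add: power2_eq_square algebra_simps)
      finally show ?thesis .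
    qed
    then show ?thesis
      by (rule has_field_derivative_transform_within_open[where S = "{0<..}"]) (use 1 in \<open>auto simp: flat_exp_def\<close>)
  next
    case 2
    have "((\<lambda>t. 0) has_real_derivative flat_exp (n + 2) t - real n * flat_exp (n + 1) t) (at t)"
      using 2 by (simp add: flat_exp_def)
    then show ?thesis
      by (rule has_field_derivative_transform_within_open[where S = "{..<0}"]) (use 2 in \<open>auto simp: flat_exp_def\<close>)
  next
    case 3
    have "(flat_exp n has_derivative (\<lambda>_. 0)) (at 0)"
      by (rule has_derivative_quadraticI[where K = "fact (n + 2)"])
        (use flat_exp_le[of n] in \<open>auto simp: flat_exp_def simp del: fact_Suc\<close>)
    then have "(flat_exp n has_derivative (*) 0) (at 0)" by (simp add: lambda_zero)
    then show ?thesis unfolding has_field_derivative_def using 3 by (simp add: flat_exp_def lambda_zero)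
  qed
qed

definition plane_bump :: "nat \<Rightarrow> real \<times> real \<Rightarrow> real" where
  "plane_bump n z = flat_exp n (1 - ((fst z)\<^sup>2 + (snd z)\<^sup>2))"

lemma smooth_on_plane_bump: "smooth_on UNIV (plane_bump n)"
proof -
  have "C_k_on k UNIV (plane_bump n)" for k
  proof (induction k arbitrary: n)
    case 0
    have "continuous_on UNIV (flat_exp n)"
      using flat_exp_has_derivative by (meson DERIV_isCont continuous_at_imp_continuous_on)
    then show ?case
      by (simp add: plane_bump_def[abs_def]) (rule continuous_on_compose2[of UNIV "flat_exp n"], auto intro!: continuous_intros)
  next
    case (Suc k)
    define D where "D z = plane_bump (n + 2) z + (- real n) * plane_bump (n + 1) z" for z
    have CD: "C_k_on k UNIV D"
      unfolding D_def[abs_def] by (intro C_k_on_add C_k_on_bilinear[OF _ bounded_bilinear_mult] C_k_on_const Suc open_UNIV)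
    have "C_k_on k UNIV (\<lambda>z. D z * (-2 * fst z))" "C_k_on k UNIV (\<lambda>z. D z * (-2 * snd z))"
      using smooth_on_fst[OF open_UNIV] smooth_on_snd[OF open_UNIV]
      by (intro C_k_on_bilinear[OF _ bounded_bilinear_mult] CD C_k_on_const open_UNIV; simp add: smooth_on_def)+
    moreover have "(plane_bump n has_derivative grad_map (D z * (-2 * fst z)) (D z * (-2 * snd z))) (at z)" for z
    proof -
      have "((\<lambda>z. 1 - ((fst z)\<^sup>2 + (snd z)\<^sup>2)) has_derivative (\<lambda>d. - (2 * fst z * fst d + 2 * snd z * snd d))) (at z)"
        by (auto intro!: derivative_eq_intros)
      from has_derivative_compose[OF this flat_exp_has_derivative[unfolded has_field_derivative_def]]
      show ?thesis
        by (simp add: plane_bump_def[abs_def] D_def grad_map_def algebra_simps)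
    qed
    ultimately show ?case by (intro C_k_on_SucI[where fx = "\<lambda>z. D z * (-2 * fst z)" and fy = "\<lambda>z. D z * (-2 * snd z)"] open_UNIV)
  qed
  then show ?thesis by (simp add: smooth_on_def)
qed

text \<open>The factor \<open>exp 1\<close> makes the value at the origin \<open>1\<close>, so that
  stretched copies of the bump converge pointwise to \<open>1\<close>.\<close>

definition bump :: "real \<times> real \<Rightarrow> complex" where
  "bump z = of_real (exp 1 * plane_bump 0 z)"

lemma smooth_on_bump: "smooth_on UNIV bump"
  unfolding bump_def[abs_def]
  by (intro smooth_on_of_real smooth_on_mult smooth_on_const smooth_on_plane_bump open_UNIV)

lemma bump_0: "bump 0 = 1"
  by (simp add: bump_def plane_bump_def flat_exp_def exp_minus_inverse)

lemma bump_nonneg: "0 \<le> exp 1 * plane_bump 0 z" "exp 1 * plane_bump 0 z \<le> 1"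
proof -
  show "0 \<le> exp 1 * plane_bump 0 z" by (simp add: plane_bump_def flat_exp_def)
  show "exp 1 * plane_bump 0 z \<le> 1"
  proof (cases "(fst z)\<^sup>2 + (snd z)\<^sup>2 < 1")
    case True
    let ?t = "1 - ((fst z)\<^sup>2 + (snd z)\<^sup>2)"
    have "1 \<le> 1 / ?t" using True by (simp add: pos_le_divide_eq add_nonneg_nonneg)
    then show ?thesis using True by (simp add: plane_bump_def flat_exp_def flip: exp_add)
  qed (simp add: plane_bump_def flat_exp_def)
qed

lemma norm_bump_le: "norm (bump z) \<le> 1"
  unfolding bump_def norm_of_real using bump_nonneg[of z] by simp

lemma bump_eq_0: "z \<notin> square 1 \<Longrightarrow> bump z = 0"
proof -
  assume "z \<notin> square 1"
  then have "1 < \<bar>fst z\<bar> \<or> 1 < \<bar>snd z\<bar>" by (cases z) (auto simp: square_def)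
  then have "1 \<le> (fst z)\<^sup>2 \<or> 1 \<le> (snd z)\<^sup>2" using abs_le_square_iff[of 1 "fst z"] abs_le_square_iff[of 1 "snd z"] by auto
  then have "\<not> (fst z)\<^sup>2 + (snd z)\<^sup>2 < 1" using zero_le_power2[of "fst z"] zero_le_power2[of "snd z"] by linarith
  then show ?thesis by (simp add: bump_def plane_bump_def flat_exp_def)
qed

lemma test_fun_bump: "test_fun bump"
  unfolding test_fun_def using smooth_on_bump bump_eq_0 by blast

lemma sup_norm_leI: "S \<noteq> {} \<Longrightarrow> (\<And>z. z \<in> S \<Longrightarrow> norm (f z) \<le> B) \<Longrightarrow> sup_norm S f \<le> B"
  unfolding sup_norm_def by (rule cSUP_least)

section \<open>Derivative bounds of order at most two\<close>

lemma partial_mult: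
  fixes f g :: "real \<times> real \<Rightarrow> complex"
  assumes "smooth_on UNIV f" "smooth_on UNIV g"
  shows "partial_x UNIV (\<lambda>z. f z * g z) z = f z * partial_x UNIV g z + partial_x UNIV f z * g z"
    and "partial_y UNIV (\<lambda>z. f z * g z) z = f z * partial_y UNIV g z + partial_y UNIV f z * g z"
proof -
  note D = has_derivative_mult[OF smooth_on_has_derivative[OF open_UNIV UNIV_I assms(1), of z] smooth_on_has_derivative[OF open_UNIV UNIV_I assms(2), of z]]
  show "partial_x UNIV (\<lambda>z. f z * g z) z = f z * partial_x UNIV g z + partial_x UNIV f z * g z"
    "partial_y UNIV (\<lambda>z. f z * g z) z = f z * partial_y UNIV g z + partial_y UNIV f z * g z"
    using partial_x_eq[OF open_UNIV UNIV_I D] partial_y_eq[OF open_UNIV UNIV_I D] by simp_all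
qed

lemma partial_add:
  fixes f g :: "real \<times> real \<Rightarrow> complex"
  assumes "smooth_on UNIV f" "smooth_on UNIV g"
  shows "partial_x UNIV (\<lambda>z. f z + g z) z = partial_x UNIV f z + partial_x UNIV g z"
    and "partial_y UNIV (\<lambda>z. f z + g z) z = partial_y UNIV f z + partial_y UNIV g z"
proof -
  note D = has_derivative_add[OF smooth_on_has_derivative[OF open_UNIV UNIV_I assms(1), of z] smooth_on_has_derivative[OF open_UNIV UNIV_I assms(2), of z]]
  show "partial_x UNIV (\<lambda>z. f z + g z) z = partial_x UNIV f z + partial_x UNIV g z"
    "partial_y UNIV (\<lambda>z. f z + g z) z = partial_y UNIV f z + partial_y UNIV g z"
    using partial_x_eq[OF open_UNIV UNIV_I D] partial_y_eq[OF open_UNIV UNIV_I D] by simp_all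
qed

lemma multi_index_le_2:
  assumes "fst \<alpha> + snd \<alpha> \<le> (2::nat)"
  shows "\<alpha> \<in> {(0, 0), (1, 0), (0, 1), (2, 0), (1, 1), (0, 2)}"
proof -
  obtain a b where \<alpha>: "\<alpha> = (a, b)" by (cases \<alpha>)
  have "a = 0 \<or> a = 1 \<or> a = 2" "b = 0 \<or> b = 1 \<or> b = 2" using assms \<alpha> by auto
  then show ?thesis using assms \<alpha> by auto
qed

text \<open>By the Leibniz rule a derivative of order at most two of a product has at most four
  terms, counted with multiplicity, each bounded by \<open>c\<close>.\<close>

lemma norm_deriv_multi_mult_le:
  assumes A: "smooth_on UNIV A" "\<And>\<alpha>. fst \<alpha> + snd \<alpha> \<le> 2 \<Longrightarrow> norm (deriv_multi \<alpha> A z) \<le> c"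
    and B: "smooth_on UNIV B" "\<And>\<alpha>. fst \<alpha> + snd \<alpha> \<le> 2 \<Longrightarrow> norm (deriv_multi \<alpha> B z) \<le> 1"
    and \<alpha>: "fst \<alpha> + snd \<alpha> \<le> 2"
  shows "norm (deriv_multi \<alpha> (\<lambda>z. A z * B z) z) \<le> 4 * c"
proof -
  have c: "0 \<le> c" using order_trans[OF norm_ge_zero A(2)[of "(0, 0)"]] by simp
  have p: "norm (deriv_multi \<beta> A z * deriv_multi \<gamma> B z) \<le> c" if "fst \<beta> + snd \<beta> \<le> 2" "fst \<gamma> + snd \<gamma> \<le> 2" for \<beta> \<gamma>
    using mult_mono[OF A(2)[OF that(1)] B(2)[OF that(2)]] c by (simp add: norm_mult)
  note Ax = smooth_on_partials(1)[OF A(1)] and Ay = smooth_on_partials(2)[OF A(1)] and Bx = smooth_on_partials(1)[OF B(1)] and By = smooth_on_partials(2)[OF B(1)]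
  note sm = A(1) B(1) Ax Ay Bx By smooth_on_mult[OF open_UNIV A(1) Bx] smooth_on_mult[OF open_UNIV Ax B(1)] smooth_on_mult[OF open_UNIV A(1) By] smooth_on_mult[OF open_UNIV Ay B(1)]
  have x: "partial_x UNIV (\<lambda>z. A z * B z) = (\<lambda>z. A z * partial_x UNIV B z + partial_x UNIV A z * B z)"
    and y: "partial_y UNIV (\<lambda>z. A z * B z) = (\<lambda>z. A z * partial_y UNIV B z + partial_y UNIV A z * B z)"
    using sm by (auto simp: partial_mult)
  have n4: "norm (a + b + (d + e)) \<le> 4 * c" if "norm a \<le> c" "norm b \<le> c" "norm d \<le> c" "norm e \<le> c" for a b d e :: complex
    using that norm_triangle_ineq[of "a + b" "d + e"] norm_triangle_ineq[of a b] norm_triangle_ineq[of d e] by linarith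
  have n2: "norm (a + b) \<le> 4 * c" if "norm a \<le> c" "norm b \<le> c" for a b :: complex
    using that norm_triangle_ineq[of a b] c by linarith
  have n1: "norm a \<le> 4 * c" if "norm a \<le> c" for a :: complex using that c by linarith
  from multi_index_le_2[OF \<alpha>] consider "\<alpha> = (0, 0)" | "\<alpha> = (1, 0)" | "\<alpha> = (0, 1)" | "\<alpha> = (2, 0)" | "\<alpha> = (1, 1)" | "\<alpha> = (0, 2)" by auto
  then show ?thesis
  proof cases
    case 1
    then show ?thesis using n1[OF p[of "(0,0)" "(0,0)"]] by simp
  next
    case 2
    then show ?thesis using n2[OF p[of "(0,0)" "(1,0)"] p[of "(1,0)" "(0,0)"]] by (simp add: x)
  next
    case 3
    then show ?thesis using n2[OF p[of "(0,0)" "(0,1)"] p[of "(0,1)" "(0,0)"]] by (simp add: y)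
  next
    case 4
    then show ?thesis using n4[OF p[of "(0,0)" "(2,0)"] p[of "(1,0)" "(1,0)"] p[of "(1,0)" "(1,0)"] p[of "(2,0)" "(0,0)"]]
      by (simp add: x numeral_2_eq_2 partial_add partial_mult sm)
  next
    case 5
    then show ?thesis using n4[OF p[of "(0,0)" "(1,1)"] p[of "(1,0)" "(0,1)"] p[of "(0,1)" "(1,0)"] p[of "(1,1)" "(0,0)"]]
      by (simp add: y partial_add partial_mult sm)
  next
    case 6
    then show ?thesis using n4[OF p[of "(0,0)" "(0,2)"] p[of "(0,1)" "(0,1)"] p[of "(0,1)" "(0,1)"] p[of "(0,2)" "(0,0)"]]
      by (simp add: y numeral_2_eq_2 partial_add partial_mult sm)
  qed
qed

lemma deriv_multi_scale:
  assumes "smooth_on UNIV f"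
  shows "deriv_multi \<alpha> (\<lambda>z. f (c *\<^sub>R z)) = (\<lambda>z. of_real c ^ (fst \<alpha> + snd \<alpha>) * deriv_multi \<alpha> f (c *\<^sub>R z))"
proof -
  have cm: "partial_x UNIV (\<lambda>z. a * f z) = (\<lambda>z. a * partial_x UNIV f z)" "partial_y UNIV (\<lambda>z. a * f z) = (\<lambda>z. a * partial_y UNIV f z)"
    if "smooth_on UNIV f" for f :: "real \<times> real \<Rightarrow> complex" and a
    using deriv_multi_lincomb[OF that that, of "(Suc 0, 0)" a 0] deriv_multi_lincomb[OF that that, of "(0, Suc 0)" a 0] by simp_all
  obtain m n where \<alpha>: "\<alpha> = (m, n)" by (cases \<alpha>)
  have sm: "smooth_on UNIV (deriv_multi \<beta> f)" for \<beta> using assms by (rule smooth_on_deriv_multi)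
  have "deriv_multi (0, n) (\<lambda>z. f (c *\<^sub>R z)) = (\<lambda>z. of_real c ^ n * deriv_multi (0, n) f (c *\<^sub>R z))"
    by (induction n) (simp_all add: smooth_on_scale[OF sm] cm[OF smooth_on_scale(1)[OF sm]] mult_ac)
  then have "deriv_multi (m, n) (\<lambda>z. f (c *\<^sub>R z)) = (\<lambda>z. of_real c ^ (m + n) * deriv_multi (m, n) f (c *\<^sub>R z))"
    by (induction m) (simp_all add: smooth_on_scale[OF sm] cm[OF smooth_on_scale(1)[OF sm]] mult_ac)
  then show ?thesis by (simp add: \<alpha>)
qed

lemma smooth_on_fourier: "test_fun f \<Longrightarrow> smooth_on UNIV (fourier f)"
proof -
  assume "test_fun f"
  then have "smooth_on UNIV (\<lambda>z. of_real (1 / (4 * pi\<^sup>2)) * EI f ((- 1) *\<^sub>R z))"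
    by (intro smooth_on_mult smooth_on_const smooth_on_scale schwartz_smooth EI_test_fun_schwartz open_UNIV)
  then show ?thesis by (simp add: fourier_eq_EI[abs_def])
qed

lemma partials_fourier:
  assumes "test_fun f"
  shows "partial_x UNIV (fourier f) = fourier (\<lambda>w. - \<i> * of_real (fst w) * f w)"
    and "partial_y UNIV (fourier f) = fourier (\<lambda>w. - \<i> * of_real (snd w) * f w)"
    and "test_fun (\<lambda>w. - \<i> * of_real (fst w) * f w)" "test_fun (\<lambda>w. - \<i> * of_real (snd w) * f w)"
proof -
  note D = has_derivative_fourier[OF smooth_on_measurable[OF test_fun_smooth[OF assms]] test_fun_wt2[OF assms]]
  show "partial_x UNIV (fourier f) = fourier (\<lambda>w. - \<i> * of_real (fst w) * f w)"
    "partial_y UNIV (fourier f) = fourier (\<lambda>w. - \<i> * of_real (snd w) * f w)"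
    using partial_x_eq[OF open_UNIV UNIV_I D] partial_y_eq[OF open_UNIV UNIV_I D] by auto
  show "test_fun (\<lambda>w. - \<i> * of_real (fst w) * f w)" "test_fun (\<lambda>w. - \<i> * of_real (snd w) * f w)"
    by (intro test_fun_mult smooth_on_ident assms)+
qed

lemma norm_fourier_le: "norm (fourier f z) \<le> 1 / (4 * pi\<^sup>2) * (\<integral>w. norm (f w) \<partial>lborel)"
  using mult_left_mono[OF norm_EI_le[of f "- z"], of "1 / (4 * pi\<^sup>2)"]
  by (simp add: fourier_eq_EI norm_divide norm_mult norm_power)

lemma emeasure_square: "0 \<le> R \<Longrightarrow> emeasure lborel (square R) = ennreal (4 * R\<^sup>2)"
  unfolding square_def lborel_prod[symmetric]
  by (subst lborel.emeasure_pair_measure_Times) (simp_all add: ennreal_mult[symmetric] power2_eq_square)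

lemma square_measurable [measurable]: "square R \<in> sets borel"
  by (intro borel_closed closed_square)

lemma integral_indicator_square: "0 \<le> R \<Longrightarrow> (\<integral>w. B * indicator (square R) w \<partial>lborel) = (4 * R\<^sup>2) * (B::real)"
  by (simp add: measure_def emeasure_square)

lemma integrable_indicator_square: "0 \<le> R \<Longrightarrow> integrable lborel (\<lambda>w. B * indicator (square R) w :: real)"
  by (intro integrable_mult_right integrable_real_indicator) (auto simp: emeasure_square)

lemma norm_integral_square_le:
  fixes f :: "real \<times> real \<Rightarrow> 'a::{banach, second_countable_topology}"
  assumes "0 \<le> R" "\<And>w. w \<in> square R \<Longrightarrow> norm (f w) \<le> B" "\<And>w. w \<notin> square R \<Longrightarrow> f w = 0"
  shows "norm (\<integral>w. f w \<partial>lborel) \<le> 4 * R\<^sup>2 * B"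
proof -
  have "norm (\<integral>w. f w \<partial>lborel) \<le> (\<integral>w. B * indicator (square R) w \<partial>lborel)"
    by (rule norm_integral_le[OF integrable_indicator_square[OF assms(1)]]) (use assms in \<open>auto simp: indicator_def\<close>)
  then show ?thesis unfolding integral_indicator_square[OF assms(1)] .
qed

text \<open>The constant is \<open>16 \<cdot> 4 / (4 \<cdot> 9)\<close>: the area of the square, the bound for a monomial of degree
  at most \<open>2\<close> on it, and \<open>\<pi>\<^sup>2 \<ge> 9\<close>.\<close>

lemma norm_deriv_fourier_le:
  assumes f: "test_fun f" "\<And>w. w \<notin> square 2 \<Longrightarrow> f w = 0" "\<And>w. norm (f w) \<le> C" and \<alpha>: "fst \<alpha> + snd \<alpha> \<le> 2"
  shows "norm (deriv_multi \<alpha> (fourier f) z) \<le> 16 / 9 * C"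
proof -
  have C: "0 \<le> C" using order_trans[OF norm_ge_zero f(3)] .
  have bd: "norm (fourier (\<lambda>w. g w * f w) z) \<le> 16 / 9 * C"
    if "\<And>w. w \<in> square 2 \<Longrightarrow> norm (g w) \<le> 4" for g
  proof -
    have "norm (\<integral>w. norm (g w * f w) \<partial>lborel) \<le> 4 * 2\<^sup>2 * (4 * C)"
    proof (rule norm_integral_square_le)
      fix w assume "w \<in> square 2"
      then show "norm (norm (g w * f w)) \<le> 4 * C"
        using mult_mono[OF that f(3)] by (simp add: norm_mult)
    qed (use f(2) in auto)
    then have "norm (fourier (\<lambda>w. g w * f w) z) \<le> 1 / (4 * pi\<^sup>2) * (64 * C)"
      by (intro order_trans[OF norm_fourier_le mult_left_mono]) auto
    also have "\<dots> \<le> 1 / (4 * 9) * (64 * C)"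
    proof -
      have "3 * 3 \<le> pi * pi" using pi_gt3 by (intro mult_mono) auto
      then show ?thesis using C by (intro mult_right_mono divide_left_mono) (auto simp: power2_eq_square)
    qed
    also have "\<dots> \<le> 16 / 9 * C" using C by simp
    finally show ?thesis .
  qed
  note p1 = partials_fourier[OF f(1)]
  note p2 = partials_fourier[OF p1(3)] partials_fourier[OF p1(4)]
  have sq: "\<bar>fst w\<bar> \<le> 2" "\<bar>snd w\<bar> \<le> 2" if "w \<in> square 2" for w
    using that by (auto simp: square_def)
  have m: "\<bar>fst w\<bar> * \<bar>fst w\<bar> \<le> 4" "\<bar>fst w\<bar> * \<bar>snd w\<bar> \<le> 4" "\<bar>snd w\<bar> * \<bar>snd w\<bar> \<le> 4" if "w \<in> square 2" for w
    using mult_mono[OF sq(1)[OF that] sq(1)[OF that]] mult_mono[OF sq(1)[OF that] sq(2)[OF that]] mult_mono[OF sq(2)[OF that] sq(2)[OF that]] by auto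
  from multi_index_le_2[OF \<alpha>] consider "\<alpha> = (0, 0)" | "\<alpha> = (1, 0)" | "\<alpha> = (0, 1)" | "\<alpha> = (2, 0)" | "\<alpha> = (1, 1)" | "\<alpha> = (0, 2)" by auto
  then show ?thesis
  proof cases
    case 1
    then show ?thesis using bd[of "\<lambda>_. 1"] by simp
  next
    case 2
    then show ?thesis using bd[of "\<lambda>w. - \<i> * of_real (fst w)"] sq(1) by (simp add: p1 norm_mult) force
  next
    case 3
    then show ?thesis using bd[of "\<lambda>w. - \<i> * of_real (snd w)"] sq(2) by (simp add: p1 norm_mult) force
  next
    case 4
    have "deriv_multi \<alpha> (fourier f) = fourier (\<lambda>w. ((- \<i> * of_real (fst w)) * (- \<i> * of_real (fst w))) * f w)"
      by (simp only: 4 deriv_multi_simps numeral_2_eq_2 One_nat_def p1 p2) (simp only: mult.assoc)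
    then show ?thesis using bd[of "\<lambda>w. (- \<i> * of_real (fst w)) * (- \<i> * of_real (fst w))"] m(1) by (simp add: norm_mult)
  next
    case 5
    have "deriv_multi \<alpha> (fourier f) = fourier (\<lambda>w. ((- \<i> * of_real (fst w)) * (- \<i> * of_real (snd w))) * f w)"
      by (simp only: 5 deriv_multi_simps numeral_2_eq_2 One_nat_def p1 p2) (simp only: mult.assoc)
    then show ?thesis using bd[of "\<lambda>w. (- \<i> * of_real (fst w)) * (- \<i> * of_real (snd w))"] m(2) by (simp add: norm_mult)
  next
    case 6
    have "deriv_multi \<alpha> (fourier f) = fourier (\<lambda>w. ((- \<i> * of_real (snd w)) * (- \<i> * of_real (snd w))) * f w)"
      by (simp only: 6 deriv_multi_simps numeral_2_eq_2 One_nat_def p1 p2) (simp only: mult.assoc)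
    then show ?thesis using bd[of "\<lambda>w. (- \<i> * of_real (snd w)) * (- \<i> * of_real (snd w))"] m(3) by (simp add: norm_mult)
  qed
qed

subsection \<open>Existence of bandlimited approximations\<close>

lemma smooth_on_polynomial_function:
  fixes p :: "real \<times> real \<Rightarrow> complex"
  assumes "polynomial_function p"
  shows "smooth_on UNIV p"
proof -
  have "smooth_on UNIV (\<lambda>z. Re (p z))" "smooth_on UNIV (\<lambda>z. Im (p z))"
    using assms bounded_linear_Re bounded_linear_Im smooth_on_real_polynomial_function[OF _ open_UNIV]
    unfolding polynomial_function_def o_def by blast+
  then have "smooth_on UNIV (\<lambda>z. of_real (Re (p z)) + \<i> * of_real (Im (p z)))"
    by (intro smooth_on_add smooth_on_mult smooth_on_const smooth_on_of_real open_UNIV)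
  then show ?thesis by (simp add: complex_eq[symmetric])
qed

lemma bump_pos: "norm z < 1 \<Longrightarrow> 0 < exp 1 * plane_bump 0 z"
proof -
  assume "norm z < 1"
  then have "(norm z)\<^sup>2 < 1" by (simp add: abs_square_less_1)
  then have "(fst z)\<^sup>2 + (snd z)\<^sup>2 < 1" by (cases z) (simp add: norm_Pair)
  then show ?thesis by (simp add: plane_bump_def flat_exp_def)
qed

lemma norm_le_of_square: "z \<in> square R \<Longrightarrow> norm z \<le> sqrt 2 * R"
proof -
  assume "z \<in> square R"
  then have "\<bar>fst z\<bar> \<le> R" "\<bar>snd z\<bar> \<le> R" by (auto simp: square_def)
  then have "(fst z)\<^sup>2 \<le> R\<^sup>2" "(snd z)\<^sup>2 \<le> R\<^sup>2" and R: "0 \<le> R"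
    by (auto simp: abs_le_square_iff[symmetric])
  then have "norm z \<le> sqrt (2 * R\<^sup>2)"
    by (cases z) (simp add: norm_Pair)
  then show ?thesis using R by (simp add: real_sqrt_mult)
qed

text \<open>Cutting off an approximation of \<open>h\<close> would change its values on
  \<open>K\<close>, so the extension of \<open>h\<close> is first divided by the cut-off and the
  quotient is approximated. Clamping the divisor from below at the minimum \<open>\<mu>\<close> of
  the cut-off over the unit square leaves the quotient unchanged on \<open>K\<close> and continuous
  everywhere; as \<open>cutr z / max (cutr z) \<mu>\<close> is at most \<open>1\<close>, the bound
  \<open>S\<close> survives multiplication by the cut-off.\<close>

lemma compactly_supported_approximation:
  fixes h :: "real \<times> real \<Rightarrow> complex"
  assumes K: "compact K" "K \<subseteq> square 1" and h: "continuous_on K h" "\<And>z. z \<in> K \<Longrightarrow> norm (h z) \<le> S" and S: "0 \<le> S" and \<delta>: "0 < \<delta>"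
  obtains H where "test_fun H" "\<And>z. z \<notin> square 2 \<Longrightarrow> H z = 0" "\<And>z. norm (H z) \<le> S + \<delta>"
    "\<And>z. z \<in> K \<Longrightarrow> norm (H z - h z) \<le> \<delta>"
proof -
  define cutr :: "real \<times> real \<Rightarrow> real" where "cutr z = exp 1 * plane_bump 0 ((1 / 2) *\<^sub>R z)" for z
  define cut where "cut z = bump ((1 / 2) *\<^sub>R z)" for z
  have cut_eq: "cut z = of_real (cutr z)" for z by (simp add: cut_def cutr_def bump_def)
  have cut01: "0 \<le> cutr z" "cutr z \<le> 1" for z unfolding cutr_def by (rule bump_nonneg)+
  have cut0: "cut z = 0" if "z \<notin> square 2" for z
    unfolding cut_def by (rule bump_eq_0) (use that in \<open>cases z, auto simp: square_def\<close>)
  have smcut: "smooth_on UNIV cut" unfolding cut_def[abs_def] by (rule smooth_on_scale[OF smooth_on_bump])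
  have contcut: "continuous_on UNIV cutr"
    using smooth_on_continuous_on[OF smcut] continuous_on_Re[of UNIV cut] by (simp add: cut_eq[abs_def])
  have "square 1 \<noteq> {}" by (auto simp: square_def)
  then obtain z0 where z0: "z0 \<in> square 1" "\<And>z. z \<in> square 1 \<Longrightarrow> cutr z0 \<le> cutr z"
    using continuous_attains_inf[OF compact_square _ continuous_on_subset[OF contcut]] by (metis top_greatest)
  define \<mu> where "\<mu> = cutr z0"
  have \<mu>: "0 < \<mu>"
  proof -
    \<comment> \<open>The cut-off is the bump stretched by two: it vanishes off
      \<open>square 2\<close> and is positive on \<open>square 1\<close>, which lies in the open
      disc of radius two.\<close>
    have "sqrt 2 < 2" by (rule real_less_lsqrt) auto
    then have "norm ((1 / 2) *\<^sub>R z0) < 1" using norm_le_of_square[OF z0(1)] by simp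
    then show ?thesis unfolding \<mu>_def cutr_def by (rule bump_pos)
  qed
  obtain Hc where Hc: "continuous_on UNIV Hc" "\<And>z. z \<in> K \<Longrightarrow> Hc z = h z" "\<And>z. norm (Hc z) \<le> S"
    using Tietze[OF h(1) _ S h(2), of UNIV] K(1) compact_imp_closed by auto
  define T where "T z = Hc z / of_real (max (cutr z) \<mu>)" for z
  have contT: "continuous_on UNIV T"
    unfolding T_def using \<mu> by (intro continuous_intros Hc(1) contcut) (auto simp: max_def)
  obtain P where P: "polynomial_function P" "\<And>z. z \<in> square 2 \<Longrightarrow> norm (T z - P z) < \<delta>"
    using Stone_Weierstrass_polynomial_function[OF compact_square continuous_on_subset[OF contT] \<delta>, of 2] by auto
  define H where "H z = P z * cut z" for z
  have Tcut: "norm (T z * cut z) \<le> S" for z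
  proof -
    have "norm (T z * cut z) = norm (Hc z) * (cutr z / max (cutr z) \<mu>)"
      using cut01[of z] \<mu> by (simp add: T_def cut_eq norm_mult norm_divide max_def)
    also have "\<dots> \<le> S * 1"
      using Hc(3)[of z] \<mu> cut01[of z] S by (intro mult_mono) (auto simp: max_def)
    finally show ?thesis by simp
  qed
  have HT: "norm (H z - T z * cut z) \<le> \<delta>" for z
  proof (cases "z \<in> square 2")
    case True
    have "norm (H z - T z * cut z) = norm (T z - P z) * cutr z"
      using cut01[of z] by (simp add: H_def cut_eq norm_mult norm_minus_commute flip: left_diff_distrib)
    also have "\<dots> \<le> \<delta> * 1" using P(2)[OF True] cut01[of z] \<delta> by (intro mult_mono) auto
    finally show ?thesis by simp
  qed (use cut0 \<delta> in \<open>simp add: H_def\<close>)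
  show ?thesis
  proof (rule that)
    show 0: "H z = 0" if "z \<notin> square 2" for z using cut0[OF that] by (simp add: H_def)
    show "test_fun H"
      unfolding test_fun_def using 0 smooth_on_mult[OF open_UNIV smooth_on_polynomial_function[OF P(1)] smcut]
      by (auto simp: H_def[abs_def])
    show "norm (H z) \<le> S + \<delta>" for z
      using norm_triangle_ineq[of "H z - T z * cut z" "T z * cut z"] HT[of z] Tcut[of z] by simp
    show "norm (H z - h z) \<le> \<delta>" if "z \<in> K" for z
    proof -
      have "\<mu> \<le> cutr z" using z0(2)[of z] that K(2) by (auto simp: \<mu>_def)
      then have "T z * cut z = h z" using Hc(2)[OF that] \<mu> by (simp add: T_def cut_eq max_def)
      then show ?thesis using HT[of z] by simp
    qed
  qed
qed

lemma fourier_test_fun_integrable: "test_fun f \<Longrightarrow> integrable lborel (fourier f)"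
  using fourier_schwartz_decay[OF test_fun_schwartz] fourier_schwartz_measurable[OF test_fun_schwartz] integrable_wt2_bound(1) by metis

text \<open>Needed because \<^term>\<open>Inf {} :: real\<close> is unspecified: without it, a positive \<^const>\<open>min_bandlimit\<close>
  would not provide any approximation.\<close>

proposition bandlimited_approx_exists:
  fixes h :: "real \<times> real \<Rightarrow> complex"
  assumes K: "compact K" "K \<subseteq> square 1" "K \<noteq> {}" and h: "continuous_on K h" and \<epsilon>: "0 < \<epsilon>" "\<epsilon> < 1"
  shows "\<exists>c h\<^sub>b. 0 < c \<and> bandlimited_approx \<epsilon> K h h\<^sub>b \<and> has_bandlimit h\<^sub>b c"
proof -
  define S where "S = sup_norm K h"
  have "bounded (h ` K)" using h K(1) by (intro compact_imp_bounded compact_continuous_image)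
  then have hS: "norm (h z) \<le> S" if "z \<in> K" for z unfolding S_def using that by (rule norm_le_sup_norm)
  have S0: "0 \<le> S" using K(3) hS order_trans[OF norm_ge_zero] by blast
  show ?thesis
  proof (cases "S = 0")
    case True
    have f0: "fourier (\<lambda>_. 0) = (\<lambda>_. 0)" by (simp add: fourier_eq_EI EI_def fun_eq_iff)
    have d0: "deriv_multi \<alpha> (\<lambda>_. 0) = (\<lambda>_. 0)" for \<alpha>
      by (rule deriv_multi_induct) (use partials_zero[of UNIV _ "\<lambda>_. 0"] in auto)
    have s0: "sup_norm U (\<lambda>_. 0) \<le> 0" if "U \<noteq> {}" for U
      using that by (intro sup_norm_leI) auto
    have t0: "test_fun (\<lambda>_. 0)" by (simp add: test_fun_def)
    have b: "has_bandlimit (\<lambda>_. 0) 1" by (simp add: has_bandlimit_def f0 fun_support_def)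
    have "sup_norm K (\<lambda>z. 0 - h z) \<le> 0" using hS K(3) True by (intro sup_norm_leI) auto
    then have "bandlimited_approx \<epsilon> K h (\<lambda>_. 0)"
      unfolding bandlimited_approx_def using b test_fun_schwartz[OF t0] s0[of UNIV] True
      by (auto simp: f0 d0 S_def)
    with b show ?thesis using zero_less_one by blast
  next
    case False
    then have S: "0 < S" using S0 by simp
    \<comment> \<open>Two errors of size \<open>\<delta>\<close> fit into
      \<open>\<epsilon> * S\<close>. Since \<open>\<delta> \<le> S / 4\<close>, the final derivative
      bound is at most \<open>4 * (16 / 9) * (5 / 4) * S\<close>, that is \<open>80 / 9 * S\<close>,
      which is below \<open>10 * S\<close>.\<close>
    define \<delta> where "\<delta> = \<epsilon> * S / 4"
    have \<delta>: "0 < \<delta>" "\<delta> \<le> S / 4" using S \<epsilon> by (auto simp: \<delta>_def)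
    obtain H where H: "test_fun H" "\<And>z. z \<notin> square 2 \<Longrightarrow> H z = 0" "\<And>z. norm (H z) \<le> S + \<delta>"
      "\<And>z. z \<in> K \<Longrightarrow> norm (H z - h z) \<le> \<delta>"
      using compactly_supported_approximation[OF K(1,2) h hS S0 \<delta>(1)] by blast
    define A where "A = fourier H"
    have smA: "smooth_on UNIV A" unfolding A_def by (rule smooth_on_fourier[OF H(1)])
    have iA: "integrable lborel A" unfolding A_def by (rule fourier_test_fun_integrable[OF H(1)])
    have A_bound: "norm (deriv_multi \<alpha> A z) \<le> 16 / 9 * (S + \<delta>)" if "fst \<alpha> + snd \<alpha> \<le> 2" for \<alpha> z
      unfolding A_def by (rule norm_deriv_fourier_le[OF H(1-3) that])
    define c where "c n = inverse (real (Suc n))" for n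
    have c01: "0 < c n" "c n \<le> 1" for n by (auto simp: c_def inverse_le_1_iff)
    have c_lim: "c \<longlonglongrightarrow> 0" unfolding c_def[abs_def] by (rule LIMSEQ_inverse_real_of_nat)
    define B where "B n z = bump (c n *\<^sub>R z)" for n z
    have smB: "smooth_on UNIV (B n)" for n unfolding B_def[abs_def] by (rule smooth_on_scale[OF smooth_on_bump])
    have meas: "A \<in> borel_measurable borel" "B n \<in> borel_measurable borel" for n
      using smA smB by (auto intro: smooth_on_measurable)
    \<comment> \<open>Convergence of the truncated transforms in the integral norm gives uniform
      convergence of their inverse transforms.\<close>
    have "(\<lambda>n. \<integral>w. norm (A w) * norm (B n w - 1) \<partial>lborel) \<longlonglongrightarrow> (\<integral>w. 0 \<partial>(lborel :: (real \<times> real) measure))"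
    proof (rule integral_dominated_convergence[where w = "\<lambda>w. 2 * norm (A w)"])
      have "(\<lambda>n. norm (A w) * norm (B n w - 1)) \<longlonglongrightarrow> 0" for w
      proof -
        have "isCont bump 0" using smooth_on_continuous_on[OF smooth_on_bump] continuous_on_eq_continuous_at[OF open_UNIV] by blast
        moreover have "(\<lambda>n. c n *\<^sub>R w) \<longlonglongrightarrow> 0" using c_lim by (auto intro!: tendsto_eq_intros)
        ultimately have "(\<lambda>n. B n w) \<longlonglongrightarrow> bump 0" unfolding B_def by (rule isCont_tendsto_compose)
        then have "(\<lambda>n. norm (A w) * norm (B n w - 1)) \<longlonglongrightarrow> norm (A w) * norm (bump 0 - 1)" by (intro tendsto_intros)
        then show ?thesis by (simp add: bump_0)
      qed
      then show "AE w in lborel. (\<lambda>n. norm (A w) * norm (B n w - 1)) \<longlonglongrightarrow> 0" by simp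
      have "norm (B n w - 1) \<le> 2" for n w
        using norm_triangle_ineq4[of "B n w" 1] norm_bump_le[of "c n *\<^sub>R w"] by (simp add: B_def)
      then show "AE w in lborel. norm (norm (A w) * norm (B n w - 1)) \<le> 2 * norm (A w)" for n
        by (intro always_eventually allI) (simp add: mult.commute[of 2] mult_left_mono)
    qed (use iA meas in auto)
    then have ev1: "\<forall>\<^sub>F n in sequentially. (\<integral>w. norm (A w) * norm (B n w - 1) \<partial>lborel) < \<delta>"
      using \<delta>(1) by (intro order_tendstoD(2)) simp_all
    \<comment> \<open>A proper derivative of the stretched bump carries at least one factor
      \<open>c n\<close>, so it is eventually at most \<open>1\<close>; without derivatives the
      bound \<open>1\<close> holds for the bump itself.\<close>
    have ev2: "\<forall>\<^sub>F n in sequentially. \<forall>z. norm (deriv_multi \<alpha> (B n) z) \<le> 1" for \<alpha>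
    proof (cases "\<alpha> = (0, 0)")
      case True
      then show ?thesis by (simp add: B_def norm_bump_le)
    next
      case False
      obtain b where b: "\<And>z. norm (deriv_multi \<alpha> bump z) \<le> b"
        using test_fun_bounded[OF test_fun_deriv_multi[OF test_fun_bump], of \<alpha>] unfolding bounded_iff by auto
      have "(\<lambda>n. c n * b) \<longlonglongrightarrow> 0" using c_lim by (auto intro!: tendsto_eq_intros)
      then have "\<forall>\<^sub>F n in sequentially. c n * b < 1" by (rule order_tendstoD(2)) simp
      then show ?thesis
      proof eventually_elim
        case (elim n)
        obtain m where m: "fst \<alpha> + snd \<alpha> = Suc m" using False by (cases \<alpha>) (auto simp: gr0_conv_Suc dest: not0_implies_Suc)
        have cm: "c n ^ Suc m \<le> c n" using c01[of n] by (simp add: power_le_one mult_left_le)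
        show ?case
        proof
          fix z
          have "norm (deriv_multi \<alpha> (B n) z) = c n ^ Suc m * norm (deriv_multi \<alpha> bump (c n *\<^sub>R z))"
            using c01[of n] unfolding B_def[abs_def] deriv_multi_scale[OF smooth_on_bump] m norm_mult norm_power by simp
          also have "\<dots> \<le> c n * b" using cm b c01[of n] by (intro mult_mono) auto
          also have "\<dots> \<le> 1" using elim by simp
          finally show "norm (deriv_multi \<alpha> (B n) z) \<le> 1" .
        qed
      qed
    qed
    have "\<forall>\<^sub>F n in sequentially. \<forall>\<alpha>\<in>{(0, 0), (1, 0), (0, 1), (2, 0), (1, 1), (0, 2)}. \<forall>z. norm (deriv_multi \<alpha> (B n) z) \<le> 1"
      using ev2 by (intro eventually_ball_finite) auto
    with ev1 obtain n where n: "(\<integral>w. norm (A w) * norm (B n w - 1) \<partial>lborel) < \<delta>"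
      "\<forall>\<alpha>\<in>{(0, 0), (1, 0), (0, 1), (2, 0), (1, 1), (0, 2)}. \<forall>z. norm (deriv_multi \<alpha> (B n) z) \<le> 1"
      using eventually_happens[OF eventually_conj] trivial_limit_sequentially by blast
    define N where "N = real (Suc n)"
    \<comment> \<open>The transform of \<open>H\<close> cut off smoothly. Being a test function,
      \<open>M\<close> is the exact Fourier transform of \<open>EI M\<close>, so bandlimit and
      derivative bounds can be read off from it.\<close>
    define M where "M z = A z * B n z" for z
    have M0: "M z = 0" if "z \<notin> square N" for z
    proof -
      have "c n *\<^sub>R z \<notin> square 1"
      proof
        assume "c n *\<^sub>R z \<in> square 1"
        then have "z \<in> square N" by (cases z) (auto simp: square_def c_def N_def field_simps)
        with that show False by simp
      qed
      then show ?thesis by (simp add: M_def B_def bump_eq_0)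
    qed
    have M: "test_fun M"
      unfolding test_fun_def using smooth_on_mult[OF open_UNIV smA smB] M0 by (auto simp: M_def[abs_def])
    have fM: "fourier (EI M) = M" by (rule fourier_EI[OF test_fun_schwartz[OF M]])
    have close: "norm (EI M z - H z) \<le> \<delta>" for z
    proof -
      have "H z = EI A z" unfolding A_def by (rule schwartz_inversion[OF test_fun_schwartz[OF H(1)], symmetric])
      moreover have "EI M z - EI A z = (\<integral>w. (A w * (B n w - 1)) * cis (fst w * fst z + snd w * snd z) \<partial>lborel)"
      proof -
        have "integrable lborel (\<lambda>w. M w * cis (fst w * fst z + snd w * snd z))" "integrable lborel (\<lambda>w. A w * cis (fst w * fst z + snd w * snd z))"
          using iA schwartz_integrable[OF test_fun_schwartz[OF M], of "(0, 0)"] by (auto intro!: integrable_cis)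
        then show ?thesis
          unfolding EI_def by (subst Bochner_Integration.integral_diff[symmetric]) (auto simp: M_def algebra_simps)
      qed
      moreover have "norm (\<integral>w. (A w * (B n w - 1)) * cis (fst w * fst z + snd w * snd z) \<partial>lborel) \<le> (\<integral>w. norm (A w) * norm (B n w - 1) \<partial>lborel)"
        by (rule order_trans[OF integral_norm_bound]) (simp add: norm_mult)
      ultimately show ?thesis using n(1) by simp
    qed
    have band: "has_bandlimit (EI M) N"
      unfolding has_bandlimit_def fM fun_support_def
      by (rule closure_minimal) (use M0 closed_square in auto)
    have "bandlimited_approx \<epsilon> K h (EI M)"
      unfolding bandlimited_approx_def S_def[symmetric]
    proof (intro conjI allI impI)
      show "EI M \<in> schwartz" by (rule EI_test_fun_schwartz[OF M])
      show "\<exists>c. has_bandlimit (EI M) c" using band by blast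
      show "sup_norm K (\<lambda>z. EI M z - h z) \<le> \<epsilon> * S"
      proof (rule sup_norm_leI[OF K(3)])
        fix z assume "z \<in> K"
        from norm_triangle_ineq[of "EI M z - H z" "H z - h z"] close[of z] H(4)[OF this]
        have "norm (EI M z - h z) \<le> \<delta> + \<delta>" by simp
        also have "\<dots> \<le> \<epsilon> * S" using S \<epsilon> by (simp add: \<delta>_def)
        finally show "norm (EI M z - h z) \<le> \<epsilon> * S" .
      qed
      show "sup_norm UNIV (EI M) \<le> 3 * S"
      proof (rule sup_norm_leI[OF UNIV_not_empty])
        show "norm (EI M z) \<le> 3 * S" for z
          using norm_triangle_ineq[of "EI M z - H z" "H z"] close[of z] H(3)[of z] \<delta>(2) S by simp
      qed
      fix \<alpha> :: "nat \<times> nat" assume \<alpha>: "fst \<alpha> + snd \<alpha> \<le> 2"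
      show "sup_norm UNIV (deriv_multi \<alpha> (fourier (EI M))) \<le> 10 * S"
      proof (rule sup_norm_leI[OF UNIV_not_empty])
        fix z
        have "norm (deriv_multi \<alpha> M z) \<le> 4 * (16 / 9 * (S + \<delta>))"
          unfolding M_def[abs_def]
          by (rule norm_deriv_multi_mult_le[OF smA A_bound smB _ \<alpha>]) (use n(2) multi_index_le_2 in blast)+
        then show "norm (deriv_multi \<alpha> (fourier (EI M)) z) \<le> 10 * S"
          unfolding fM using \<delta>(2) S by simp
      qed
    qed
    moreover have "0 < N" by (simp add: N_def)
    ultimately show ?thesis using band by blast
  qed
qed

subsection \<open>The bandlimited solution of the transport equation\<close>

lemma integrable_mult_support:
  fixes m c :: "'a \<Rightarrow> complex"
  assumes "integrable M m" "c \<in> borel_measurable M" "\<And>t. m t \<noteq> 0 \<Longrightarrow> norm (c t) \<le> R"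
  shows "integrable M (\<lambda>t. c t * m t)"
proof (rule Bochner_Integration.integrable_bound)
  show "integrable M (\<lambda>t. R * norm (m t))" using assms by simp
  show "AE t in M. norm (c t * m t) \<le> norm (R * norm (m t))"
  proof (intro always_eventually allI)
    fix t
    have "norm (c t) * norm (m t) \<le> R * norm (m t)"
      using assms(3)[of t] by (cases "m t = 0") (auto intro: mult_right_mono)
    also have "\<dots> \<le> \<bar>R * norm (m t)\<bar>" by (rule abs_ge_self)
    finally show "norm (c t * m t) \<le> norm (R * norm (m t))" by (simp only: norm_mult real_norm_def)
  qed
qed (use assms in auto)

text \<open>Both parts of the solution are superpositions of plane waves, one over the plane and one
  over \<open>[0, 1]\<close> times the plane. An abstract measure with two phases gives smoothness,
  entire extension and pairing with test functions once for both.\<close>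

locale bounded_phase =
  fixes M :: "'a measure" and a b :: "'a \<Rightarrow> real" and R :: real
  assumes meas [measurable]: "a \<in> borel_measurable M" "b \<in> borel_measurable M"
begin

definition amp :: "('a \<Rightarrow> complex) \<Rightarrow> bool" where
  "amp m \<longleftrightarrow> integrable M m \<and> (\<forall>t. m t \<noteq> 0 \<longrightarrow> \<bar>a t\<bar> \<le> R \<and> \<bar>b t\<bar> \<le> R)"

definition osc :: "('a \<Rightarrow> complex) \<Rightarrow> real \<times> real \<Rightarrow> complex" where
  "osc m z = (\<integral>t. m t * cis (a t * fst z + b t * snd z) \<partial>M)"

lemma amp_mult:
  assumes "amp m" "c \<in> borel_measurable M" "\<And>t. m t \<noteq> 0 \<Longrightarrow> norm (c t) \<le> C"
  shows "amp (\<lambda>t. c t * m t)"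
  using assms integrable_mult_support[of M m c C] unfolding amp_def by auto

lemma amp_partial:
  assumes "amp m"
  shows "amp (\<lambda>t. \<i> * of_real (a t) * m t)" "amp (\<lambda>t. \<i> * of_real (b t) * m t)"
  using amp_mult[OF assms, of "\<lambda>t. \<i> * of_real (a t)" R] amp_mult[OF assms, of "\<lambda>t. \<i> * of_real (b t)" R] assms
  by (auto simp: amp_def norm_mult)

lemma osc_has_derivative:
  assumes m: "amp m"
  shows "(osc m has_derivative grad_map (osc (\<lambda>t. \<i> * of_real (a t) * m t) z) (osc (\<lambda>t. \<i> * of_real (b t) * m t) z)) (at z)"
  unfolding osc_def[abs_def]
proof (rule has_derivative_cis_integral)
  have sq: "\<bar>x\<bar> \<le> R \<Longrightarrow> x\<^sup>2 \<le> R\<^sup>2" for x using abs_le_square_iff[of x R] by simp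
  show "integrable M m" using m by (simp add: amp_def)
  then show "integrable M (\<lambda>t. of_real ((a t)\<^sup>2) * m t)" "integrable M (\<lambda>t. of_real ((b t)\<^sup>2) * m t)"
    using m by (auto intro!: integrable_mult_support[where R = "R\<^sup>2"] simp: amp_def norm_power sq simp del: of_real_power)
qed measurable

lemma smooth_on_osc:
  assumes "amp m"
  shows "smooth_on UNIV (osc m)"
proof (rule smooth_on_coinduct[where P = "\<lambda>f. \<exists>m. amp m \<and> f = osc m"])
  fix f assume "\<exists>m. amp m \<and> f = osc m"
  then obtain m where m: "amp m" "f = osc m" by blast
  show "\<exists>fx fy. (\<exists>m. amp m \<and> fx = osc m) \<and> (\<exists>m. amp m \<and> fy = osc m) \<and> (\<forall>z\<in>UNIV. (f has_derivative grad_map (fx z) (fy z)) (at z))"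
    unfolding m(2) using amp_partial[OF m(1)] osc_has_derivative[OF m(1)]
    by (intro exI[of _ "osc (\<lambda>t. \<i> * of_real (a t) * m t)"] exI[of _ "osc (\<lambda>t. \<i> * of_real (b t) * m t)"] conjI ballI
      exI[of _ "\<lambda>t. \<i> * of_real (a t) * m t"] exI[of _ "\<lambda>t. \<i> * of_real (b t) * m t"] refl)
qed (use assms in auto)

lemma norm_osc_le: "norm (osc m z) \<le> (\<integral>t. norm (m t) \<partial>M)"
  unfolding osc_def using integral_norm_bound[of M "\<lambda>t. m t * cis (a t * fst z + b t * snd z)"]
  by (simp add: norm_mult)

lemma amp_integrable: "amp m \<Longrightarrow> integrable M (\<lambda>t. m t * cis (a t * fst z + b t * snd z))"
  by (rule integrable_cis) (auto simp: amp_def)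

definition osc_ext :: "('a \<Rightarrow> complex) \<Rightarrow> complex \<times> complex \<Rightarrow> complex" where
  "osc_ext m p = (\<integral>t. m t * exp (\<i> * (of_real (a t) * fst p + of_real (b t) * snd p)) \<partial>M)"

lemma osc_ext_of_real: "osc_ext m (of_real x, of_real y) = osc m (x, y)"
  by (simp add: osc_ext_def osc_def cis_conv_exp)

lemma osc_ext_has_derivative:
  assumes "amp m"
  shows "\<exists>\<alpha> \<beta>. (osc_ext m has_derivative (\<lambda>d. fst d * \<alpha> + snd d * \<beta>)) (at p)"
  unfolding osc_ext_def[abs_def] using assms has_derivative_exp_integral[of M m a b R "fst p" "snd p"]
  by (auto simp: amp_def)

lemma osc_swap:
  assumes "sigma_finite_measure M" "amp m" "integrable lborel p"
  shows "(\<integral>z. osc m z * p z \<partial>lborel) = (\<integral>t. m t * EI p (a t, b t) \<partial>M)"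
  unfolding osc_def by (rule integral_cis_swap) (use assms in \<open>auto simp: amp_def\<close>)

end

text \<open>Linearity reduces sequential continuity to an estimate by seminorms. The value and the
  first \<open>x\<close>-derivative suffice in the bound, one subtraction in the direction of
  \<open>\<xi>\<close> costing one derivative.\<close>

lemma temperedI:
  assumes lin: "\<And>\<phi> \<psi> a b. \<phi> \<in> schwartz \<Longrightarrow> \<psi> \<in> schwartz \<Longrightarrow> T (\<lambda>z. a * \<phi> z + b * \<psi> z) = a * T \<phi> + b * T \<psi>"
    and bd: "\<And>\<phi>. \<phi> \<in> schwartz \<Longrightarrow> norm (T \<phi>) \<le> C * (schwartz_norm (0, 0) \<phi> + schwartz_norm (1, 0) \<phi>)"
  shows "tempered T"
  unfolding tempered_def
proof (intro conjI ballI allI impI)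
  fix \<Phi> \<phi> assume "(\<forall>n. \<Phi> n \<in> schwartz) \<and> \<phi> \<in> schwartz \<and> schwartz_tendsto \<Phi> \<phi>"
  then have \<Phi>: "\<And>n. \<Phi> n \<in> schwartz" "\<phi> \<in> schwartz" and conv: "schwartz_tendsto \<Phi> \<phi>" by auto
  have "(\<lambda>n. schwartz_norm \<alpha> (\<lambda>z. \<Phi> n z - \<phi> z)) \<longlonglongrightarrow> 4 * (0 + 0 + 0 + 0)" for \<alpha>
    unfolding schwartz_norm_def using conv unfolding schwartz_tendsto_def by (intro tendsto_intros) blast+
  then have "(\<lambda>n. C * (schwartz_norm (0, 0) (\<lambda>z. \<Phi> n z - \<phi> z) + schwartz_norm (1, 0) (\<lambda>z. \<Phi> n z - \<phi> z))) \<longlonglongrightarrow> C * (4 * (0 + 0 + 0 + 0) + 4 * (0 + 0 + 0 + 0))"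
    by (intro tendsto_intros)
  then have 0: "(\<lambda>n. C * (schwartz_norm (0, 0) (\<lambda>z. \<Phi> n z - \<phi> z) + schwartz_norm (1, 0) (\<lambda>z. \<Phi> n z - \<phi> z))) \<longlonglongrightarrow> 0"
    by simp
  have "(\<lambda>n. T (\<Phi> n) - T \<phi>) \<longlonglongrightarrow> 0"
  proof (rule Lim_null_comparison[OF _ 0], intro always_eventually allI)
    fix n
    have "T (\<Phi> n) - T \<phi> = T (\<lambda>z. \<Phi> n z - \<phi> z)" using lin[OF \<Phi>(1)[of n] \<Phi>(2), of 1 "-1"] by simp
    then show "norm (T (\<Phi> n) - T \<phi>) \<le> C * (schwartz_norm (0, 0) (\<lambda>z. \<Phi> n z - \<phi> z) + schwartz_norm (1, 0) (\<lambda>z. \<Phi> n z - \<phi> z))"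
      using bd[OF schwartz_diff[OF \<Phi>(1)[of n] \<Phi>(2)]] by simp
  qed
  then show "(\<lambda>n. T (\<Phi> n)) \<longlonglongrightarrow> T \<phi>" by (rule LIM_zero_cancel)
qed (use lin in auto)

lemma schwartz_norm_nonneg: "f \<in> schwartz \<Longrightarrow> 0 \<le> schwartz_norm \<alpha> f"
  using wt2_nonneg_const[OF schwartz_decay] .

lemma schwartz_norm_le: "f \<in> schwartz \<Longrightarrow> norm (deriv_multi \<alpha> f z) \<le> schwartz_norm \<alpha> f"
proof -
  assume f: "f \<in> schwartz"
  have "norm (deriv_multi \<alpha> f z) \<le> schwartz_norm \<alpha> f * (wt z)\<^sup>2" by (rule schwartz_decay[OF f])
  also have "\<dots> \<le> schwartz_norm \<alpha> f * 1"
    using order_trans[OF wt2_le_wt wt_le_1] schwartz_norm_nonneg[OF f] by (rule mult_left_mono)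
  finally show ?thesis by simp
qed

lemma fun_support_subset: "fun_support \<phi> \<subseteq> K \<Longrightarrow> v \<notin> K \<Longrightarrow> \<phi> v = 0"
  and partial_x_off_support: "fun_support \<phi> \<subseteq> K \<Longrightarrow> v \<notin> K \<Longrightarrow> partial_x UNIV \<phi> v = 0"
proof -
  assume s: "fun_support \<phi> \<subseteq> K" and v: "v \<notin> K"
  have o: "open (- fun_support \<phi>)" "v \<in> - fun_support \<phi>" using s v by (auto simp: fun_support_def)
  have z: "w \<in> - fun_support \<phi> \<Longrightarrow> \<phi> w = 0" for w
    using closure_subset[of "{z. \<phi> z \<noteq> 0}"] by (auto simp: fun_support_def)
  show "\<phi> v = 0" "partial_x UNIV \<phi> v = 0"
    using z o(2) partials_zero[OF o z] by auto
qed

lemma integrable_bounded_times: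
  fixes f g :: "real \<times> real \<Rightarrow> complex"
  assumes "smooth_on UNIV f" "\<And>z. norm (f z) \<le> C" "integrable lborel g"
  shows "integrable lborel (\<lambda>z. f z * g z)"
  using integrable_mult_support[OF assms(3), of f C] assms(1,2) by (auto intro: smooth_on_measurable)

lemma schwartz_wt2: "\<phi> \<in> schwartz \<Longrightarrow> norm (\<phi> z) \<le> schwartz_norm (0, 0) \<phi> * (wt z)\<^sup>2"
  using schwartz_decay[of \<phi> "(0, 0)" z] by simp

lemma square_abs_le: "v \<in> square R \<Longrightarrow> \<bar>fst v\<bar> \<le> R \<and> \<bar>snd v\<bar> \<le> R"
  by (auto simp: square_def)

text \<open>Properties that survive a pointwise limit: a Lipschitz bound replaces derivatives,
  stated in the direction \<open>\<xi>\<close> in which the divided difference is formed. One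
  constant \<open>B\<close> serves for size and slope.\<close>

locale transport_symbol =
  fixes k :: "real \<times> real \<Rightarrow> complex" and W\<^sub>0 W B :: real
  assumes W0: "0 < W\<^sub>0" and W: "0 < W"
    and k_bound: "\<And>v. norm (k v) \<le> B"
    and k_lip: "\<And>\<xi> \<xi>' \<eta>. norm (k (\<xi>, \<eta>) - k (\<xi>', \<eta>)) \<le> B * \<bar>\<xi> - \<xi>'\<bar>"
    and k_zero: "\<And>v. v \<notin> square W\<^sub>0 \<Longrightarrow> k v = 0"
    and k_meas [measurable]: "k \<in> borel_measurable borel"
begin

lemma B: "0 \<le> B" using order_trans[OF norm_ge_zero k_bound] .

text \<open>The solution is written as the integral of \<open>quot (\<xi>, \<eta>) exp (\<i> (x \<xi> + y \<eta>))\<close> plus \<open>x\<close> times an integral over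
  \<open>(s, v) \<in> [0, 1] \<times> square W\<^sub>0\<close>, using
  \<open>(exp (\<i> x \<xi>) - exp (- \<i> x W)) / (\<i> (\<xi> + W)) = x \<integral>\<^sub>0\<^sup>1 exp (\<i> x (- W + s (\<xi> + W))) ds\<close>,
  so that no singular integrand occurs. On the line \<open>\<xi> = - W\<close> the division by zero in \<open>quot\<close> gives the
  harmless value \<open>0\<close>.\<close>

definition trace :: "real \<times> real \<Rightarrow> complex" where
  "trace v = (if v \<in> square W\<^sub>0 then k (- W, snd v) else 0)"

definition quot :: "real \<times> real \<Rightarrow> complex" where
  "quot v = (if v \<in> square W\<^sub>0 then (k v - k (- W, snd v)) / (\<i> * of_real (fst v + W)) else 0)"

lemma trace_meas [measurable]: "trace \<in> borel_measurable borel"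
proof -
  have "(\<lambda>v::real \<times> real. k (- W, snd v)) \<in> borel_measurable borel"
    by (rule measurable_compose[OF _ k_meas]) (intro borel_measurable_continuous_onI continuous_intros)
  then show ?thesis unfolding trace_def by measurable
qed

lemma quot_eq: "\<i> * of_real (fst v + W) * quot v = k v - trace v"
proof (cases "v \<in> square W\<^sub>0")
  case True
  show ?thesis
  proof (cases "fst v + W = 0")
    case True
    \<comment> \<open>On the resonant line \<open>v\<close> is its own projection, so
      \<open>k v\<close> equals \<open>trace v\<close> and both sides vanish.\<close>
    then have "v = (- W, snd v)" by (cases v) auto
    with \<open>v \<in> square W\<^sub>0\<close> True show ?thesis by (metis trace_def diff_self mult_zero_left mult_zero_right of_real_0)
  next
    case False
    then have "\<i> * complex_of_real (fst v + W) \<noteq> 0" by (simp del: of_real_add)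
    then show ?thesis using True by (simp add: quot_def trace_def del: of_real_add)
  qed
qed (simp add: quot_def trace_def k_zero)

lemma quot_meas [measurable]: "quot \<in> borel_measurable borel"
proof -
  have "quot = (\<lambda>v. (k v - trace v) / (\<i> * of_real (fst v + W)))"
    by (auto simp: quot_def trace_def k_zero fun_eq_iff)
  then show ?thesis by (simp only:) measurable
qed

lemma quot_zero: "v \<notin> square W\<^sub>0 \<Longrightarrow> quot v = 0" and trace_zero: "v \<notin> square W\<^sub>0 \<Longrightarrow> trace v = 0"
  by (simp_all add: quot_def trace_def)

text \<open>The Lipschitz bound in \<open>\<xi>\<close> absorbs the denominator; the result depends
  neither on \<open>W\<close> nor on the distance to the resonance.\<close>

lemma norm_quot_le: "norm (quot v) \<le> B"
proof (cases "v \<in> square W\<^sub>0 \<and> fst v + W \<noteq> 0")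
  case True
  have "norm (k v - k (- W, snd v)) \<le> B * \<bar>fst v + W\<bar>" using k_lip[of "fst v" "snd v" "- W"] by simp
  then show ?thesis using True by (simp add: quot_def norm_divide norm_mult divide_le_eq flip: of_real_add)
qed (use B in \<open>auto simp: quot_def simp flip: of_real_add\<close>)

lemma norm_trace_le: "norm (trace v) \<le> B"
  using k_bound B by (simp add: trace_def)

lemma integrable_square_bounded:
  fixes f :: "real \<times> real \<Rightarrow> complex"
  assumes "f \<in> borel_measurable borel" "\<And>v. norm (f v) \<le> C" "\<And>v. v \<notin> square W\<^sub>0 \<Longrightarrow> f v = 0"
  shows "integrable lborel f"
proof (rule Bochner_Integration.integrable_bound[OF integrable_indicator_square])
  show "AE v in lborel. norm (f v) \<le> norm (C * indicator (square W\<^sub>0) v)"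
  proof (intro always_eventually allI)
    fix v show "norm (f v) \<le> norm (C * indicator (square W\<^sub>0) v)"
      using order_trans[OF assms(2)[of v] abs_ge_self] assms(3)[of v] by (cases "v \<in> square W\<^sub>0") auto
  qed
qed (use assms(1) W0 in auto)

lemma integrable_quot: "integrable lborel quot" and integrable_trace: "integrable lborel trace" and integrable_k: "integrable lborel k"
  by (rule integrable_square_bounded; (fact norm_quot_le norm_trace_le k_bound quot_zero trace_zero k_zero)?; measurable)+

definition blend :: "real \<times> real \<times> real \<Rightarrow> complex" where
  "blend t = of_real (indicator {0..1} (fst t)) * trace (snd t)"

text \<open>Linear interpolation between the resonant frequency \<open>- W\<close> at
  \<open>s = 0\<close> and the frequency \<open>\<xi>\<close> at \<open>s = 1\<close>.\<close>

definition phase :: "real \<times> real \<times> real \<Rightarrow> real" where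
  "phase t = - W + fst t * (fst (snd t) + W)"

abbreviation LB :: "(real \<times> real \<times> real) measure" where
  "LB \<equiv> lborel \<Otimes>\<^sub>M lborel"

lemma sigma_finite_LB: "sigma_finite_measure LB"
proof -
  interpret pair_sigma_finite "lborel :: real measure" "lborel :: (real \<times> real) measure" ..
  show ?thesis by unfold_locales
qed

lemma phase_meas [measurable]: "phase \<in> borel_measurable LB"
  unfolding phase_def by measurable

sublocale O1: bounded_phase "lborel :: (real \<times> real) measure" fst snd W\<^sub>0
  by unfold_locales auto

sublocale O2: bounded_phase LB phase "\<lambda>t. snd (snd t)" W\<^sub>0
  by unfold_locales measurable

lemma O1_osc: "O1.osc = EI"
  by (auto simp: O1.osc_def EI_def fun_eq_iff)

lemma amp_squareI:
  assumes "integrable lborel f" "\<And>v. v \<notin> square W\<^sub>0 \<Longrightarrow> f v = 0"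
  shows "O1.amp f"
  unfolding O1.amp_def using assms square_abs_le by blast

lemmas amp_quot = amp_squareI[OF integrable_quot quot_zero]

text \<open>A nonzero density forces \<open>k\<close> to be nonzero somewhere on the line
  \<open>\<xi> = - W\<close>, so \<open>- W\<close> lies in the band, and by convexity all
  interpolated frequencies do. This keeps the second part of the solution inside the square.\<close>

lemma blend_support:
  assumes "blend t \<noteq> 0"
  shows "0 \<le> fst t" "fst t \<le> 1" "snd t \<in> square W\<^sub>0" "W \<le> W\<^sub>0" "(phase t, snd (snd t)) \<in> square W\<^sub>0"
proof -
  have t: "fst t \<in> {0..1}" "trace (snd t) \<noteq> 0" using assms by (auto simp: blend_def indicator_def split: if_splits)
  then have sq: "snd t \<in> square W\<^sub>0" "k (- W, snd (snd t)) \<noteq> 0" by (auto simp: trace_def split: if_splits)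
  then have W': "(- W, snd (snd t)) \<in> square W\<^sub>0" using k_zero by blast
  show "0 \<le> fst t" "fst t \<le> 1" "snd t \<in> square W\<^sub>0" "W \<le> W\<^sub>0" using t sq W' by (auto simp: square_def)
  have "(1 - fst t) * - W + fst t * fst (snd t) \<in> {- W\<^sub>0..W\<^sub>0}"
    using convexD_alt[of "{- W\<^sub>0..W\<^sub>0}" "- W" "fst (snd t)" "fst t"] t sq W' by (auto simp: square_def)
  moreover have "phase t = (1 - fst t) * - W + fst t * fst (snd t)" by (simp add: phase_def algebra_simps)
  ultimately show "(phase t, snd (snd t)) \<in> square W\<^sub>0" using W' by (auto simp: square_def)
qed

lemma integrable_blend: "integrable LB blend"
  unfolding blend_def[abs_def]
  by (rule integrable_tensor) (use integrable_trace in \<open>auto intro: lborel.sigma_finite_measure_axioms\<close>)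

lemma amp_blend: "O2.amp blend"
  unfolding O2.amp_def using integrable_blend square_abs_le[OF blend_support(5)] by simp

lemma integral_norm_blend: "(\<integral>t. norm (blend t) \<partial>LB) \<le> 4 * W\<^sub>0\<^sup>2 * B"
proof -
  have "(\<integral>t. norm (blend t) \<partial>LB) = (\<integral>t. indicator {0..1} (fst t) * norm (trace (snd t)) \<partial>LB)"
    by (simp add: blend_def norm_mult)
  also have "\<dots> = (\<integral>s. indicator {0..1::real} s \<partial>lborel) * (\<integral>v. norm (trace v) \<partial>lborel)"
    by (rule integral_tensor) (use integrable_trace in \<open>auto intro: lborel.sigma_finite_measure_axioms\<close>)
  also have "\<dots> \<le> norm (\<integral>v. norm (trace v) \<partial>lborel)" by simp
  also have "\<dots> \<le> 4 * W\<^sub>0\<^sup>2 * B"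
    by (rule norm_integral_square_le) (use W0 norm_trace_le trace_zero in auto)
  finally show ?thesis .
qed

lemma norm_EI_square_le:
  assumes "\<And>v. norm (f v) \<le> C" "\<And>v. v \<notin> square W\<^sub>0 \<Longrightarrow> f v = 0"
  shows "norm (EI f z) \<le> 4 * W\<^sub>0\<^sup>2 * C"
  unfolding EI_def by (rule norm_integral_square_le) (use assms W0 in \<open>auto simp: norm_mult\<close>)

section \<open>The solution and its equation\<close>

definition sol_ext :: "complex \<times> complex \<Rightarrow> complex" where
  "sol_ext p = O1.osc_ext quot p + fst p * O2.osc_ext blend p"

definition sol :: "real \<times> real \<Rightarrow> complex" where
  "sol z = EI quot z + of_real (fst z) * O2.osc blend z"

lemma sol_real_restriction: "real_restriction sol_ext = sol"
  by (auto simp: real_restriction_def sol_ext_def sol_def O1.osc_ext_of_real O2.osc_ext_of_real O1_osc)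

lemma entire_sol: "entire2 sol_ext"
  unfolding entire2_def
proof
  fix p
  obtain a b where 1: "(O1.osc_ext quot has_derivative (\<lambda>d. fst d * a + snd d * b)) (at p)"
    using O1.osc_ext_has_derivative[OF amp_quot] by blast
  obtain a' b' where 2: "(O2.osc_ext blend has_derivative (\<lambda>d. fst d * a' + snd d * b')) (at p)"
    using O2.osc_ext_has_derivative[OF amp_blend] by blast
  have "(sol_ext has_derivative (\<lambda>d. (fst d * a + snd d * b) + (fst p * (fst d * a' + snd d * b') + fst d * O2.osc_ext blend p))) (at p)"
    unfolding sol_ext_def[abs_def]
    by (intro has_derivative_add has_derivative_mult 1 2 has_derivative_fst has_derivative_ident)
  then have "(sol_ext has_derivative (\<lambda>(h, k). (a + fst p * a' + O2.osc_ext blend p) * h + (b + fst p * b') * k)) (at p)"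
    by (simp add: case_prod_beta' algebra_simps)
  then show "\<exists>a b. (sol_ext has_derivative (\<lambda>(h, k). a * h + b * k)) (at p)" by blast
qed

lemma norm_osc_blend_le: "norm (O2.osc blend z) \<le> 4 * W\<^sub>0\<^sup>2 * B"
  by (rule order_trans[OF O2.norm_osc_le integral_norm_blend])

text \<open>The explicit factor \<open>x\<close> is responsible for the linear growth; the constant
  does not involve \<open>W\<close>.\<close>

lemma norm_sol_le: "norm (sol z) \<le> 4 * W\<^sub>0\<^sup>2 * B * (1 + \<bar>fst z\<bar>)"
proof -
  have "norm (sol z) \<le> norm (EI quot z) + \<bar>fst z\<bar> * norm (O2.osc blend z)"
    unfolding sol_def by (rule norm_triangle_le) (simp add: norm_mult)
  also have "\<dots> \<le> 4 * W\<^sub>0\<^sup>2 * B + \<bar>fst z\<bar> * (4 * W\<^sub>0\<^sup>2 * B)"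
    using norm_EI_square_le[of quot B z] norm_quot_le quot_zero norm_osc_blend_le
    by (intro add_mono mult_left_mono) auto
  finally show ?thesis by (simp add: algebra_simps)
qed

lemma smooth_on_sol: "smooth_on UNIV sol"
  unfolding sol_def[abs_def] O1_osc[symmetric]
  by (intro smooth_on_add smooth_on_mult smooth_on_of_real smooth_on_fst O1.smooth_on_osc O2.smooth_on_osc amp_quot amp_blend open_UNIV)

lemma partial_x_sol:
  "partial_x UNIV sol z = EI (\<lambda>v. \<i> * of_real (fst v) * quot v) z + (O2.osc blend z + of_real (fst z) * O2.osc (\<lambda>t. \<i> * of_real (phase t) * blend t) z)"
proof -
  have "(sol has_derivative (\<lambda>d. grad_map (EI (\<lambda>v. \<i> * of_real (fst v) * quot v) z) (EI (\<lambda>v. \<i> * of_real (snd v) * quot v) z) d +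
    (of_real (fst z) * grad_map (O2.osc (\<lambda>t. \<i> * of_real (phase t) * blend t) z) (O2.osc (\<lambda>t. \<i> * of_real (snd (snd t)) * blend t) z) d
      + of_real (fst d) * O2.osc blend z))) (at z)"
    unfolding sol_def[abs_def] O1_osc[symmetric]
    by (intro has_derivative_add has_derivative_mult O1.osc_has_derivative O2.osc_has_derivative amp_quot amp_blend has_derivative_of_real has_derivative_fst has_derivative_ident)
  from partial_x_eq[OF open_UNIV UNIV_I this] show ?thesis by simp
qed

text \<open>With \<open>c\<close> the phase at \<open>s = 0\<close> and \<open>d\<close> its
  increment, the integrand is \<open>trace\<close> times the \<open>s\<close>-derivative of
  \<open>s * exp (\<i> * (c + s * d))\<close>. Integration over \<open>[0, 1]\<close> leaves the
  plane wave with phase \<open>c + d\<close>, the one at the original frequency.\<close>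

lemma blend_identity:
  "O2.osc blend z + of_real (fst z) * O2.osc (\<lambda>t. \<i> * of_real (fst t * (fst (snd t) + W)) * blend t) z = EI trace z"
proof -
  let ?th = "\<lambda>s v. (- W + s * (fst v + W)) * fst z + snd v * snd z"
  let ?g = "\<lambda>s v. blend (s, v) * (1 + \<i> * of_real (s * ((fst v + W) * fst z))) * cis (?th s v)"
  have amp': "O2.amp (\<lambda>t. \<i> * of_real (fst t * (fst (snd t) + W)) * blend t)"
  proof (rule O2.amp_mult[OF amp_blend, where C = "W\<^sub>0 + W"])
    fix t assume t: "blend t \<noteq> 0"
    note s = blend_support[OF t]
    have "\<bar>fst (snd t) + W\<bar> \<le> W\<^sub>0 + W" using s(3) W by (auto simp: square_def)
    then have "\<bar>fst t\<bar> * \<bar>fst (snd t) + W\<bar> \<le> 1 * (W\<^sub>0 + W)" using s(1,2) by (intro mult_mono) auto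
    then show "norm (\<i> * complex_of_real (fst t * (fst (snd t) + W))) \<le> W\<^sub>0 + W"
      by (simp add: norm_mult abs_mult flip: of_real_add)
  qed measurable
  have eq: "O2.osc blend z + of_real (fst z) * O2.osc (\<lambda>t. \<i> * of_real (fst t * (fst (snd t) + W)) * blend t) z = (\<integral>t. ?g (fst t) (snd t) \<partial>LB)"
    unfolding O2.osc_def
    apply (subst integral_mult_right_zero[symmetric])
    apply (subst Bochner_Integration.integral_add[symmetric])
      apply (rule O2.amp_integrable[OF amp_blend])
     apply (rule integrable_mult_right, rule O2.amp_integrable[OF amp'])
    by (intro Bochner_Integration.integral_cong refl) (simp add: phase_def algebra_simps)
  have int: "integrable LB (case_prod ?g)"
  proof -
    have "integrable LB (\<lambda>t. blend t * cis (phase t * fst z + snd (snd t) * snd z) +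
      of_real (fst z) * ((\<i> * of_real (fst t * (fst (snd t) + W)) * blend t) * cis (phase t * fst z + snd (snd t) * snd z)))"
      by (intro Bochner_Integration.integrable_add integrable_mult_right O2.amp_integrable amp_blend amp')
    then show ?thesis by (rule Bochner_Integration.integrable_cong[THEN iffD1, rotated -1]) (auto simp: phase_def algebra_simps)
  qed
  have "(\<integral>t. ?g (fst t) (snd t) \<partial>LB) = (\<integral>v. (\<integral>s. ?g s v \<partial>lborel) \<partial>lborel)"
    using lborel_pair.integral_snd[OF int] by (simp add: case_prod_beta')
  also have "\<dots> = (\<integral>v. trace v * cis (fst v * fst z + snd v * snd z) \<partial>lborel)"
  proof (intro Bochner_Integration.integral_cong refl)
    fix v :: "real \<times> real"
    let ?d = "(fst v + W) * fst z" and ?c = "- W * fst z + snd v * snd z"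
    have "(\<integral>s. indicator {0..1} s *\<^sub>R ((1 + \<i> * of_real (s * ?d)) * exp (\<i> * of_real (?c + s * ?d))) \<partial>lborel)
      = of_real 1 * exp (\<i> * of_real (?c + 1 * ?d)) - of_real 0 * exp (\<i> * of_real (?c + 0 * ?d))"
    proof (rule integral_FTC_Icc)
      fix s :: real
      have "((\<lambda>s. s * exp (\<i> * (of_real ?c + s * of_real ?d))) has_field_derivative
          (1 + \<i> * (of_real s * of_real ?d)) * exp (\<i> * (of_real ?c + of_real s * of_real ?d))) (at (of_real s))"
        by (auto intro!: derivative_eq_intros simp: algebra_simps)
      from has_vector_derivative_real_field[OF this, of "{0..1}"]
      show "((\<lambda>s. of_real s * exp (\<i> * of_real (?c + s * ?d))) has_vector_derivative
        (1 + \<i> * of_real (s * ?d)) * exp (\<i> * of_real (?c + s * ?d))) (at s within {0..1})"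
        by simp
    qed (auto intro!: continuous_intros)
    then have *: "(\<integral>s. indicator {0..1} s *\<^sub>R ((1 + \<i> * of_real (s * ?d)) * cis (?c + s * ?d)) \<partial>lborel) = cis (?c + ?d)"
      by (simp add: cis_conv_exp)
    have "(\<integral>s. ?g s v \<partial>lborel) = (\<integral>s. trace v * (indicator {0..1} s *\<^sub>R ((1 + \<i> * of_real (s * ?d)) * cis (?c + s * ?d))) \<partial>lborel)"
      by (intro Bochner_Integration.integral_cong refl) (simp add: blend_def scaleR_conv_of_real algebra_simps)
    also have "\<dots> = trace v * cis (?c + ?d)" by (subst integral_mult_right_zero) (simp only: *)
    also have "?c + ?d = fst v * fst z + snd v * snd z" by (simp add: algebra_simps)
    finally show "(\<integral>s. ?g s v \<partial>lborel) = trace v * cis (fst v * fst z + snd v * snd z)" .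
  qed
  finally show ?thesis unfolding eq EI_def .
qed

text \<open>The operator multiplies a plane wave of frequency \<open>\<xi>\<close> by
  \<open>\<i> * (\<xi> + W)\<close>, so the part with \<open>quot\<close> gives the inverse
  transform of \<open>k - trace\<close>; the part with the factor \<open>x\<close> restores that of
  \<open>trace\<close>.\<close>

lemma sol_ode: "partial_x UNIV sol z + \<i> * of_real W * sol z = EI k z"
proof -
  let ?q = "\<lambda>v. \<i> * of_real (fst v) * quot v"
  have i1: "integrable lborel (\<lambda>v. ?q v * cis (fst v * fst z + snd v * snd z))" "integrable lborel (\<lambda>v. quot v * cis (fst v * fst z + snd v * snd z))"
    using O1.amp_integrable[OF O1.amp_partial(1)[OF amp_quot]] O1.amp_integrable[OF amp_quot] by auto
  have "EI ?q z + \<i> * of_real W * EI quot z = (\<integral>v. (\<i> * of_real (fst v + W) * quot v) * cis (fst v * fst z + snd v * snd z) \<partial>lborel)"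
    unfolding EI_def
    apply (subst integral_mult_right_zero[symmetric])
    apply (subst Bochner_Integration.integral_add[symmetric])
      apply (rule i1)
     apply (rule integrable_mult_right, rule i1)
    by (simp add: algebra_simps)
  also have "\<dots> = EI k z - EI trace z"
    unfolding quot_eq EI_def left_diff_distrib
    using integrable_k integrable_trace by (intro Bochner_Integration.integral_diff integrable_cis) auto
  finally have 1: "EI ?q z + \<i> * of_real W * EI quot z = EI k z - EI trace z" .
  have i2: "integrable LB (\<lambda>t. (\<i> * of_real (phase t) * blend t) * cis (phase t * fst z + snd (snd t) * snd z))" "integrable LB (\<lambda>t. blend t * cis (phase t * fst z + snd (snd t) * snd z))"
    using O2.amp_integrable[OF O2.amp_partial(1)[OF amp_blend]] O2.amp_integrable[OF amp_blend] by auto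
  \<comment> \<open>The summand \<open>- W\<close> of \<open>phase\<close> cancels against the
    zero-order term of the equation.\<close>
  have 2: "O2.osc (\<lambda>t. \<i> * of_real (phase t) * blend t) z + \<i> * of_real W * O2.osc blend z = O2.osc (\<lambda>t. \<i> * of_real (fst t * (fst (snd t) + W)) * blend t) z"
    unfolding O2.osc_def
    apply (subst integral_mult_right_zero[symmetric])
    apply (subst Bochner_Integration.integral_add[symmetric])
      apply (rule i2)
     apply (rule integrable_mult_right, rule i2)
    by (intro Bochner_Integration.integral_cong refl) (simp add: phase_def[of "_ :: real \<times> real \<times> real"] algebra_simps)
  have "partial_x UNIV sol z + \<i> * of_real W * sol z =
    (EI ?q z + \<i> * of_real W * EI quot z) + (O2.osc blend z + of_real (fst z) * (O2.osc (\<lambda>t. \<i> * of_real (phase t) * blend t) z + \<i> * of_real W * O2.osc blend z))"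
    unfolding partial_x_sol sol_def by (simp add: algebra_simps)
  also have "\<dots> = EI k z - EI trace z + EI trace z"
    unfolding 1 2 blend_identity ..
  finally show ?thesis by simp
qed

section \<open>The solution as a tempered distribution and its Fourier transform\<close>

lemma sol_times_integrable:
  assumes meas: "p \<in> borel_measurable borel" and bd: "\<And>z. norm (p z) \<le> C * (wt z)\<^sup>2"
  shows "integrable lborel (\<lambda>z. EI quot z * p z)" "integrable lborel (\<lambda>z. O2.osc blend z * (of_real (fst z) * p z))"
    "integrable lborel (\<lambda>z. sol z * p z)"
proof -
  show 1: "integrable lborel (\<lambda>z. EI quot z * p z)"
    by (rule integrable_bounded_times[where C = "4 * W\<^sub>0\<^sup>2 * B"])
      (use O1.smooth_on_osc[OF amp_quot] norm_EI_square_le[OF norm_quot_le quot_zero] integrable_wt2_bound[OF assms] in \<open>auto simp: O1_osc\<close>)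
  show 2: "integrable lborel (\<lambda>z. O2.osc blend z * (of_real (fst z) * p z))"
    by (rule integrable_bounded_times[where C = "4 * W\<^sub>0\<^sup>2 * B"])
      (use O2.smooth_on_osc[OF amp_blend] norm_osc_blend_le integrable_wt2_bound[OF assms] in auto)
  have "(\<lambda>z. sol z * p z) = (\<lambda>z. EI quot z * p z + O2.osc blend z * (of_real (fst z) * p z))"
    by (simp add: sol_def fun_eq_iff algebra_simps)
  then show "integrable lborel (\<lambda>z. sol z * p z)" using 1 2 by simp
qed

lemma tempered_fun_sol: "tempered_fun sol"
  unfolding tempered_fun_def
proof
  show int: "\<forall>\<phi>\<in>schwartz. integrable lborel (\<lambda>z. sol z * \<phi> z)"
    using sol_times_integrable(3)[OF schwartz_measurable schwartz_wt2] by blast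
  show "tempered (dist_of_fun sol)"
  proof (rule temperedI[where C = "8 * W\<^sub>0\<^sup>2 * B * (\<integral>z. wt z \<partial>lborel)"])
    fix \<phi> \<psi> :: "real \<times> real \<Rightarrow> complex" and a b assume p: "\<phi> \<in> schwartz" "\<psi> \<in> schwartz"
    have "dist_of_fun sol (\<lambda>z. a * \<phi> z + b * \<psi> z) = (\<integral>z. a * (sol z * \<phi> z) + b * (sol z * \<psi> z) \<partial>lborel)"
      by (simp add: dist_of_fun_def algebra_simps)
    also have "\<dots> = a * dist_of_fun sol \<phi> + b * dist_of_fun sol \<psi>"
      unfolding dist_of_fun_def using int p by simp
    finally show "dist_of_fun sol (\<lambda>z. a * \<phi> z + b * \<psi> z) = a * dist_of_fun sol \<phi> + b * dist_of_fun sol \<psi>" .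
  next
    fix \<phi> :: "real \<times> real \<Rightarrow> complex" assume p: "\<phi> \<in> schwartz"
    let ?C = "4 * W\<^sub>0\<^sup>2 * B" and ?s = "schwartz_norm (0, 0) \<phi>"
    have s0: "0 \<le> ?s" "0 \<le> schwartz_norm (1, 0) \<phi>" using p by (auto intro: schwartz_norm_nonneg)
    have "norm (dist_of_fun sol \<phi>) \<le> (\<integral>z. (?C * ?s * 2) * wt z \<partial>lborel)"
      unfolding dist_of_fun_def
    proof (rule norm_integral_le)
      fix z
      \<comment> \<open>One factor \<open>wt\<close> absorbs the linear growth and the other remains
        for integrability; each summand of \<open>1 + |x|\<close> contributes \<open>1\<close> to
        the factor \<open>2\<close>.\<close>
      have x: "(1 + \<bar>fst z\<bar>) * (wt z)\<^sup>2 \<le> 2 * wt z"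
      proof -
        have "\<bar>fst z\<bar> \<le> 1 + (fst z)\<^sup>2" using zero_le_power2[of "\<bar>fst z\<bar> - 1"] by (simp add: power2_eq_square algebra_simps)
        then have "\<bar>fst z\<bar> * wt z \<le> (1 + (fst z)\<^sup>2) * wt z" using wt_pos[of z] by (intro mult_right_mono) auto
        also have "\<dots> = 1 / (1 + (snd z)\<^sup>2)"
        proof -
          have "1 + (fst z)\<^sup>2 \<noteq> 0" by (metis add_pos_nonneg less_irrefl zero_le_power2 zero_less_one)
          then show ?thesis by (simp add: wt_def)
        qed
        also have "\<dots> \<le> 1" by (subst divide_le_eq_1_pos) (simp_all add: add_pos_nonneg)
        finally have "(1 + \<bar>fst z\<bar>) * wt z \<le> 2" using wt_le_1[of z] by (simp add: distrib_right)
        then have "((1 + \<bar>fst z\<bar>) * wt z) * wt z \<le> 2 * wt z" using wt_pos[of z] by (intro mult_right_mono) auto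
        then show ?thesis by (simp add: power2_eq_square mult.assoc)
      qed
      have "norm (sol z * \<phi> z) \<le> (?C * (1 + \<bar>fst z\<bar>)) * (?s * (wt z)\<^sup>2)"
        unfolding norm_mult using norm_sol_le[of z] schwartz_wt2[OF p, of z] B by (intro mult_mono) auto
      also have "\<dots> = (?C * ?s) * ((1 + \<bar>fst z\<bar>) * (wt z)\<^sup>2)" by (simp only: mult_ac)
      also have "\<dots> \<le> (?C * ?s) * (2 * wt z)" using x B s0 by (intro mult_left_mono) auto
      finally show "norm (sol z * \<phi> z) \<le> (?C * ?s * 2) * wt z" by (simp only: mult_ac)
    qed (use integrable_wt in auto)
    also have "\<dots> = 8 * W\<^sub>0\<^sup>2 * B * (\<integral>z. wt z \<partial>lborel) * ?s" by simp
    also have "\<dots> \<le> 8 * W\<^sub>0\<^sup>2 * B * (\<integral>z. wt z \<partial>lborel) * (?s + schwartz_norm (1, 0) \<phi>)"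
      using s0 B wt_pos by (intro mult_left_mono) (auto intro!: mult_nonneg_nonneg integral_nonneg simp: less_imp_le)
    finally show "norm (dist_of_fun sol \<phi>) \<le> \<dots>" .
  qed
qed

text \<open>Fubini turns the two oscillatory integrals into weighted integrals of
  \<open>\<phi>\<close> and of its \<open>x\<close>-derivative, the latter because of the factor
  \<open>x\<close>. Order and support of the transform are read off from this formula.\<close>

lemma fourier_dist_sol:
  assumes p: "\<phi> \<in> schwartz"
  shows "fourier_dist (dist_of_fun sol) \<phi> =
    (\<integral>v. quot v * \<phi> v \<partial>lborel) + (\<integral>t. blend t * (- \<i> * partial_x UNIV \<phi> (phase t, snd (snd t))) \<partial>LB)"
proof -
  obtain C where C: "\<And>z. norm (fourier \<phi> z) \<le> C * (wt z)\<^sup>2" using fourier_schwartz_decay[OF p] by blast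
  note m = fourier_schwartz_measurable[OF p]
  note int = sol_times_integrable[OF m C]
  have x: "EI (\<lambda>z. of_real (fst z) * fourier \<phi> z) v = - \<i> * partial_x UNIV \<phi> v" for v
  proof -
    have "partial_x UNIV \<phi> v = \<i> * EI (\<lambda>z. of_real (fst z) * fourier \<phi> z) v"
      unfolding schwartz_inversion_partial_x[OF p, symmetric] EI_def by (simp add: mult.assoc flip: integral_mult_right_zero)
    then show ?thesis by (simp flip: mult.assoc)
  qed
  have "fourier_dist (dist_of_fun sol) \<phi> = (\<integral>z. EI quot z * fourier \<phi> z + O2.osc blend z * (of_real (fst z) * fourier \<phi> z) \<partial>lborel)"
    by (simp add: fourier_dist_def dist_of_fun_def sol_def algebra_simps)
  also have "\<dots> = (\<integral>z. O1.osc quot z * fourier \<phi> z \<partial>lborel) + (\<integral>z. O2.osc blend z * (of_real (fst z) * fourier \<phi> z) \<partial>lborel)"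
    unfolding O1_osc using int by simp
  also have "(\<integral>z. O1.osc quot z * fourier \<phi> z \<partial>lborel) = (\<integral>v. quot v * EI (fourier \<phi>) (fst v, snd v) \<partial>lborel)"
    by (rule O1.osc_swap[OF _ amp_quot integrable_wt2_bound(1)[OF m C]]) (rule lborel.sigma_finite_measure_axioms)
  also have "(\<integral>z. O2.osc blend z * (of_real (fst z) * fourier \<phi> z) \<partial>lborel) =
      (\<integral>t. blend t * EI (\<lambda>z. of_real (fst z) * fourier \<phi> z) (phase t, snd (snd t)) \<partial>LB)"
    by (rule O2.osc_swap[OF sigma_finite_LB amp_blend integrable_wt2_bound(4)[OF m C]])
  finally show ?thesis by (simp add: x schwartz_inversion[OF p])
qed

text \<open>One estimate serves both for temperedness, with global seminorms, and for the order,
  with suprema over a compact set containing the support.\<close>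

lemma norm_fourier_dist_sol_le:
  assumes p: "\<phi> \<in> schwartz" and "\<And>v. norm (\<phi> v) \<le> c0" "\<And>v. norm (partial_x UNIV \<phi> v) \<le> c1"
  shows "norm (fourier_dist (dist_of_fun sol) \<phi>) \<le> 4 * W\<^sub>0\<^sup>2 * B * (c0 + c1)"
proof -
  have c: "0 \<le> c0" "0 \<le> c1" using assms(2,3) order_trans[OF norm_ge_zero] by blast+
  have "norm (\<integral>v. quot v * \<phi> v \<partial>lborel) \<le> 4 * W\<^sub>0\<^sup>2 * (B * c0)"
    by (rule norm_integral_square_le)
      (use W0 quot_zero mult_mono[OF norm_quot_le assms(2) B norm_ge_zero] in \<open>auto simp: norm_mult\<close>)
  moreover have "norm (\<integral>t. blend t * (- \<i> * partial_x UNIV \<phi> (phase t, snd (snd t))) \<partial>LB) \<le> (\<integral>t. norm (blend t) * c1 \<partial>LB)"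
    by (rule norm_integral_le) (use integrable_blend assms(3) in \<open>auto simp: norm_mult intro!: mult_left_mono\<close>)
  moreover have "(\<integral>t. norm (blend t) * c1 \<partial>LB) \<le> 4 * W\<^sub>0\<^sup>2 * B * c1"
    using mult_right_mono[OF integral_norm_blend c(2)] by simp
  moreover have "norm (fourier_dist (dist_of_fun sol) \<phi>) \<le>
    norm (\<integral>v. quot v * \<phi> v \<partial>lborel) + norm (\<integral>t. blend t * (- \<i> * partial_x UNIV \<phi> (phase t, snd (snd t))) \<partial>LB)"
    unfolding fourier_dist_sol[OF p] by (rule norm_triangle_ineq)
  ultimately show ?thesis by (simp add: algebra_simps)
qed

lemma tempered_fourier_sol: "tempered (fourier_dist (dist_of_fun sol))"
proof (rule temperedI)
  fix \<phi> \<psi> :: "real \<times> real \<Rightarrow> complex" and a b assume p: "\<phi> \<in> schwartz" "\<psi> \<in> schwartz"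
  have int: "integrable lborel (\<lambda>z. sol z * fourier \<phi> z)" if "\<phi> \<in> schwartz" for \<phi>
    using fourier_schwartz_decay[OF that] sol_times_integrable(3)[OF fourier_schwartz_measurable[OF that]] by metis
  have "fourier_dist (dist_of_fun sol) (\<lambda>z. a * \<phi> z + b * \<psi> z) = (\<integral>z. a * (sol z * fourier \<phi> z) + b * (sol z * fourier \<psi> z) \<partial>lborel)"
    by (simp add: fourier_dist_def dist_of_fun_def fourier_lincomb[OF p] algebra_simps)
  also have "\<dots> = a * fourier_dist (dist_of_fun sol) \<phi> + b * fourier_dist (dist_of_fun sol) \<psi>"
    unfolding fourier_dist_def dist_of_fun_def using int p by simp
  finally show "fourier_dist (dist_of_fun sol) (\<lambda>z. a * \<phi> z + b * \<psi> z) = a * fourier_dist (dist_of_fun sol) \<phi> + b * fourier_dist (dist_of_fun sol) \<psi>" .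
next
  fix \<phi> :: "real \<times> real \<Rightarrow> complex" assume p: "\<phi> \<in> schwartz"
  show "norm (fourier_dist (dist_of_fun sol) \<phi>) \<le> 4 * W\<^sub>0\<^sup>2 * B * (schwartz_norm (0, 0) \<phi> + schwartz_norm (1, 0) \<phi>)"
    by (rule norm_fourier_dist_sol_le[OF p]) (use schwartz_norm_le[OF p, of "(0, 0)"] schwartz_norm_le[OF p, of "(1, 0)"] in auto)
qed

lemma order_fourier_sol: "order_at_most (fourier_dist (dist_of_fun sol)) 1"
  unfolding order_at_most_def
proof (intro conjI allI impI tempered_fourier_sol)
  fix K :: "(real \<times> real) set" assume K: "compact K"
  let ?N = "\<lambda>\<phi>. SUP \<alpha>\<in>{\<alpha>. fst \<alpha> + snd \<alpha> \<le> 1}. sup_norm K (deriv_multi \<alpha> \<phi>)"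
  show "\<exists>M. \<forall>\<phi>\<in>schwartz. fun_support \<phi> \<subseteq> K \<longrightarrow> norm (fourier_dist (dist_of_fun sol) \<phi>) \<le> M * ?N \<phi>"
  \<comment> \<open>Suprema over the empty set are unspecified, so this case is treated apart: the
    test function vanishes identically and \<open>M = 0\<close> works.\<close>
  proof (cases "K = {}")
    case True
    have "norm (fourier_dist (dist_of_fun sol) \<phi>) \<le> 4 * W\<^sub>0\<^sup>2 * B * (0 + 0)" if "\<phi> \<in> schwartz" "fun_support \<phi> \<subseteq> K" for \<phi>
      by (rule norm_fourier_dist_sol_le[OF that(1)]) (use True fun_support_subset[OF that(2)] partial_x_off_support[OF that(2)] in auto)
    then show ?thesis by (intro exI[of _ 0]) auto
  next
    case False
    show ?thesis
    proof (intro exI ballI impI)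
      fix \<phi> assume p: "\<phi> \<in> schwartz" and s: "fun_support \<phi> \<subseteq> K"
      have fin: "finite {\<alpha>. fst \<alpha> + snd \<alpha> \<le> (1::nat)}"
        by (rule finite_subset[of _ "{..1} \<times> {..1}"]) auto
      have b: "norm (deriv_multi \<alpha> \<phi> v) \<le> ?N \<phi>" if "v \<in> K" "fst \<alpha> + snd \<alpha> \<le> 1" for \<alpha> v
      proof -
        have "continuous_on K (deriv_multi \<alpha> \<phi>)"
          using continuous_on_subset[OF smooth_on_continuous_on[OF smooth_on_deriv_multi[OF schwartz_smooth[OF p]]]] by blast
        then have "bounded (deriv_multi \<alpha> \<phi> ` K)" using K by (intro compact_imp_bounded compact_continuous_image)
        then have "norm (deriv_multi \<alpha> \<phi> v) \<le> sup_norm K (deriv_multi \<alpha> \<phi>)" using that(1) by (rule norm_le_sup_norm)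
        also have "\<dots> \<le> ?N \<phi>" using that(2) fin by (intro cSUP_upper bdd_above_finite) auto
        finally show ?thesis .
      qed
      have N0: "0 \<le> ?N \<phi>" using False order_trans[OF norm_ge_zero b[of _ "(0, 0)"]] by auto
      have "norm (fourier_dist (dist_of_fun sol) \<phi>) \<le> 4 * W\<^sub>0\<^sup>2 * B * (?N \<phi> + ?N \<phi>)"
      proof (rule norm_fourier_dist_sol_le[OF p])
        show "norm (\<phi> v) \<le> ?N \<phi>" for v
          using b[of v "(0, 0)"] fun_support_subset[OF s, of v] N0 by (cases "v \<in> K") auto
        show "norm (partial_x UNIV \<phi> v) \<le> ?N \<phi>" for v
          using b[of v "(1, 0)"] partial_x_off_support[OF s, of v] N0 by (cases "v \<in> K") auto
      qed
      then show "norm (fourier_dist (dist_of_fun sol) \<phi>) \<le> (8 * W\<^sub>0\<^sup>2 * B) * ?N \<phi>" by simp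
    qed
  qed
qed

text \<open>Off the band \<open>quot\<close> vanishes, and the derivative of \<open>\<phi>\<close>
  is evaluated at points of the band wherever the density \<open>blend\<close> is nonzero.\<close>

lemma support_fourier_sol: "dist_support (fourier_dist (dist_of_fun sol)) \<subseteq> square W\<^sub>0"
proof -
  have "fourier_dist (dist_of_fun sol) \<phi> = 0" if p: "\<phi> \<in> schwartz" and s: "fun_support \<phi> \<subseteq> - square W\<^sub>0" for \<phi>
  proof -
    have "(\<lambda>v. quot v * \<phi> v) = (\<lambda>_. 0)" using fun_support_subset[OF s] quot_zero by fastforce
    moreover have "blend t * (- \<i> * partial_x UNIV \<phi> (phase t, snd (snd t))) = 0" for t
      using partial_x_off_support[OF s, of "(phase t, snd (snd t))"] blend_support(5)[of t] by auto
    ultimately show ?thesis unfolding fourier_dist_sol[OF p] by (simp only: integral_zero Bochner_Integration.integral_zero add_0)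
  qed
  moreover have "open (- square W\<^sub>0)" by (simp add: closed_square open_Compl)
  ultimately have "- square W\<^sub>0 \<subseteq> \<Union> {U. open U \<and> (\<forall>\<phi>\<in>schwartz. compact (fun_support \<phi>) \<and> fun_support \<phi> \<subseteq> U \<longrightarrow> fourier_dist (dist_of_fun sol) \<phi> = 0)}"
    by (intro Union_upper) auto
  then show ?thesis unfolding dist_support_def by auto
qed

text \<open>Splitting at \<open>2 * W\<^sub>0\<close> keeps the constant free of \<open>W\<close>:
  below, \<open>min 1 (1 / W)\<close> is bounded from below in terms of \<open>W\<^sub>0\<close> and
  the uniform bounds suffice; above, the quotient itself decays like \<open>1 / W\<close>. The
  polynomial in \<open>W\<^sub>0\<close> is chosen large enough to dominate both cases.\<close>

lemma sol_bounds:
  assumes x: "\<bar>fst z\<bar> \<le> 1"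
  shows "norm (sol z) \<le> (1 + 2 * W\<^sub>0) * (12 * W\<^sub>0\<^sup>2 + 24 * W\<^sub>0 ^ 3) * min 1 (1 / W) * B"
    and "norm (partial_x UNIV sol z) \<le> (1 + 2 * W\<^sub>0) * (12 * W\<^sub>0\<^sup>2 + 24 * W\<^sub>0 ^ 3) * min 1 (1 / W) * B"
proof -
  let ?m = "min 1 (1 / W)" and ?c = "12 * W\<^sub>0\<^sup>2 + 24 * W\<^sub>0 ^ 3"
  have m0: "0 \<le> ?m" using W by simp
  have "norm (sol z) \<le> (1 + 2 * W\<^sub>0) * ?c * ?m * B \<and> norm (partial_x UNIV sol z) \<le> (1 + 2 * W\<^sub>0) * ?c * ?m * B"
  proof (cases "W < 2 * W\<^sub>0")
    case True
    \<comment> \<open>Either the minimum is \<open>1\<close>, or it is \<open>1 / W\<close>, which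
      exceeds \<open>1 / (2 * W\<^sub>0)\<close>.\<close>
    have "1 \<le> (1 + 2 * W\<^sub>0) * ?m" using W W0 True by (auto simp: min_def field_simps)
    then have fin: "?c * B \<le> (1 + 2 * W\<^sub>0) * ?c * ?m * B"
      using mult_right_mono[of 1 "(1 + 2 * W\<^sub>0) * ?m" "?c * B"] W0 B by (simp add: mult_ac)
    have s: "norm (sol z) \<le> 8 * W\<^sub>0\<^sup>2 * B"
    proof -
      have "4 * W\<^sub>0\<^sup>2 * B * (1 + \<bar>fst z\<bar>) \<le> 4 * W\<^sub>0\<^sup>2 * B * 2" using x B by (intro mult_left_mono) auto
      from order_trans[OF norm_sol_le this] show ?thesis by simp
    qed
    \<comment> \<open>The equation trades the derivative for \<open>W\<close> times the solution,
      affordable because \<open>W < 2 * W\<^sub>0\<close>.\<close>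
    have "partial_x UNIV sol z = EI k z - \<i> * of_real W * sol z" using sol_ode[of z] by (simp add: eq_diff_eq)
    then have "norm (partial_x UNIV sol z) \<le> norm (EI k z) + W * norm (sol z)"
      using norm_triangle_ineq4[of "EI k z" "\<i> * of_real W * sol z"] W by (simp add: norm_mult)
    also have "\<dots> \<le> 4 * W\<^sub>0\<^sup>2 * B + (2 * W\<^sub>0) * (8 * W\<^sub>0\<^sup>2 * B)"
      using norm_EI_square_le[of k B z, OF k_bound k_zero] s True W by (intro add_mono mult_mono) auto
    also have "\<dots> \<le> ?c * B" using W0 B by (simp add: power2_eq_square power3_eq_cube algebra_simps)
    finally have "norm (partial_x UNIV sol z) \<le> ?c * B" .
    moreover have "8 * W\<^sub>0\<^sup>2 * B \<le> ?c * B" using W0 B by (intro mult_right_mono) auto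
    ultimately show ?thesis using s fin by linarith
  next
    case False
    then have "(- W, y) \<notin> square W\<^sub>0" for y using W0 by (auto simp: square_def)
    then have kW: "k (- W, y) = 0" for y by (rule k_zero)
    then have tr: "trace = (\<lambda>_. 0)" by (auto simp: trace_def)
    then have bl: "blend = (\<lambda>_. 0)" by (auto simp: blend_def)
    have q: "norm (quot v) \<le> 2 * B * ?m" for v
    proof (cases "v \<in> square W\<^sub>0")
      case True
      then have "W / 2 \<le> \<bar>fst v + W\<bar>" using False by (auto simp: square_def)
      moreover have "norm (quot v) = norm (k v) / \<bar>fst v + W\<bar>"
        using True by (simp add: quot_def kW norm_divide norm_mult flip: of_real_add)
      ultimately have "norm (quot v) \<le> B / (W / 2)"
        using W B k_bound[of v] by (simp only:) (intro frac_le, auto)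
      then have "norm (quot v) \<le> 2 * B * (1 / W)" by (simp add: mult.commute)
      moreover have "norm (quot v) \<le> 2 * B * 1" using norm_quot_le[of v] B by simp
      ultimately show ?thesis by (simp add: min_def)
    qed (use quot_zero B m0 in auto)
    have "norm (EI quot z) \<le> 4 * W\<^sub>0\<^sup>2 * (2 * B * ?m)" by (rule norm_EI_square_le[OF q quot_zero])
    \<comment> \<open>The equation would cost a factor \<open>W\<close> here; differentiating under
      the integral costs only \<open>\<xi>\<close>, at most \<open>W\<^sub>0\<close> in
      modulus.\<close>
    moreover have "norm (EI (\<lambda>v. \<i> * of_real (fst v) * quot v) z) \<le> 4 * W\<^sub>0\<^sup>2 * (W\<^sub>0 * (2 * B * ?m))"
    proof (rule norm_EI_square_le)
      fix v
      show "norm (\<i> * of_real (fst v) * quot v) \<le> W\<^sub>0 * (2 * B * ?m)"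
        unfolding norm_mult using q[of v] square_abs_le[of v W\<^sub>0] quot_zero[of v] W0 B m0
        by (cases "v \<in> square W\<^sub>0") (auto intro!: mult_mono)
    qed (simp add: quot_zero)
    moreover have "sol z = EI quot z" "partial_x UNIV sol z = EI (\<lambda>v. \<i> * of_real (fst v) * quot v) z"
      unfolding partial_x_sol sol_def by (simp_all add: bl O2.osc_def)
    moreover have "8 * W\<^sub>0\<^sup>2 * (?m * B) \<le> (1 + 2 * W\<^sub>0) * ?c * (?m * B)" "8 * W\<^sub>0 ^ 3 * (?m * B) \<le> (1 + 2 * W\<^sub>0) * ?c * (?m * B)"
      using W0 B m0 by (intro mult_right_mono; simp add: algebra_simps power2_eq_square power3_eq_cube)+
    ultimately show ?thesis by (simp add: power2_eq_square power3_eq_cube mult_ac)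
  qed
  then show "norm (sol z) \<le> (1 + 2 * W\<^sub>0) * ?c * ?m * B" "norm (partial_x UNIV sol z) \<le> (1 + 2 * W\<^sub>0) * ?c * ?m * B" by auto
qed

end

subsection \<open>The change of variables\<close>

lemma slice_square: "y \<in> {-1..1} \<Longrightarrow> {t. (t, y) \<in> square 1} = {-1..1}"
  by (auto simp: square_def)

lemma partial_x_square:
  assumes "(x, y) \<in> square 1" "((\<lambda>t. f (t, y)) has_vector_derivative d) (at x within {-1..1})"
  shows "partial_x (square 1) f (x, y) = d"
proof -
  have "x \<in> {-1..1}" "y \<in> {-1..1}" using assms(1) by (auto simp: square_def)
  then show ?thesis
    using assms(2) vector_derivative_within_cbox[of "-1" 1 x "\<lambda>t. f (t, y)" d]
    by (simp add: partial_x_def slice_square cbox_interval)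
qed

lemma square_eq_cbox: "square 1 = cbox (-1, -1) (1, 1)"
  by (simp add: square_def cbox_Pair_eq)

locale phase_function =
  fixes g G :: "real \<times> real \<Rightarrow> real" and V :: "(real \<times> real) set"
  assumes smooth_ext: "smooth_extension (square 1) g V G" and nz: "\<And>z. z \<in> V \<Longrightarrow> partial_x V G z \<noteq> 0"
begin

lemma open_V: "open V" and square_V: "square 1 \<subseteq> V" and smooth_G: "smooth_on V G" and G_eq: "z \<in> square 1 \<Longrightarrow> G z = g z"
  using smooth_ext by (auto simp: smooth_extension_def)

abbreviation "Gx \<equiv> partial_x V G"
abbreviation "Gy \<equiv> partial_y V G"

text \<open>Horizontal slices of \<open>V\<close> may be disconnected. In a box around the square
  they are intervals reaching the left edge \<open>x = - 1\<close>, as required for the mean value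
  theorem and for the values of \<open>G\<close> at that edge.\<close>

definition box_at :: "real \<Rightarrow> (real \<times> real) set" where
  "box_at \<delta> = {-1 - \<delta><..<1 + \<delta>} \<times> {-1 - \<delta><..<1 + \<delta>}"

lemma box_exists: "\<exists>\<delta>>0. box_at \<delta> \<subseteq> V"
proof -
  obtain e where e: "0 < e" "(\<Union>x\<in>square 1. ball x e) \<subseteq> V"
    using compact_subset_open_imp_ball_epsilon_subset[OF compact_square open_V square_V] by blast
  have "box_at (e / 2) \<subseteq> V"
  proof
    fix z assume z: "z \<in> box_at (e / 2)"
    obtain x y where xy: "z = (x, y)" by (cases z)
    \<comment> \<open>Clamping both coordinates gives a point of the square close to
      \<open>z\<close>.\<close>
    define c where "c t = max (- 1) (min 1 t)" for t :: real
    have c: "c t \<in> {-1..1}" for t by (auto simp: c_def)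
    have d: "\<bar>c x - x\<bar> < e / 2" "\<bar>c y - y\<bar> < e / 2"
      using z e(1) unfolding xy box_at_def c_def by (auto simp: max_def min_def abs_if)
    have "dist (c x, c y) z \<le> \<bar>c x - x\<bar> + \<bar>c y - y\<bar>"
      unfolding xy dist_Pair_Pair dist_real_def by (rule sqrt_sum_squares_le_sum) auto
    then have "z \<in> ball (c x, c y) e" using d by simp
    moreover have "(c x, c y) \<in> square 1" using c by (auto simp: square_def)
    ultimately show "z \<in> V" using e(2) by blast
  qed
  then show ?thesis using e(1) by (intro exI[of _ "e / 2"]) auto
qed

definition \<delta> where "\<delta> = (SOME \<delta>. 0 < \<delta> \<and> box_at \<delta> \<subseteq> V)"
definition "D = box_at \<delta>"

lemma \<delta>: "0 < \<delta>" "D \<subseteq> V"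
  unfolding D_def \<delta>_def by (rule someI2_ex[OF box_exists]; simp)+

lemma open_D: "open D" unfolding D_def box_at_def by (intro open_Times open_greaterThanLessThan)

lemma square_D: "square 1 \<subseteq> D" using \<delta>(1) by (auto simp: D_def box_at_def square_def)

lemma D_convex: "(x, y) \<in> D \<Longrightarrow> (x', y) \<in> D \<Longrightarrow> x \<le> t \<Longrightarrow> t \<le> x' \<Longrightarrow> (t, y) \<in> D"
  by (auto simp: D_def box_at_def)

lemma D_edge: "(x, y) \<in> D \<Longrightarrow> (- 1, y) \<in> D" using \<delta>(1) by (auto simp: D_def box_at_def)

lemma G_has_derivative: "z \<in> V \<Longrightarrow> (G has_derivative grad_map (Gx z) (Gy z)) (at z)"
  by (rule smooth_on_has_derivative[OF open_V _ smooth_G])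

lemma G_slice: "(x, y) \<in> V \<Longrightarrow> ((\<lambda>t. G (t, y)) has_real_derivative Gx (x, y)) (at x)"
  using has_derivative_slice_x[OF G_has_derivative, of x y] by (simp add: has_real_derivative_iff_has_vector_derivative)

lemma g_x_eq:
  assumes "z \<in> square 1"
  shows "g_x g z = Gx z"
proof -
  obtain x y where z: "z = (x, y)" by (cases z)
  have "((\<lambda>t. g (t, y)) has_vector_derivative Gx (x, y)) (at x within {-1..1})"
  proof (rule has_vector_derivative_transform[where f = "\<lambda>t. G (t, y)"])
    show "((\<lambda>t. G (t, y)) has_vector_derivative Gx (x, y)) (at x within {-1..1})"
      using G_slice[of x y] assms z square_V by (auto simp: has_real_derivative_iff_has_vector_derivative intro: has_vector_derivative_at_within)
  qed (use assms z G_eq in \<open>auto simp: square_def\<close>)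
  then show ?thesis using assms unfolding z g_x_def by (intro partial_x_square) auto
qed

lemma continuous_on_Gx: "continuous_on V Gx"
  by (intro smooth_on_continuous_on smooth_on_partials smooth_G)

lemma square_nonempty: "square 1 \<noteq> {}" by (auto simp: square_def)

lemma bounded_g_x: "bounded ((\<lambda>z. \<bar>g_x g z\<bar>) ` square 1)"
proof -
  have "continuous_on (square 1) (\<lambda>z. \<bar>Gx z\<bar>)"
    using continuous_on_subset[OF continuous_on_Gx square_V] by (intro continuous_intros)
  then have "bounded ((\<lambda>z. \<bar>Gx z\<bar>) ` square 1)"
    by (intro compact_imp_bounded compact_continuous_image compact_square)
  then show ?thesis by (simp add: g_x_eq cong: image_cong)
qed

lemma G_max_ge: "z \<in> square 1 \<Longrightarrow> \<bar>Gx z\<bar> \<le> G_max g"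
  unfolding G_max_def using bounded_g_x g_x_eq cSUP_upper[of z "square 1" "\<lambda>z. \<bar>g_x g z\<bar>"] bounded_imp_bdd_above by fastforce

lemma G_min_le: "z \<in> square 1 \<Longrightarrow> G_min g \<le> \<bar>Gx z\<bar>"
  unfolding G_min_def using bounded_g_x g_x_eq cINF_lower[of "\<lambda>z. \<bar>g_x g z\<bar>" "square 1" z] bounded_imp_bdd_below by fastforce

lemma G_min_pos: "0 < G_min g"
proof -
  have "continuous_on (square 1) (\<lambda>z. \<bar>Gx z\<bar>)"
    using continuous_on_subset[OF continuous_on_Gx square_V] by (intro continuous_intros)
  then obtain z0 where z0: "z0 \<in> square 1" "\<And>z. z \<in> square 1 \<Longrightarrow> \<bar>Gx z0\<bar> \<le> \<bar>Gx z\<bar>"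
    using continuous_attains_inf[OF compact_square square_nonempty] by blast
  have "\<bar>Gx z0\<bar> \<le> G_min g"
    unfolding G_min_def using z0 g_x_eq by (intro cINF_greatest square_nonempty) auto
  moreover have "0 < \<bar>Gx z0\<bar>" using nz[of z0] z0(1) square_V by auto
  ultimately show ?thesis by linarith
qed

text \<open>The integral of \<open>g_x\<close> from \<open>- 1\<close>, continued beyond the square
  through the extension \<open>G\<close>, so that the change of variables is differentiable on an
  open set.\<close>

definition \<Phi> where "\<Phi> z = G z - G (- 1, snd z)"

lemma integral_g_x:
  assumes "(x, y) \<in> square 1"
  shows "integral {- 1..x} (\<lambda>t. g_x g (t, y)) = \<Phi> (x, y)"
proof -
  have sq: "(t, y) \<in> square 1" if "t \<in> {- 1..x}" for t using assms that by (auto simp: square_def)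
  have "((\<lambda>t. g_x g (t, y)) has_integral (G (x, y) - G (- 1, y))) {- 1..x}"
  proof (rule fundamental_theorem_of_calculus)
    show "- 1 \<le> x" using assms by (auto simp: square_def)
    fix t assume t: "t \<in> {- 1..x}"
    then have "(t, y) \<in> V" using sq square_V by blast
    then show "((\<lambda>t. G (t, y)) has_vector_derivative g_x g (t, y)) (at t within {- 1..x})"
      using G_slice[of t y] g_x_eq[OF sq[OF t]]
      by (simp add: has_real_derivative_iff_has_vector_derivative has_vector_derivative_at_within)
  qed
  then show ?thesis by (simp add: integral_unique \<Phi>_def)
qed

lemma \<Phi>_slice: "(x, y) \<in> D \<Longrightarrow> ((\<lambda>t. \<Phi> (t, y)) has_real_derivative Gx (x, y)) (at x)"
  unfolding \<Phi>_def using G_slice[of x y] \<delta>(2) by (auto intro!: derivative_eq_intros)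

lemma \<Phi>_inj:
  assumes "(x, y) \<in> D" "(x', y) \<in> D" "\<Phi> (x, y) = \<Phi> (x', y)"
  shows "x = x'"
proof (rule ccontr)
  assume "x \<noteq> x'"
  have *: False if ab: "a < b" "(a, y) \<in> D" "(b, y) \<in> D" "\<Phi> (a, y) = \<Phi> (b, y)" for a b
  proof -
    have d: "((\<lambda>t. \<Phi> (t, y)) has_real_derivative Gx (t, y)) (at t)" if "a \<le> t" "t \<le> b" for t
      using \<Phi>_slice D_convex[OF \<open>(a, y) \<in> D\<close> \<open>(b, y) \<in> D\<close>] that by blast
    obtain t where t: "a < t" "t < b" "\<Phi> (b, y) - \<Phi> (a, y) = (b - a) * Gx (t, y)"
      using MVT2[OF ab(1), of "\<lambda>t. \<Phi> (t, y)" "\<lambda>t. Gx (t, y)"] d by blast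
    then have "Gx (t, y) = 0" using ab by simp
    moreover have "(t, y) \<in> V" using D_convex[OF ab(2,3)] t \<delta>(2) by force
    ultimately show False using nz by blast
  qed
  then show False using \<open>x \<noteq> x'\<close> assms by (metis linorder_neqE_linordered_idom)
qed

lemma \<Phi>_edge [simp]: "\<Phi> (- 1, y) = 0" by (simp add: \<Phi>_def)

lemma continuous_on_\<Phi>: "continuous_on D \<Phi>"
  unfolding \<Phi>_def
proof (intro continuous_on_diff)
  show "continuous_on D G" using smooth_on_continuous_on[OF smooth_G] \<delta>(2) by (rule continuous_on_subset)
  show "continuous_on D (\<lambda>z. G (- 1, snd z))"
    by (rule continuous_on_compose2[OF \<open>continuous_on D G\<close>]) (auto intro!: continuous_intros D_edge)
qed

text \<open>Along a horizontal line \<open>\<Phi>\<close> starts from \<open>0\<close> at the left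
  edge and is strictly monotone, in either direction, so its modulus is largest at the right edge.
  The definition of \<open>W\<close> looks at that edge only.\<close>

lemma abs_\<Phi>_le:
  assumes "(x, y) \<in> square 1"
  shows "\<bar>\<Phi> (x, y)\<bar> \<le> \<bar>\<Phi> (1, y)\<bar>"
proof (cases "x = - 1 \<or> x = 1")
  case False
  then have x: "- 1 < x" "x < 1" using assms by (auto simp: square_def)
  have sl: "(t, y) \<in> D" if "t \<in> {- 1..1}" for t using assms that square_D by (auto simp: square_def)
  have "continuous_on {- 1..1} (\<lambda>t. \<Phi> (t, y))"
    by (rule continuous_on_compose2[OF continuous_on_\<Phi>]) (use sl in \<open>auto intro!: continuous_intros\<close>)
  moreover have "inj_on (\<lambda>t. \<Phi> (t, y)) {- 1..1}"
    using \<Phi>_inj sl by (intro inj_onI) blast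
  ultimately have "(\<Phi> (- 1, y) < \<Phi> (x, y) \<and> \<Phi> (x, y) < \<Phi> (1, y)) \<or> (\<Phi> (1, y) < \<Phi> (x, y) \<and> \<Phi> (x, y) < \<Phi> (- 1, y))"
    by (rule continuous_inj_imp_mono[OF x, where f = "\<lambda>t. \<Phi> (t, y)"])
  then show ?thesis by auto
qed auto

abbreviation "W \<equiv> W_of g"

lemma W_ge:
  assumes "(x, y) \<in> square 1"
  shows "\<bar>\<Phi> (x, y)\<bar> \<le> W"
proof -
  have y: "y \<in> {-1..1}" and sq: "(1, y) \<in> square 1" if "y \<in> {-1..1}" for y
    using assms that by (auto simp: square_def)
  have eq: "\<bar>integral {- 1..1} (\<lambda>x. g_x g (x, y))\<bar> = \<bar>\<Phi> (1, y)\<bar>" if "y \<in> {-1..1}" for y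
    using integral_g_x[OF sq[OF that]] by simp
  have "continuous_on {-1..1} (\<lambda>y. \<bar>\<Phi> (1, y)\<bar>)"
    by (intro continuous_on_rabs continuous_on_compose2[OF continuous_on_\<Phi>]) (use sq square_D in \<open>auto intro!: continuous_intros\<close>)
  then have "bounded ((\<lambda>y. \<bar>\<Phi> (1, y)\<bar>) ` {-1..1})"
    by (intro compact_imp_bounded compact_continuous_image) auto
  then have "bdd_above ((\<lambda>y. \<bar>integral {- 1..1} (\<lambda>x. g_x g (x, y))\<bar>) ` {-1..1})"
    using eq by (metis (mono_tags, lifting) bounded_imp_bdd_above image_cong)
  then have "\<bar>integral {- 1..1} (\<lambda>x. g_x g (x, y))\<bar> \<le> W"
    unfolding W_of_def using y assms by (intro cSUP_upper) (auto simp: square_def)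
  then show ?thesis using abs_\<Phi>_le[OF assms] eq assms by (auto simp: square_def)
qed

lemma W_pos: "0 < W"
proof -
  have sq: "(1, 0) \<in> square 1" "(- 1, 0) \<in> square 1" by (auto simp: square_def)
  have "\<Phi> (1, 0) \<noteq> \<Phi> (- 1, 0)" using \<Phi>_inj[of 1 0 "- 1"] sq square_D by auto
  then show ?thesis using W_ge[OF sq(1)] by auto
qed

definition U where "U z = (\<Phi> z / W, snd z)"

lemma u_map_eq: "z \<in> square 1 \<Longrightarrow> u_map g z = U z"
  by (cases z) (simp add: u_map_def U_def integral_g_x)

lemma U_inj: "inj_on U D"
proof (rule inj_onI)
  fix z z' assume z: "z \<in> D" "z' \<in> D" "U z = U z'"
  obtain x y x' y' where xy: "z = (x, y)" "z' = (x', y')" by (metis surj_pair)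
  have "y = y'" "\<Phi> (x, y) = \<Phi> (x', y')" using z(3) W_pos by (auto simp: U_def xy)
  then show "z = z'" using \<Phi>_inj z xy by blast
qed

lemma \<Phi>_has_derivative:
  assumes "z \<in> D"
  shows "(\<Phi> has_derivative grad_map (Gx z) (Gy z - Gy (- 1, snd z))) (at z)"
proof -
  have e: "(- 1, snd z) \<in> D" using D_edge[of "fst z" "snd z"] assms by simp
  have "((\<lambda>z. G (- 1, snd z)) has_derivative (\<lambda>d. grad_map (Gx (- 1, snd z)) (Gy (- 1, snd z)) (0, snd d))) (at z)"
    by (rule has_derivative_compose[of "\<lambda>z. (- 1, snd z)" "\<lambda>d. (0, snd d)", OF _ G_has_derivative])
      (use e \<delta>(2) in \<open>auto intro!: derivative_eq_intros\<close>)
  from has_derivative_diff[OF G_has_derivative this] assms \<delta>(2)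
  show ?thesis unfolding \<Phi>_def[abs_def] by (auto simp: grad_map_def algebra_simps)
qed

section \<open>The differential of the change of variables and the inverse map\<close>

definition dU where "dU z d = (grad_map (Gx z / W) ((Gy z - Gy (- 1, snd z)) / W) d, snd d)"
definition dV where "dV z d = ((fst d - (Gy z - Gy (- 1, snd z)) / W * snd d) * (W / Gx z), snd d)"

lemma U_has_derivative: "z \<in> D \<Longrightarrow> (U has_derivative dU z) (at z)"
proof -
  assume z: "z \<in> D"
  have "(U has_derivative (\<lambda>d. (grad_map (Gx z) (Gy z - Gy (- 1, snd z)) d / W, snd d))) (at z)"
    unfolding U_def[abs_def] divide_inverse
    by (intro has_derivative_Pair has_derivative_mult_left \<Phi>_has_derivative[OF z] has_derivative_snd has_derivative_ident)
  then show ?thesis by (simp add: dU_def[abs_def] grad_map_def add_divide_distrib)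
qed

lemma dU_dV: "z \<in> V \<Longrightarrow> dU z (dV z d) = d"
  using nz[of z] W_pos by (cases d) (simp add: dU_def dV_def grad_map_def field_simps)

lemma dV_bounded_linear: "bounded_linear (dV z)"
  unfolding dV_def
  by (intro bounded_linear_Pair bounded_linear_mult_left[THEN bounded_linear_compose] bounded_linear_sub bounded_linear_fst
      bounded_linear_snd bounded_linear_mult_right[THEN bounded_linear_compose])

lemma dV_dU: "z \<in> V \<Longrightarrow> dV z (dU z d) = d"
  using nz[of z] W_pos by (cases d) (simp add: dU_def dV_def grad_map_def field_simps)

text \<open>Invariance of domain makes the image open and the inverse continuous, which the rule for
  derivatives of inverses requires; the derivative is then the explicit \<open>dV\<close>.\<close>

lemma U_inverse:
  obtains v where "homeomorphism D (U ` D) U v" "open (U ` D)"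
    "\<And>z. z \<in> U ` D \<Longrightarrow> (v has_derivative dV (v z)) (at z)"
proof -
  have cont: "continuous_on D U"
    using U_has_derivative by (intro continuous_at_imp_continuous_on ballI has_derivative_continuous) blast
  obtain v where v: "homeomorphism D (U ` D) U v"
    using invariance_of_domain_homeomorphism[OF open_D cont _ U_inj] by auto
  have o: "open (U ` D)" by (rule invariance_of_domain[OF cont open_D U_inj])
  have "(v has_derivative dV (v z)) (at z)" if z: "z \<in> U ` D" for z
  proof (rule has_derivative_inverse_basic[OF _ dV_bounded_linear _ _ o z])
    have vz: "v z \<in> D" using v z by (auto simp: homeomorphism_def)
    then show "(U has_derivative dU (v z)) (at (v z))" by (rule U_has_derivative)
    show "dV (v z) \<circ> dU (v z) = id" by (rule ext) (simp only: o_apply id_apply dV_dU[OF subsetD[OF \<delta>(2) vz]])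
    show "continuous (at z) v" using v o z by (auto simp: homeomorphism_def continuous_on_eq_continuous_at)
  qed (use v in \<open>auto simp: homeomorphism_def\<close>)
  with v o show ?thesis using that by blast
qed

text \<open>The closed square is the compact closure of the open one, so compactness of its image
  gives one inclusion and continuity the other. Points where \<open>h\<close> is considered thereby
  get preimages in the closed square.\<close>

lemma u_image: "closure (u_domain g) = u_map g ` square 1"
proof
  have cont: "continuous_on (square 1) (u_map g)"
  proof -
    have "continuous_on (square 1) U"
      using U_has_derivative square_D by (intro continuous_at_imp_continuous_on ballI has_derivative_continuous) blast
    then show ?thesis by (simp add: u_map_eq cong: continuous_on_cong)
  qed
  have sub: "{-1<..<1} \<times> {-1<..<1} \<subseteq> (square 1 :: (real \<times> real) set)" by (auto simp: square_def)
  have cl: "closure ({-1<..<1} \<times> {-1<..<1}) = (square 1 :: (real \<times> real) set)"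
    by (simp add: closure_Times square_def)
  have "compact (u_map g ` square 1)" by (intro compact_continuous_image cont compact_square)
  then show "closure (u_domain g) \<subseteq> u_map g ` square 1"
    unfolding u_domain_def using sub by (intro closure_minimal compact_imp_closed) auto
  have "u_map g ` closure ({-1<..<1} \<times> {-1<..<1}) \<subseteq> closure (u_domain g)"
    by (rule image_closure_subset) (simp_all add: cl cont u_domain_def closure_subset)
  then show "u_map g ` square 1 \<subseteq> closure (u_domain g)" by (simp only: cl)
qed

lemma u_map_inj: "inj_on (u_map g) (square 1)"
  using inj_on_subset[OF U_inj square_D] u_map_eq by (metis inj_on_cong)

lemma u_inv_map: "p \<in> square 1 \<Longrightarrow> u_inv g (u_map g p) = p"
  unfolding u_inv_def by (rule the_inv_into_f_f[OF u_map_inj])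

lemma u_image_square: "closure (u_domain g) \<subseteq> square 1"
proof -
  have "U p \<in> square 1" if "p \<in> square 1" for p
  proof -
    obtain x y where p: "p = (x, y)" by (cases p)
    have h: "\<bar>\<Phi> (x, y) / W\<bar> \<le> 1" using W_ge[of x y] that p W_pos by (simp add: abs_divide)
    then show ?thesis using that p abs_le_D1[OF h] abs_le_D2[OF h] by (auto simp: U_def square_def)
  qed
  then show ?thesis unfolding u_image using u_map_eq by auto
qed

text \<open>A derivative within the image need not be unique a priori, since near a boundary point the image may
  contain no segment in the vertical direction; pulling back along the diffeomorphism to the square
  makes it unique.\<close>

lemma jacobian_u_inv:
  assumes p: "p \<in> square 1"
  shows "jacobian_det (closure (u_domain g)) (u_inv g) (u_map g p) = W / Gx p"
proof -
  let ?S = "closure (u_domain g)"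
  obtain v where v: "homeomorphism D (U ` D) U v" "\<And>z. z \<in> U ` D \<Longrightarrow> (v has_derivative dV (v z)) (at z)"
    using U_inverse by blast
  have pD: "p \<in> D" "p \<in> V" using p square_D \<delta>(2) by auto
  have vU: "v (U q) = q" if "q \<in> D" for q using v(1) that by (auto simp: homeomorphism_def)
  have vS: "v z = u_inv g z" if "z \<in> ?S" for z
    using that u_inv_map u_map_eq vU square_D unfolding u_image by force
  have "(v has_derivative dV p) (at (U p) within ?S)"
    using v(2)[of "U p"] pD(1) vU[OF pD(1)] by (auto intro: has_derivative_at_withinI)
  then have "(u_inv g has_derivative dV p) (at (u_map g p) within ?S)"
    unfolding u_map_eq[OF p]
    by (rule has_derivative_transform[rotated 2]) (use vS imageI[OF p, of "u_map g"] u_map_eq[OF p] u_image in auto)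
  then have L: "(u_inv g has_derivative frechet_derivative (u_inv g) (at (u_map g p) within ?S)) (at (u_map g p) within ?S)"
    using frechet_derivative_works differentiableI by blast
  let ?L = "frechet_derivative (u_inv g) (at (u_map g p) within ?S)"
  have d: "(u_map g has_derivative dU p) (at p within square 1)"
    by (rule has_derivative_transform[OF p u_map_eq has_derivative_at_withinI[OF U_has_derivative[OF pD(1)]]])
  have "((u_inv g \<circ> u_map g) has_derivative ?L \<circ> dU p) (at p within square 1)"
    by (rule diff_chain_within[OF d]) (use L in \<open>simp add: u_image\<close>)
  then have "((\<lambda>q. q) has_derivative ?L \<circ> dU p) (at p within square 1)"
    by (rule has_derivative_transform[OF p, rotated]) (simp add: u_inv_map)
  moreover have "((\<lambda>q. q) has_derivative (\<lambda>d. d)) (at p within square 1)" by (rule has_derivative_ident)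
  ultimately have "?L \<circ> dU p = (\<lambda>d. d)"
    unfolding square_eq_cbox using p[unfolded square_eq_cbox]
    by (intro frechet_derivative_unique_within_closed_interval[where f = "\<lambda>q. q" and x = p and a = "(-1, -1)" and b = "(1, 1)"]) (auto simp: Basis_prod_def)
  then have "?L d = dV p d" for d
    using dU_dV[OF pD(2), of d] by (metis comp_apply)
  then have "?L = dV p" by auto
  then show ?thesis
    by (simp add: jacobian_det_def Let_def det_2 dV_def)
qed

section \<open>The right-hand side in the new variables and composition with
  \<open>U\<close>\<close>

lemma h_fun_eq: "p \<in> square 1 \<Longrightarrow> h_fun f g (u_map g p) = f p * of_real (W / Gx p)"
  by (simp add: h_fun_def u_inv_map jacobian_u_inv)

lemma continuous_on_h_fun:
  fixes f :: "real \<times> real \<Rightarrow> complex"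
  assumes "continuous_on (square 1) f"
  shows "continuous_on (closure (u_domain g)) (h_fun f g)"
proof -
  let ?S = "closure (u_domain g)"
  obtain v where v: "homeomorphism D (U ` D) U v" using U_inverse by blast
  have vU: "v (U q) = q" if "q \<in> D" for q using v(1) that by (auto simp: homeomorphism_def)
  have S: "?S = U ` square 1" unfolding u_image using u_map_eq by auto
  have vS: "v ` ?S \<subseteq> square 1" unfolding S using vU square_D by auto
  have cv: "continuous_on ?S v"
    using v square_D unfolding S homeomorphism_def by (auto intro: continuous_on_subset)
  have "continuous_on (square 1) (\<lambda>p. f p * of_real (W / Gx p))"
    using assms continuous_on_subset[OF continuous_on_Gx square_V] nz square_V by (intro continuous_intros) auto
  from continuous_on_compose2[OF this cv vS] have "continuous_on ?S (\<lambda>z. f (v z) * of_real (W / Gx (v z)))" .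
  moreover have "h_fun f g z = f (v z) * of_real (W / Gx (v z))" if "z \<in> ?S" for z
    using that h_fun_eq vU u_map_eq square_D unfolding S by force
  ultimately show ?thesis by (simp cong: continuous_on_cong)
qed

lemma smooth_on_\<Phi>: "smooth_on D \<Phi>"
proof -
  have "C_k_on k D (\<lambda>z. h (- 1, snd z))" if "C_k_on k V h" for k and h :: "real \<times> real \<Rightarrow> real"
    using that
  proof (induction k arbitrary: h)
    case 0
    then have "continuous_on V h" by simp
    moreover have "(- 1, snd z) \<in> V" if "z \<in> D" for z using D_edge[of "fst z" "snd z"] that \<delta>(2) by auto
    ultimately show ?case by simp (rule continuous_on_compose2, auto intro!: continuous_intros)
  next
    case (Suc k)
    show ?case
    proof (rule C_k_on_SucI[OF open_D, where fx = "\<lambda>_. 0" and fy = "\<lambda>z. partial_y V h (- 1, snd z)"])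
      fix z assume "z \<in> D"
      then have "(- 1, snd z) \<in> V" using D_edge[of "fst z" "snd z"] \<delta>(2) by auto
      from C_k_on_has_derivative[OF open_V this Suc.prems]
      have "((\<lambda>z. h (- 1, snd z)) has_derivative (\<lambda>d. grad_map (partial_x V h (- 1, snd z)) (partial_y V h (- 1, snd z)) (0, snd d))) (at z)"
        by (rule has_derivative_compose[of "\<lambda>z. (- 1, snd z)" "\<lambda>d. (0, snd d)", rotated]) (auto intro!: derivative_eq_intros)
      then show "((\<lambda>z. h (- 1, snd z)) has_derivative grad_map 0 (partial_y V h (- 1, snd z))) (at z)"
        by (simp add: grad_map_def)
    next
      show "C_k_on k D (\<lambda>z. partial_y V h (- 1, snd z))" using Suc by simp
    qed (rule C_k_on_const[OF open_D])
  qed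
  then have "smooth_on D (\<lambda>z. - G (- 1, snd z))"
    using smooth_G by (intro smooth_on_bounded_linear[OF open_D bounded_linear_minus[OF bounded_linear_ident]]) (simp add: smooth_on_def)
  from smooth_on_add[OF open_D smooth_on_subset[OF open_V open_D \<delta>(2) smooth_G] this]
  show ?thesis by (simp add: \<Phi>_def[abs_def])
qed

text \<open>Differentiating \<open>q (U z)\<close> gives derivatives of \<open>q\<close> at
  \<open>U z\<close> times smooth coefficients, so the induction runs over all smooth
  \<open>q\<close> at once.\<close>

lemma smooth_on_compose_U:
  fixes q :: "real \<times> real \<Rightarrow> complex"
  assumes "smooth_on UNIV q"
  shows "smooth_on D (\<lambda>z. q (U z))"
proof -
  have sx: "smooth_on D (\<lambda>z. complex_of_real (Gx z / W))"
    unfolding divide_inverse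
    using smooth_on_subset[OF open_V open_D \<delta>(2) smooth_on_partials(1)[OF smooth_G]] by (intro smooth_on_of_real smooth_on_mult smooth_on_const open_D)
  \<comment> \<open>The \<open>y\<close>-coefficient is written as
    \<open>partial_y D \<Phi>\<close>, whose smoothness is known; \<open>py\<close> translates it
    into the expression that occurs in \<open>dU\<close>.\<close>
  have "smooth_on D (\<lambda>z. partial_y D \<Phi> z)" using smooth_on_\<Phi> by (rule smooth_on_partials)
  then have sy: "smooth_on D (\<lambda>z. complex_of_real (partial_y D \<Phi> z / W))"
    unfolding divide_inverse by (intro smooth_on_of_real smooth_on_mult smooth_on_const open_D)
  have py: "partial_y D \<Phi> z = Gy z - Gy (- 1, snd z)" if "z \<in> D" for z
    using partial_y_eq[OF open_D that \<Phi>_has_derivative[OF that]] by simp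
  have "C_k_on k D (\<lambda>z. q (U z))" if "smooth_on UNIV q" for k and q :: "real \<times> real \<Rightarrow> complex"
    using that
  proof (induction k arbitrary: q)
    case 0
    have "continuous_on D U"
      using U_has_derivative by (intro continuous_at_imp_continuous_on ballI has_derivative_continuous) blast
    then show ?case using smooth_on_continuous_on[OF 0] by simp (rule continuous_on_compose2, auto)
  next
    case (Suc k)
    let ?qx = "partial_x UNIV q" and ?qy = "partial_y UNIV q"
    have IH: "C_k_on k D (\<lambda>z. ?qx (U z))" "C_k_on k D (\<lambda>z. ?qy (U z))"
      using Suc smooth_on_partials by blast+
    show ?case
    proof (rule C_k_on_SucI[OF open_D, where fx = "\<lambda>z. of_real (Gx z / W) * ?qx (U z)" and fy = "\<lambda>z. of_real (partial_y D \<Phi> z / W) * ?qx (U z) + ?qy (U z)"])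
      fix z assume z: "z \<in> D"
      have "((\<lambda>z. q (U z)) has_derivative (\<lambda>d. grad_map (?qx (U z)) (?qy (U z)) (dU z d))) (at z)"
        by (rule has_derivative_compose[OF U_has_derivative[OF z] smooth_on_has_derivative[OF open_UNIV UNIV_I Suc.prems]])
      then show "((\<lambda>z. q (U z)) has_derivative grad_map (of_real (Gx z / W) * ?qx (U z)) (of_real (partial_y D \<Phi> z / W) * ?qx (U z) + ?qy (U z))) (at z)"
        by (simp add: grad_map_def dU_def py[OF z] scaleR_conv_of_real algebra_simps)
    next
      show "C_k_on k D (\<lambda>z. of_real (Gx z / W) * ?qx (U z))"
        using sx IH by (intro C_k_on_bilinear[OF open_D bounded_bilinear_mult]) (auto simp: smooth_on_def)
      show "C_k_on k D (\<lambda>z. of_real (partial_y D \<Phi> z / W) * ?qx (U z) + ?qy (U z))"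
        using sy IH by (intro C_k_on_add[OF open_D] C_k_on_bilinear[OF open_D bounded_bilinear_mult]) (auto simp: smooth_on_def)
    qed
  qed
  then show ?thesis using assms by (simp add: smooth_on_def)
qed

lemma partial_x_square_compose:
  fixes q :: "real \<times> real \<Rightarrow> complex"
  assumes q: "smooth_on UNIV q" and z: "z \<in> square 1"
  shows "partial_x (square 1) (\<lambda>z. q (u_map g z)) z = of_real (Gx z / W) * partial_x UNIV q (u_map g z)"
proof -
  obtain x y where xy: "z = (x, y)" by (cases z)
  have zD: "z \<in> D" using z square_D by blast
  have "((\<lambda>z. q (U z)) has_derivative (\<lambda>d. grad_map (partial_x UNIV q (U z)) (partial_y UNIV q (U z)) (dU z d))) (at z)"
    by (rule has_derivative_compose[OF U_has_derivative[OF zD] smooth_on_has_derivative[OF open_UNIV UNIV_I q]])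
  from has_derivative_slice_x[OF this[unfolded xy]]
  have "((\<lambda>t. q (U (t, y))) has_vector_derivative of_real (Gx z / W) * partial_x UNIV q (U z)) (at x)"
    by (simp add: dU_def grad_map_def scaleR_conv_of_real xy)
  then have "((\<lambda>t. q (U (t, y))) has_vector_derivative of_real (Gx z / W) * partial_x UNIV q (U z)) (at x within {-1..1})"
    by (rule has_vector_derivative_at_within)
  then have "((\<lambda>t. q (u_map g (t, y))) has_vector_derivative of_real (Gx z / W) * partial_x UNIV q (U z)) (at x within {-1..1})"
    by (rule has_vector_derivative_transform[rotated 2]) (use z xy u_map_eq in \<open>auto simp: square_def\<close>)
  then show ?thesis using partial_x_square[of x y "\<lambda>z. q (u_map g z)"] z xy u_map_eq[OF z] by simp
qed

end

subsection \<open>The theorem\<close>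

lemma lipschitz_slice:
  fixes f f' :: "real \<Rightarrow> complex"
  assumes "\<And>t. (f has_vector_derivative f' t) (at t)" "\<And>t. norm (f' t) \<le> B"
  shows "norm (f x - f y) \<le> B * \<bar>x - y\<bar>"
proof -
  have "norm (f x - f y) \<le> B * norm (x - y)"
  proof (rule differentiable_bound[where S = UNIV and f' = "\<lambda>t d. d *\<^sub>R f' t"])
    show "onorm (\<lambda>d. d *\<^sub>R f' t) \<le> B" for t
      by (rule onorm_le) (use assms(2)[of t] in \<open>simp add: mult.commute[of B] mult_left_mono\<close>)
  qed (use assms(1) in \<open>auto simp: has_vector_derivative_def\<close>)
  then show ?thesis by simp
qed

lemma fourier_schwartz_regular:
  assumes h: "h \<in> schwartz" and bd: "\<And>\<alpha>. fst \<alpha> + snd \<alpha> \<le> 2 \<Longrightarrow> sup_norm UNIV (deriv_multi \<alpha> (fourier h)) \<le> B"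
  shows "norm (fourier h z) \<le> B"
    and "norm (fourier h (\<xi>, \<eta>) - fourier h (\<xi>', \<eta>)) \<le> B * \<bar>\<xi> - \<xi>'\<bar>"
    and "norm (fourier h (\<xi>, \<eta>) - fourier h (\<xi>, \<eta>')) \<le> B * \<bar>\<eta> - \<eta>'\<bar>"
proof -
  note D = has_derivative_fourier[OF schwartz_measurable[OF h] schwartz_decay[OF h, of "(0, 0)", simplified]]
  have px: "partial_x UNIV (fourier h) = fourier (\<lambda>w. - (\<i> * of_real (fst w)) * h w)"
    and py: "partial_y UNIV (fourier h) = fourier (\<lambda>w. - (\<i> * of_real (snd w)) * h w)"
    using partial_x_eq[OF open_UNIV UNIV_I D] partial_y_eq[OF open_UNIV UNIV_I D] by auto
  \<comment> \<open>\<open>sup_norm\<close> controls values only for bounded functions, the supremum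
    of an unbounded set being unspecified. The derivatives in question are again transforms, hence
    bounded by an integral.\<close>
  have b: "bounded (range (fourier f))" for f
    unfolding bounded_iff using norm_fourier_le by blast
  show "norm (fourier h z) \<le> B"
    using norm_le_sup_norm[OF b, of z h] bd[of "(0, 0)"] by simp
  have bx: "norm (fourier (\<lambda>w. - (\<i> * of_real (fst w)) * h w) z) \<le> B" for z
    using norm_le_sup_norm[OF b, of z] bd[of "(1, 0)"] by (simp add: px) (meson UNIV_I order_trans)
  have by': "norm (fourier (\<lambda>w. - (\<i> * of_real (snd w)) * h w) z) \<le> B" for z
    using norm_le_sup_norm[OF b, of z] bd[of "(0, 1)"] by (simp add: py) (meson UNIV_I order_trans)
  show "norm (fourier h (\<xi>, \<eta>) - fourier h (\<xi>', \<eta>)) \<le> B * \<bar>\<xi> - \<xi>'\<bar>"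
    by (rule lipschitz_slice[OF _ bx, where f = "\<lambda>t. fourier h (t, \<eta>)"]) (use has_derivative_slice_x[OF D] in simp)
  show "norm (fourier h (\<xi>, \<eta>) - fourier h (\<xi>, \<eta>')) \<le> B * \<bar>\<eta> - \<eta>'\<bar>"
    by (rule lipschitz_slice[OF _ by', where f = "\<lambda>t. fourier h (\<xi>, t)"]) (use has_derivative_slice_y[OF D] in simp)
qed

proposition optimal_symbol:
  fixes h :: "real \<times> real \<Rightarrow> complex"
  assumes K: "compact K" "K \<subseteq> square 1" "K \<noteq> {}" and h: "continuous_on K h" and \<epsilon>: "0 < \<epsilon>" "\<epsilon> < 1"
    and W0: "W\<^sub>0 = min_bandlimit K h \<epsilon>" "0 < W\<^sub>0" and W: "0 < W"
  obtains k where "transport_symbol k W\<^sub>0 W (10 * sup_norm K h)"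
    "\<And>z. z \<in> K \<Longrightarrow> norm (EI k z - h z) \<le> \<epsilon> * sup_norm K h"
proof -
  define S where "S = sup_norm K h"
  define X where "X = {c. 0 < c \<and> (\<exists>h\<^sub>b. bandlimited_approx \<epsilon> K h h\<^sub>b \<and> has_bandlimit h\<^sub>b c)}"
  have X: "X \<noteq> {}" using bandlimited_approx_exists[OF K h \<epsilon>] by (auto simp: X_def)
  have W0X: "W\<^sub>0 = Inf X" unfolding W0(1) min_bandlimit_def X_def ..
  have bdd: "bdd_below X" by (rule bdd_belowI[of _ 0]) (auto simp: X_def)
  have "\<exists>c h\<^sub>b. c < W\<^sub>0 + 1 / real (Suc n) \<and> bandlimited_approx \<epsilon> K h h\<^sub>b \<and> has_bandlimit h\<^sub>b c" for n
    using cInf_lessD[OF X, of "W\<^sub>0 + 1 / real (Suc n)"] W0X by (auto simp: X_def)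
  then obtain c hb where c: "\<And>n. c n < W\<^sub>0 + 1 / real (Suc n)" and hb: "\<And>n. bandlimited_approx \<epsilon> K h (hb n)"
    and band: "\<And>n. has_bandlimit (hb n) (c n)"
    by metis
  have sch: "hb n \<in> schwartz" for n using hb by (simp add: bandlimited_approx_def)
  have "sup_norm UNIV (deriv_multi \<alpha> (fourier (hb n))) \<le> 10 * S" if "fst \<alpha> + snd \<alpha> \<le> 2" for n \<alpha>
    using hb[of n] that unfolding bandlimited_approx_def S_def by blast
  note reg = fourier_schwartz_regular[OF sch this]
  have S: "0 \<le> 10 * S" using order_trans[OF norm_ge_zero reg(1)[of 0]] .
  have zero: "fourier (hb n) z = 0" if "z \<notin> square (c n)" for n z
    using band[of n] that closure_subset[of "{z. fourier (hb n) z \<noteq> 0}"] by (auto simp: has_bandlimit_def fun_support_def)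
  have cW: "c n < W\<^sub>0 + 1" for n
  proof -
    have "1 / real (Suc n) \<le> 1" by simp
    then show ?thesis using c[of n] by linarith
  qed
  \<comment> \<open>A common compact set for all transforms, on which Arzela-Ascoli applies.\<close>
  have zero': "fourier (hb n) z = 0" if "z \<notin> square (W\<^sub>0 + 1)" for n z
    using zero[of z n] that cW[of n] by (cases z) (auto simp: square_def)
  \<comment> \<open>Moving first horizontally and then vertically costs \<open>10 * S\<close>
    each.\<close>
  have lip: "norm (fourier (hb n) p - fourier (hb n) p') \<le> 20 * S * norm (p - p')" for n p p'
  proof -
    obtain x y x' y' where p: "p = (x, y)" "p' = (x', y')" by (metis surj_pair)
    have "norm (fourier (hb n) p - fourier (hb n) p') \<le> norm (fourier (hb n) (x, y) - fourier (hb n) (x', y)) + norm (fourier (hb n) (x', y) - fourier (hb n) (x', y'))"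
      unfolding p by (rule order_trans[OF _ norm_triangle_ineq]) simp
    also have "\<dots> \<le> 10 * S * \<bar>x - x'\<bar> + 10 * S * \<bar>y - y'\<bar>" by (intro add_mono reg)
    also have "\<dots> \<le> 10 * S * norm (p - p') + 10 * S * norm (p - p')"
      using S norm_fst_le[of "x - x'" "y - y'"] norm_snd_le[of "y - y'" "x - x'"]
      by (intro add_mono mult_left_mono) (simp_all add: p)
    finally show ?thesis by simp
  qed
  obtain kl r where r: "strict_mono (r :: nat \<Rightarrow> nat)"
    "\<And>e. 0 < e \<Longrightarrow> \<exists>N. \<forall>n x. n \<ge> N \<and> x \<in> square (W\<^sub>0 + 1) \<longrightarrow> norm (fourier (hb (r n)) x - kl x) < e"
  proof (rule Arzela_Ascoli[OF compact_square, of "W\<^sub>0 + 1" "\<lambda>n. fourier (hb n)" "10 * S"])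
    fix x :: "real \<times> real" and e :: real assume e: "0 < e"
    show "\<exists>d>0. \<forall>n y. y \<in> square (W\<^sub>0 + 1) \<and> norm (x - y) < d \<longrightarrow> norm (fourier (hb n) x - fourier (hb n) y) < e"
    \<comment> \<open>The summand \<open>1\<close> keeps the denominator positive also for
      \<open>S = 0\<close>.\<close>
    proof (intro exI[of _ "e / (20 * S + 1)"] conjI allI impI)
      show "0 < e / (20 * S + 1)" using e S by simp
      fix n y assume "y \<in> square (W\<^sub>0 + 1) \<and> norm (x - y) < e / (20 * S + 1)"
      then have "norm (x - y) * (20 * S + 1) < e" using S by (simp add: pos_less_divide_eq)
      moreover have "20 * S * norm (x - y) \<le> norm (x - y) * (20 * S + 1)" by (simp add: algebra_simps)
      ultimately show "norm (fourier (hb n) x - fourier (hb n) y) < e" using lip[of n x y] by linarith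
    qed
  qed (use reg(1) in auto)
  \<comment> \<open>The uniform limit is controlled on the compact square only; outside it all
    transforms vanish, so \<open>0\<close> is the pointwise limit there.\<close>
  define k where "k z = (if z \<in> square (W\<^sub>0 + 1) then kl z else 0)" for z
  have lim: "(\<lambda>n. fourier (hb (r n)) z) \<longlonglongrightarrow> k z" for z
  proof (cases "z \<in> square (W\<^sub>0 + 1)")
    case True
    have "\<exists>N. \<forall>n\<ge>N. norm (fourier (hb (r n)) z - kl z) < e" if "0 < e" for e
      using r(2)[OF that] True by blast
    then show ?thesis using True by (simp add: k_def LIMSEQ_iff)
  qed (simp add: k_def zero')
  have meas: "fourier (hb n) \<in> borel_measurable borel" for n by (rule fourier_schwartz_measurable[OF sch])
  have k_meas: "k \<in> borel_measurable borel"
    by (rule borel_measurable_LIMSEQ_metric[OF meas lim])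
  have k_bound: "norm (k z) \<le> 10 * S" for z
    using reg(1) by (intro LIMSEQ_le_const2[OF tendsto_norm[OF lim]]) auto
  have k_lip: "norm (k (\<xi>, \<eta>) - k (\<xi>', \<eta>)) \<le> 10 * S * \<bar>\<xi> - \<xi>'\<bar>" for \<xi> \<xi>' \<eta>
    using reg(2) by (intro LIMSEQ_le_const2[OF tendsto_norm[OF tendsto_diff[OF lim lim]]]) auto
  have k_zero: "k z = 0" if "z \<notin> square W\<^sub>0" for z
  proof -
    \<comment> \<open>A point outside the limiting band is at positive distance from it in the
      maximum norm, so from some index on it lies outside the approximating bands.\<close>
    define \<mu> where "\<mu> = max \<bar>fst z\<bar> \<bar>snd z\<bar>"
    have sq: "z \<in> square a \<longleftrightarrow> \<mu> \<le> a" for a by (cases z) (auto simp: square_def \<mu>_def)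
    then have "0 < \<mu> - W\<^sub>0" using that by simp
    then obtain N where N: "1 / real (Suc N) < \<mu> - W\<^sub>0" using nat_approx_posE by blast
    have "fourier (hb (r n)) z = 0" if "N \<le> n" for n
    proof (rule zero)
      have "N \<le> r n" using that seq_suble[OF r(1), of n] by simp
      then have "1 / real (Suc (r n)) \<le> 1 / real (Suc N)" by (intro divide_left_mono) auto
      then have "c (r n) < \<mu>" using c[of "r n"] N by linarith
      then show "z \<notin> square (c (r n))" using sq by simp
    qed
    then have "(\<lambda>n. fourier (hb (r n)) z) \<longlonglongrightarrow> 0"
      by (intro tendsto_eventually) (auto simp: eventually_sequentially)
    then show ?thesis using lim LIMSEQ_unique by blast
  qed
  \<comment> \<open>Bounded pointwise convergence of the transforms on a bounded set passes to the
    inverse transforms, which are the approximations themselves.\<close>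
  have conv: "(\<lambda>n. hb (r n) z) \<longlonglongrightarrow> EI k z" for z
  proof -
    have "(\<lambda>n. EI (fourier (hb (r n))) z) \<longlonglongrightarrow> EI k z"
      unfolding EI_def
    proof (rule integral_dominated_convergence[where w = "\<lambda>w. 10 * S * indicator (square (W\<^sub>0 + 1)) w"])
      show "integrable lborel (\<lambda>w. 10 * S * indicator (square (W\<^sub>0 + 1)) w :: real)"
        using W0(2) by (intro integrable_indicator_square) simp
      show "AE w in lborel. (\<lambda>n. fourier (hb (r n)) w * cis (fst w * fst z + snd w * snd z)) \<longlonglongrightarrow> k w * cis (fst w * fst z + snd w * snd z)"
        by (intro always_eventually allI tendsto_mult_right lim)
      show "AE w in lborel. norm (fourier (hb (r n)) w * cis (fst w * fst z + snd w * snd z)) \<le> 10 * S * indicator (square (W\<^sub>0 + 1)) w" for n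
        using reg(1) zero' by (intro always_eventually allI) (auto simp: norm_mult indicator_def)
    qed (use meas k_meas in measurable)
    then show ?thesis by (simp add: schwartz_inversion[OF sch])
  qed
  have close: "norm (EI k z - h z) \<le> \<epsilon> * S" if "z \<in> K" for z
  proof (rule LIMSEQ_le_const2[OF tendsto_norm[OF tendsto_diff[OF conv tendsto_const]]], intro exI allI impI)
    fix n
    have "continuous_on K (\<lambda>z. hb (r n) z - h z)"
      using continuous_on_subset[OF smooth_on_continuous_on[OF schwartz_smooth[OF sch]]] h by (intro continuous_intros) auto
    then have "bounded ((\<lambda>z. hb (r n) z - h z) ` K)" using K(1) by (intro compact_imp_bounded compact_continuous_image)
    from norm_le_sup_norm[OF this that] hb[of "r n"] show "norm (hb (r n) z - h z) \<le> \<epsilon> * S"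
      unfolding bandlimited_approx_def S_def by linarith
  qed
  show ?thesis
  proof (rule that)
    show "transport_symbol k W\<^sub>0 W (10 * sup_norm K h)"
      by unfold_locales (use W0(2) W k_bound k_lip k_zero k_meas in \<open>auto simp: S_def\<close>)
  qed (use close in \<open>simp add: S_def\<close>)
qed

theorem theorem3p3:
  shows "\<exists>C :: real \<Rightarrow> real.
    \<forall>(f :: real \<times> real \<Rightarrow> complex) (g :: real \<times> real \<Rightarrow> real) (\<epsilon> :: real) (W\<^sub>0 :: real).
      (\<exists>U F. smooth_extension (square 1) f U F) \<and>
      (\<exists>V G. smooth_extension (square 1) g V G \<and> (\<forall>z\<in>V. partial_x V G z \<noteq> 0)) \<and>
      0 < \<epsilon> \<and> \<epsilon> < 1 \<and>
      W\<^sub>0 = min_bandlimit (closure (u_domain g)) (h_fun f g) \<epsilon> \<and> 0 < W\<^sub>0 \<longrightarrow>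
      (\<exists>p\<^sub>b :: real \<times> real \<Rightarrow> complex.
        (\<exists>V P. smooth_extension (square 1) p\<^sub>b V P) \<and>
        (\<exists>F. entire2 F \<and> tempered_fun (real_restriction F) \<and>
           (\<forall>z\<in>closure (u_domain g). p\<^sub>b (u_inv g z) = real_restriction F z) \<and>
           order_at_most (fourier_dist (dist_of_fun (real_restriction F))) 1 \<and>
           dist_support (fourier_dist (dist_of_fun (real_restriction F))) \<subseteq> square W\<^sub>0) \<and>
        (\<forall>z\<in>square 1.
           norm (partial_x (square 1) p\<^sub>b z + \<i> * of_real (g_x g z) * p\<^sub>b z - f z)
             \<le> \<epsilon> * (G_max g / G_min g) * sup_norm (square 1) f) \<and>
        sup_norm (square 1) p\<^sub>b
          \<le> C W\<^sub>0 * (W_of g / G_min g) * min 1 (1 / W_of g) * sup_norm (square 1) f \<and>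
        sup_norm (square 1) (partial_x (square 1) p\<^sub>b)
          \<le> C W\<^sub>0 * (G_max g / G_min g) * min 1 (1 / W_of g) * sup_norm (square 1) f)"
proof (intro exI[of _ "\<lambda>W\<^sub>0. 10 * ((1 + 2 * W\<^sub>0) * (12 * W\<^sub>0\<^sup>2 + 24 * W\<^sub>0 ^ 3))"] allI impI, elim conjE)
  fix f :: "real \<times> real \<Rightarrow> complex" and g :: "real \<times> real \<Rightarrow> real" and \<epsilon> W\<^sub>0 :: real
  assume f: "\<exists>U F. smooth_extension (square 1) f U F"
    and g: "\<exists>V G. smooth_extension (square 1) g V G \<and> (\<forall>z\<in>V. partial_x V G z \<noteq> 0)"
    and \<epsilon>: "0 < \<epsilon>" "\<epsilon> < 1" and W0: "W\<^sub>0 = min_bandlimit (closure (u_domain g)) (h_fun f g) \<epsilon>" "0 < W\<^sub>0"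
  obtain V G where "smooth_extension (square 1) g V G" "\<And>z. z \<in> V \<Longrightarrow> partial_x V G z \<noteq> 0" using g by blast
  then interpret phase_function g G V by unfold_locales
  have cont_f: "continuous_on (square 1) f"
  proof -
    obtain N F where F: "smooth_on N F" "square 1 \<subseteq> N" "\<And>z. z \<in> square 1 \<Longrightarrow> F z = f z"
      using f by (auto simp: smooth_extension_def)
    have "continuous_on (square 1) F" using continuous_on_subset[OF smooth_on_continuous_on[OF F(1)] F(2)] .
    then show ?thesis using F(3) by (simp cong: continuous_on_cong)
  qed
  have "bounded (f ` square 1)" by (intro compact_imp_bounded compact_continuous_image cont_f compact_square)
  then have f_le: "norm (f p) \<le> sup_norm (square 1) f" if "p \<in> square 1" for p using that by (rule norm_le_sup_norm)
  let ?K = "closure (u_domain g)" and ?h = "h_fun f g" and ?f = "sup_norm (square 1) f" and ?m = "min 1 (1 / W)"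
  define S where "S = sup_norm ?K ?h"
  have uK: "u_map g p \<in> ?K" if "p \<in> square 1" for p using that by (simp add: u_image)
  have K: "compact ?K" "?K \<noteq> {}"
  proof -
    show "compact ?K"
      using compact_square[of 1] u_image_square by (metis closed_closure compact_Int_closed inf.absorb_iff2)
    show "?K \<noteq> {}" using square_nonempty by (simp add: u_image)
  qed
  obtain k where k: "transport_symbol k W\<^sub>0 W (10 * S)" "\<And>z. z \<in> ?K \<Longrightarrow> norm (EI k z - ?h z) \<le> \<epsilon> * S"
    using optimal_symbol[OF K(1) u_image_square K(2) continuous_on_h_fun[OF cont_f] \<epsilon> W0 W_pos] unfolding S_def by blast
  interpret T: transport_symbol k W\<^sub>0 W "10 * S" by (rule k(1))
  \<comment> \<open>On the image of the square \<open>h\<close> is \<open>f\<close> times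
    \<open>W / g_x\<close>; this is where \<open>G_min g\<close> enters.\<close>
  have S_le: "S \<le> W / G_min g * ?f"
    unfolding S_def
  proof (rule sup_norm_leI[OF K(2)])
    fix z assume "z \<in> ?K"
    then obtain p where p: "p \<in> square 1" "z = u_map g p" by (auto simp: u_image)
    have "norm (?h z) = W / \<bar>Gx p\<bar> * norm (f p)"
      using p W_pos by (simp add: h_fun_eq norm_mult norm_divide)
    also have "\<dots> \<le> W / G_min g * ?f"
      using G_min_le[OF p(1)] G_min_pos W_pos f_le[OF p(1)] by (intro mult_mono divide_left_mono) auto
    finally show "norm (?h z) \<le> W / G_min g * ?f" .
  qed
  have S0: "0 \<le> S" using T.B by simp
  define p where "p z = T.sol (u_map g z)" for z
  have px: "partial_x (square 1) p z = of_real (Gx z / W) * partial_x UNIV T.sol (u_map g z)" if "z \<in> square 1" for z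
    using partial_x_square_compose[OF T.smooth_on_sol that] by (simp add: p_def[abs_def])
  \<comment> \<open>The constant of \<open>sol_bounds\<close>; the further \<open>10\<close> in the
    final constant is the one in the bound \<open>10 * S\<close> for the symbol.\<close>
  let ?C = "(1 + 2 * W\<^sub>0) * (12 * W\<^sub>0\<^sup>2 + 24 * W\<^sub>0 ^ 3)"
  have C0: "0 \<le> ?C * ?m" using W0(2) W_pos by simp
  have u1: "\<bar>fst (u_map g z)\<bar> \<le> 1" if "z \<in> square 1" for z
    using subsetD[OF u_image_square uK[OF that]] by (cases "u_map g z") (auto simp: square_def)
  have "smooth_extension (square 1) p D (\<lambda>z. T.sol (U z))"
    unfolding smooth_extension_def p_def
    using open_D square_D smooth_on_compose_U[OF T.smooth_on_sol] u_map_eq by auto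
  moreover have "entire2 T.sol_ext \<and> tempered_fun (real_restriction T.sol_ext) \<and>
    (\<forall>z\<in>?K. p (u_inv g z) = real_restriction T.sol_ext z) \<and>
    order_at_most (fourier_dist (dist_of_fun (real_restriction T.sol_ext))) 1 \<and>
    dist_support (fourier_dist (dist_of_fun (real_restriction T.sol_ext))) \<subseteq> square W\<^sub>0"
    unfolding T.sol_real_restriction using T.entire_sol T.tempered_fun_sol T.order_fourier_sol T.support_fourier_sol
    by (auto simp: p_def u_image u_inv_map)
  moreover have "norm (partial_x (square 1) p z + \<i> * of_real (g_x g z) * p z - f z) \<le> \<epsilon> * (G_max g / G_min g) * ?f"
    if z: "z \<in> square 1" for z
  proof -
    have nzz: "Gx z \<noteq> 0" using nz square_V z by blast
    \<comment> \<open>By the chain rule the operator becomes \<open>g_x / W\<close> times the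
      transported one, and \<open>f\<close> is \<open>g_x / W\<close> times \<open>h\<close>. The
      error \<open>\<epsilon> * S\<close> is thus multiplied by at most \<open>G_max g / W\<close>,
      whose \<open>W\<close> cancels against the one in \<open>S_le\<close>.\<close>
    have "partial_x (square 1) p z + \<i> * of_real (g_x g z) * p z - f z =
        of_real (Gx z / W) * (partial_x UNIV T.sol (u_map g z) + \<i> * of_real W * T.sol (u_map g z)) - f z"
      using W_pos unfolding px[OF z] g_x_eq[OF z] p_def by (simp add: field_simps)
    also have "\<dots> = of_real (Gx z / W) * (EI k (u_map g z) - ?h (u_map g z))"
      unfolding T.sol_ode h_fun_eq[OF z] using W_pos nzz by (simp add: field_simps)
    also have "norm \<dots> = \<bar>Gx z\<bar> / W * norm (EI k (u_map g z) - ?h (u_map g z))"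
      using W_pos by (simp add: norm_mult norm_divide)
    also have "\<dots> \<le> G_max g / W * (\<epsilon> * (W / G_min g * ?f))"
      using G_max_ge[OF z] W_pos order_trans[OF k(2)[OF uK[OF z]] mult_left_mono[OF S_le]] \<epsilon>(1)
      by (intro mult_mono divide_right_mono) auto
    also have "\<dots> = \<epsilon> * (G_max g / G_min g) * ?f" using W_pos by simp
    finally show ?thesis .
  qed
  moreover have "sup_norm (square 1) p \<le> 10 * ?C * (W / G_min g) * ?m * ?f"
  proof (rule sup_norm_leI[OF square_nonempty])
    fix z :: "real \<times> real" assume z: "z \<in> square 1"
    have "norm (p z) \<le> ?C * ?m * (10 * S)" unfolding p_def by (rule T.sol_bounds(1)[OF u1[OF z]])
    also have "\<dots> \<le> ?C * ?m * (10 * (W / G_min g * ?f))" using S_le C0 by (intro mult_left_mono) auto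
    also have "\<dots> = 10 * ?C * (W / G_min g) * ?m * ?f" by (simp only: mult_ac)
    finally show "norm (p z) \<le> 10 * ?C * (W / G_min g) * ?m * ?f" .
  qed
  moreover have "sup_norm (square 1) (partial_x (square 1) p) \<le> 10 * ?C * (G_max g / G_min g) * ?m * ?f"
  proof (rule sup_norm_leI[OF square_nonempty])
    fix z :: "real \<times> real" assume z: "z \<in> square 1"
    have "norm (partial_x UNIV T.sol (u_map g z)) \<le> ?C * ?m * (10 * S)" by (rule T.sol_bounds(2)[OF u1[OF z]])
    also have "\<dots> \<le> ?C * ?m * (10 * (W / G_min g * ?f))" using S_le C0 by (intro mult_left_mono) auto
    \<comment> \<open>The chain rule factor \<open>1 / W\<close> cancels the \<open>W\<close> of
      \<open>S_le\<close>, which remains in the bound for \<open>p\<close> itself.\<close>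
    finally have "\<bar>Gx z\<bar> / W * norm (partial_x UNIV T.sol (u_map g z)) \<le> G_max g / W * (?C * ?m * (10 * (W / G_min g * ?f)))"
      using G_max_ge[OF z] W_pos by (intro mult_mono divide_right_mono) auto
    also have "\<dots> = 10 * ?C * (G_max g / G_min g) * ?m * ?f" using W_pos by simp
    finally show "norm (partial_x (square 1) p z) \<le> 10 * ?C * (G_max g / G_min g) * ?m * ?f"
      using W_pos unfolding px[OF z] norm_mult by (simp add: norm_divide)
  qed
  ultimately show "\<exists>p\<^sub>b :: real \<times> real \<Rightarrow> complex.
        (\<exists>V P. smooth_extension (square 1) p\<^sub>b V P) \<and>
        (\<exists>F. entire2 F \<and> tempered_fun (real_restriction F) \<and>
           (\<forall>z\<in>closure (u_domain g). p\<^sub>b (u_inv g z) = real_restriction F z) \<and>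
           order_at_most (fourier_dist (dist_of_fun (real_restriction F))) 1 \<and>
           dist_support (fourier_dist (dist_of_fun (real_restriction F))) \<subseteq> square W\<^sub>0) \<and>
        (\<forall>z\<in>square 1.
           norm (partial_x (square 1) p\<^sub>b z + \<i> * of_real (g_x g z) * p\<^sub>b z - f z)
             \<le> \<epsilon> * (G_max g / G_min g) * sup_norm (square 1) f) \<and>
        sup_norm (square 1) p\<^sub>b
          \<le> 10 * ((1 + 2 * W\<^sub>0) * (12 * W\<^sub>0\<^sup>2 + 24 * W\<^sub>0 ^ 3)) * (W_of g / G_min g) * min 1 (1 / W_of g) * sup_norm (square 1) f \<and>
        sup_norm (square 1) (partial_x (square 1) p\<^sub>b)
          \<le> 10 * ((1 + 2 * W\<^sub>0) * (12 * W\<^sub>0\<^sup>2 + 24 * W\<^sub>0 ^ 3)) * (G_max g / G_min g) * min 1 (1 / W_of g) * sup_norm (square 1) f"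
    by blast
qed

end
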